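(* Suppose that for each subsolution $w$ the functions $T_c^-w$ and $-T_c^+w$ are locally semiconcave on $M$, and that there exists a subsolution. Then there exists a locally $C^{1,1}$ subsolution which is free and smooth in the complement of $\mathcal{A}$ (in $M$), and strict on the complement of $\overline{\mathcal{A}}$ (in $M\times M$).
   Context: $M$ is a smooth connected Riemannian manifold, and $c:M\times M\to\mathbb{R}$ is a given function (the cost). A function $u:M\to\mathbb{R}$ (not assumed continuous) is called a subsolution if $u(y)-u(x)\leq c(x,y)$ for all $(x,y)\in M\times M$. The discrete Lax--Oleinik operators are $T_c^-u(x)=\inf_{y\in M}\big(u(y)+c(y,x)\big)$ and $T_c^+u(x)=\sup_{y\in M}\big(u(y)-c(x,y)\big)$. A function is locally semiconcave (with linear modulus) if each point has a chart neighbourhood in which the function is the sum of a concave function and a smooth function. A function is locally $C^{1,1}$ if it is $C^1$ with locally Lipschitz differential. A subsolution $u$ is free at $x$ if $T_c^+u(x)<u(x)<T_c^-u(x)$, and strict at $(x,y)$ if $u(y)-u(x)<c(x,y)$; it is free (resp. strict) on a set if it is so at each element of the set. For a subsolution $u$, $\mathcal{A}_u=\{x\in M : T_c^+u(x)=u(x)=T_c^-u(x)\}$ and $\overline{\mathcal{A}}_u=\{(x,y)\in M\times M : u(y)-u(x)=c(x,y)\}$. The Aubry set is $\mathcal{A}=\bigcap_u\mathcal{A}_u\subset M$, and $\overline{\mathcal{A}}=\bigcap_u\overline{\mathcal{A}}_u\subset M\times M$, both intersections being over all subsolutions $u$. (The bar is notation, not closure.) *)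

theory Defs
  imports "HOL-Analysis.Analysis"
begin

section \<open>Smooth functions on open sets of normed spaces\<close>

text \<open>
  The class $C^k$ on an open set: for finite-dimensional domains it is enough that all
  directional derivatives of the (Frechet) differentiable function are of class $C^{k-1}$.
  Both definitions below are only meant for open \<open>S\<close>.
\<close>

primrec Ck_on :: "nat \<Rightarrow> 'a::euclidean_space set \<Rightarrow> ('a \<Rightarrow> 'b::real_normed_vector) \<Rightarrow> bool" where
  "Ck_on 0 S f \<longleftrightarrow> continuous_on S f"
| "Ck_on (Suc k) S f \<longleftrightarrow>
     (\<forall>x\<in>S. f differentiable (at x)) \<and> (\<forall>v. Ck_on k S (\<lambda>x. frechet_derivative f (at x) v))"

definition smooth_on :: "'a::euclidean_space set \<Rightarrow> ('a \<Rightarrow> 'b::real_normed_vector) \<Rightarrow> bool" where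
  "smooth_on S f \<longleftrightarrow> (\<forall>k. Ck_on k S f)"

definition locally_C11_on :: "'a::euclidean_space set \<Rightarrow> ('a \<Rightarrow> real) \<Rightarrow> bool" where
  "locally_C11_on S f \<longleftrightarrow>
     (\<exists>D :: 'a \<Rightarrow> 'a \<Rightarrow>\<^sub>L real.
        (\<forall>x\<in>S. (f has_derivative blinfun_apply (D x)) (at x)) \<and>
        continuous_on S D \<and>
        (\<forall>x\<in>S. \<exists>e>0. \<exists>L. L-lipschitz_on (ball x e \<inter> S) D))"


section \<open>Smooth and Riemannian manifolds\<close>

text \<open>
  The manifold is a whole type \<open>'m\<close>, which carries its topology; the smooth structure is given
  by an atlas modelled on a Euclidean space \<open>'e\<close>. A chart \<open>(U, \<phi>)\<close> consists of its domain and
  its coordinate map; the values of \<open>\<phi>\<close> outside \<open>U\<close> are irrelevant.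
\<close>

type_synonym ('m, 'e) chart = "'m set \<times> ('m \<Rightarrow> 'e)"

definition inv_chart :: "('m, 'e) chart \<Rightarrow> 'e \<Rightarrow> 'm" where
  "inv_chart K = inv_into (fst K) (snd K)"

definition chart_image :: "('m, 'e) chart \<Rightarrow> 'e set" where
  "chart_image K = snd K ` fst K"

definition is_chart :: "('m::topological_space, 'e::euclidean_space) chart \<Rightarrow> bool" where
  "is_chart K \<longleftrightarrow>
     open (fst K) \<and> open (chart_image K) \<and>
     homeomorphism (fst K) (chart_image K) (snd K) (inv_chart K)"

definition smooth_transition ::
    "('m, 'e::euclidean_space) chart \<Rightarrow> ('m, 'e) chart \<Rightarrow> bool" where
  "smooth_transition K L \<longleftrightarrow> smooth_on (snd K ` (fst K \<inter> fst L)) (snd L \<circ> inv_chart K)"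

definition smooth_atlas :: "('m::topological_space, 'e::euclidean_space) chart set \<Rightarrow> bool" where
  "smooth_atlas A \<longleftrightarrow>
     (\<forall>K\<in>A. is_chart K) \<and> (\<Union>K\<in>A. fst K) = UNIV \<and> (\<forall>K\<in>A. \<forall>L\<in>A. smooth_transition K L)"

definition maximal_atlas ::
    "('m::topological_space, 'e::euclidean_space) chart set \<Rightarrow> ('m, 'e) chart set" where
  "maximal_atlas A =
     {K. is_chart K \<and> (\<forall>L\<in>A. smooth_transition K L \<and> smooth_transition L K)}"

text \<open>
  A metric is given by its local expressions: \<open>g K p v w\<close> is the inner product of the tangent
  vectors at \<open>p\<close> with coordinates \<open>v\<close> and \<open>w\<close> in the chart \<open>K\<close>. The last condition says that
  these expressions define one and the same inner product on the tangent space at \<open>p\<close>.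
\<close>

definition riemannian_metric ::
    "('m::topological_space, 'e::euclidean_space) chart set \<Rightarrow>
     (('m, 'e) chart \<Rightarrow> 'm \<Rightarrow> 'e \<Rightarrow> 'e \<Rightarrow> real) \<Rightarrow> bool" where
  "riemannian_metric A g \<longleftrightarrow>
     (\<forall>K\<in>A. \<forall>p\<in>fst K.
        bilinear (g K p) \<and> (\<forall>v w. g K p v w = g K p w v) \<and> (\<forall>v. v \<noteq> 0 \<longrightarrow> g K p v v > 0)) \<and>
     (\<forall>K\<in>A. \<forall>v w. smooth_on (chart_image K) (\<lambda>x. g K (inv_chart K x) v w)) \<and>
     (\<forall>K\<in>A. \<forall>L\<in>A. \<forall>p\<in>fst K \<inter> fst L. \<forall>v w.
        (let D = frechet_derivative (snd L \<circ> inv_chart K) (at (snd K p))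
         in g K p v w = g L p (D v) (D w)))"

definition connected_riemannian_manifold ::
    "('m::{t2_space, second_countable_topology}, 'e::euclidean_space) chart set \<Rightarrow>
     (('m, 'e) chart \<Rightarrow> 'm \<Rightarrow> 'e \<Rightarrow> 'e \<Rightarrow> real) \<Rightarrow> bool" where
  "connected_riemannian_manifold A g \<longleftrightarrow>
     smooth_atlas A \<and> riemannian_metric A g \<and> connected (UNIV :: 'm set)"


section \<open>Regularity of functions on a manifold\<close>

text \<open>Smoothness in a set means smoothness near each of its points.\<close>

definition mfd_smooth_on ::
    "('m::topological_space, 'e::euclidean_space) chart set \<Rightarrow> 'm set \<Rightarrow> ('m \<Rightarrow> real) \<Rightarrow> bool" where
  "mfd_smooth_on A W f \<longleftrightarrow>
     (\<forall>K\<in>A. \<forall>p\<in>fst K \<inter> W.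
        \<exists>N. open N \<and> snd K p \<in> N \<and> N \<subseteq> chart_image K \<and> smooth_on N (f \<circ> inv_chart K))"

definition mfd_locally_C11 ::
    "('m::topological_space, 'e::euclidean_space) chart set \<Rightarrow> ('m \<Rightarrow> real) \<Rightarrow> bool" where
  "mfd_locally_C11 A f \<longleftrightarrow> (\<forall>K\<in>A. locally_C11_on (chart_image K) (f \<circ> inv_chart K))"

text \<open>
  The chart ranges over the maximal atlas, so that it may be restricted to a smaller domain;
  \<open>concave_on\<close> includes the convexity of the chart image.
\<close>

definition locally_semiconcave ::
    "('m::topological_space, 'e::euclidean_space) chart set \<Rightarrow> ('m \<Rightarrow> real) \<Rightarrow> bool" where
  "locally_semiconcave A f \<longleftrightarrow>
     (\<forall>p. \<exists>K\<in>maximal_atlas A. p \<in> fst K \<and>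
        (\<exists>h s. concave_on (chart_image K) h \<and> smooth_on (chart_image K) s \<and>
               (\<forall>x\<in>chart_image K. f (inv_chart K x) = h x + s x)))"


section \<open>Subsolutions, Lax--Oleinik operators and Aubry sets\<close>

type_synonym 'm cost = "'m \<Rightarrow> 'm \<Rightarrow> real"

definition subsolution :: "'m cost \<Rightarrow> ('m \<Rightarrow> real) \<Rightarrow> bool" where
  "subsolution c u \<longleftrightarrow> (\<forall>x y. u y - u x \<le> c x y)"

text \<open>
  The operators are only applied to subsolutions, for which the infimum and the supremum are
  finite (the two lemmas below).
\<close>

definition T_minus :: "'m cost \<Rightarrow> ('m \<Rightarrow> real) \<Rightarrow> 'm \<Rightarrow> real" where
  "T_minus c u x = (INF y. u y + c y x)"

definition T_plus :: "'m cost \<Rightarrow> ('m \<Rightarrow> real) \<Rightarrow> 'm \<Rightarrow> real" where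
  "T_plus c u x = (SUP y. u y - c x y)"

lemma subsolution_bdd_below: "subsolution c u \<Longrightarrow> bdd_below (range (\<lambda>y. u y + c y x))"
  unfolding subsolution_def by (intro bdd_belowI2[where m = "u x"]) (simp add: algebra_simps)

lemma subsolution_bdd_above: "subsolution c u \<Longrightarrow> bdd_above (range (\<lambda>y. u y - c x y))"
  unfolding subsolution_def by (intro bdd_aboveI2[where M = "u x"]) (simp add: algebra_simps)

definition free_on :: "'m cost \<Rightarrow> ('m \<Rightarrow> real) \<Rightarrow> 'm set \<Rightarrow> bool" where
  "free_on c u W \<longleftrightarrow> (\<forall>x\<in>W. T_plus c u x < u x \<and> u x < T_minus c u x)"

definition strict_on :: "'m cost \<Rightarrow> ('m \<Rightarrow> real) \<Rightarrow> ('m \<times> 'm) set \<Rightarrow> bool" where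
  "strict_on c u W \<longleftrightarrow> (\<forall>(x, y)\<in>W. u y - u x < c x y)"

definition Aubry_of :: "'m cost \<Rightarrow> ('m \<Rightarrow> real) \<Rightarrow> 'm set" where
  "Aubry_of c u = {x. T_plus c u x = u x \<and> u x = T_minus c u x}"

definition Aubry2_of :: "'m cost \<Rightarrow> ('m \<Rightarrow> real) \<Rightarrow> ('m \<times> 'm) set" where
  "Aubry2_of c u = {(x, y). u y - u x = c x y}"

definition Aubry :: "'m cost \<Rightarrow> 'm set" where
  "Aubry c = (\<Inter>u\<in>{u. subsolution c u}. Aubry_of c u)"

definition Aubry2 :: "'m cost \<Rightarrow> ('m \<times> 'm) set" where
  "Aubry2 c = (\<Inter>u\<in>{u. subsolution c u}. Aubry2_of c u)"

end

theory Submission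
  imports Defs
begin

text \<open>
  The statement reduces to an insertion problem in which the cost no longer appears, and that
  problem is solved by smoothing at the scale given by the gap.

  \<^emph>\<open>Reduction.\<close> If \<open>f\<close> is a subsolution, every function between \<open>f\<close> and \<open>T_minus c f\<close> is again a
  subsolution (\<open>subsolution_above\<close>), and where it lies strictly between the two it is free. So no
  inequality involving the cost has to be preserved by a regularization: it suffices to choose \<open>f\<close>
  well and to interpolate. Take \<open>f = T_plus c u\<close> and \<open>h = T_minus c f\<close>, so that \<open>-f\<close> and \<open>h\<close> are
  locally semiconcave by hypothesis. On the Aubry set \<open>f = u = h\<close> for every subsolution \<open>u\<close>; off it
  \<open>f < h\<close> as soon as \<open>T_plus c u < u\<close> there, because \<open>u \<le> h\<close>. Strictness at \<open>(x, y)\<close> is then automatic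
  when \<open>x\<close> or \<open>y\<close> lies off the Aubry set, from \<open>h y \<le> f x + c x y\<close>, and on the Aubry set the
  interpolating function equals \<open>u\<close>, so that only \<open>u\<close> has to be strict there. A subsolution \<open>u\<close> with
  these two properties is a countable weighted sum of continuous subsolutions
  (\<open>extremal_subsolution\<close>). Applying \<open>T_plus\<close> restores the regularity, so the sum has to converge only
  pointwise.

  \<^emph>\<open>Insertion.\<close> It remains to find, for \<open>f \<le> h\<close> with \<open>-f\<close> and \<open>h\<close> locally semiconcave, a locally
  $C^{1,1}$ function \<open>w\<close> with \<open>f \<le> w \<le> h\<close> which is smooth and strictly between where \<open>f < h\<close>. Let
  \<open>\<rho> = sqrt (h - f)\<close>. Since \<open>h - f\<close> is nonnegative and semiconcave, \<open>\<rho>\<close> is locally Lipschitz and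
  controls the difference between supergradients of \<open>h\<close> and subgradients of \<open>f\<close>. Hence on a ball of
  radius a small multiple of \<open>\<rho> x\<close> around \<open>x\<close>, an affine function whose slope is a subgradient of \<open>f\<close> at
  \<open>x\<close> fits strictly between \<open>f\<close> and \<open>h\<close>. Blending these affine functions by bumps of the same size,
  placed on dyadic lattices so that a bounded number of them overlap, gives a smooth function:
  neighbouring affine functions differ by \<open>O(\<rho>\<^sup>2)\<close> in value and \<open>O(\<rho>)\<close> in slope, while the bumps
  have derivatives of size \<open>1/\<rho>\<close> and \<open>1/\<rho>\<^sup>2\<close>, so the second derivative of the blend stays bounded up
  to the contact set (\<open>blend_expansion\<close>). The local solutions are glued by a partition of unity,
  which preserves all the requirements because they are convex (\<open>insertion\<close>).

  \<^emph>\<open>Regularity.\<close> All second-order regularity is expressed by one condition on germs, being touched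
  from above by paraboloids of bounded opening (\<open>semiconcave_at\<close>). It is stable under smooth changes of
  variables, sums and products with nonnegative smooth functions, and a function is locally $C^{1,1}$ as
  soon as it and its negative satisfy it (\<open>locally_C11_onI\<close>).
\<close>


section \<open>Calculus of smooth functions\<close>

lemma Ck_on_subset: "Ck_on k T f \<Longrightarrow> S \<subseteq> T \<Longrightarrow> Ck_on k S f"
  by (induction k arbitrary: f) (auto intro: continuous_on_subset)

lemma Ck_on_cong:
  assumes "open S" "\<And>x. x \<in> S \<Longrightarrow> f x = g x" "Ck_on k S f"
  shows "Ck_on k S g"
  using assms(2,3)
proof (induction k arbitrary: f g)
  case 0
  then show ?case by (auto intro: continuous_on_eq)
next
  case (Suc k)
  have D: "(g has_derivative frechet_derivative f (at x)) (at x)" if "x \<in> S" for x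
    using Suc.prems that assms(1)
    by (auto simp: frechet_derivative_works intro: has_derivative_transform_within_open)
  then have "frechet_derivative g (at x) = frechet_derivative f (at x)" if "x \<in> S" for x
    using frechet_derivative_at[OF D] that by simp
  then show ?case
    using D Suc.IH[of "\<lambda>x. frechet_derivative f (at x) v" "\<lambda>x. frechet_derivative g (at x) v" for v]
      Suc.prems by (auto simp: differentiable_def)
qed

lemma Ck_on_SucI:
  assumes "open S" "\<And>x. x \<in> S \<Longrightarrow> (f has_derivative f' x) (at x)"
    and "\<And>v. Ck_on k S (\<lambda>x. f' x v)"
  shows "Ck_on (Suc k) S f"
proof -
  have "f' x v = frechet_derivative f (at x) v" if "x \<in> S" for x v
    using frechet_derivative_at[OF assms(2)[OF that]] by simp
  then have "Ck_on k S (\<lambda>x. frechet_derivative f (at x) v)" for v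
    using Ck_on_cong[OF assms(1) _ assms(3), of v "\<lambda>x. frechet_derivative f (at x) v"] by blast
  then show ?thesis using assms(2) by (auto simp: differentiable_def)
qed

lemma Ck_on_SucD:
  "Ck_on (Suc k) S f \<Longrightarrow> x \<in> S \<Longrightarrow> (f has_derivative frechet_derivative f (at x)) (at x)"
  by (simp add: frechet_derivative_works)

lemma Ck_on_lower: "Ck_on (Suc k) S f \<Longrightarrow> Ck_on k S f"
proof (induction k arbitrary: f)
  case 0
  then show ?case
    by (auto intro!: continuous_at_imp_continuous_on differentiable_imp_continuous_within)
next
  case (Suc k)
  from Suc.prems have D: "\<forall>x\<in>S. f differentiable (at x)"
    and E: "\<And>v. Ck_on (Suc k) S (\<lambda>x. frechet_derivative f (at x) v)"
    unfolding Ck_on.simps(2)[of "Suc k"] by blast+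
  from D Suc.IH[OF E] show ?case unfolding Ck_on.simps(2)[of k] by blast
qed

lemma Ck_on_local:
  assumes "\<And>x. x \<in> S \<Longrightarrow> \<exists>T. open T \<and> x \<in> T \<and> Ck_on k T f"
  shows "Ck_on k S f"
  using assms
proof (induction k arbitrary: f)
  case 0
  show ?case
    unfolding Ck_on.simps(1) using 0
    by (intro continuous_at_imp_continuous_on ballI)
       (metis Ck_on.simps(1) continuous_on_eq_continuous_at)
next
  case (Suc k)
  show ?case unfolding Ck_on.simps(2)
  proof (intro conjI allI ballI)
    show "f differentiable at x" if "x \<in> S" for x using Suc.prems[OF that] by auto
    show "Ck_on k S (\<lambda>x. frechet_derivative f (at x) v)" for v
    proof (rule Suc.IH)
      fix x assume "x \<in> S"
      from Suc.prems[OF this] show "\<exists>T. open T \<and> x \<in> T \<and> Ck_on k T (\<lambda>x. frechet_derivative f (at x) v)"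
        by auto
    qed
  qed
qed

lemma Ck_on_const: "Ck_on k S (\<lambda>x. c)"
  by (induction k arbitrary: c) (auto simp: frechet_derivative_const)

lemma Ck_on_bounded_linear_comp:
  assumes "open S" "bounded_linear L" "Ck_on k S f"
  shows "Ck_on k S (\<lambda>x. L (f x))"
  using assms(3)
proof (induction k arbitrary: f)
  case 0
  then show ?case using linear_continuous_on_compose assms(2) by (auto intro: bounded_linear.continuous_on[OF assms(2)])
next
  case (Suc k)
  show ?case
    by (rule Ck_on_SucI[OF assms(1) bounded_linear.has_derivative[OF assms(2) Ck_on_SucD[OF Suc.prems]]])
       (use Suc in auto)
qed

lemma Ck_on_bounded_linear:
  assumes "open S" "bounded_linear L"
  shows "Ck_on k S L"
proof (cases k)
  case 0
  then show ?thesis using assms(2) by (auto intro: linear_continuous_on)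
next
  case (Suc k)
  show ?thesis unfolding Suc
    by (rule Ck_on_SucI[OF assms(1)])
       (auto intro!: bounded_linear_imp_has_derivative assms Ck_on_const)
qed

lemma Ck_on_add:
  assumes "open S" "Ck_on k S f" "Ck_on k S g"
  shows "Ck_on k S (\<lambda>x. f x + g x)"
  using assms(2,3)
proof (induction k arbitrary: f g)
  case 0
  then show ?case by (auto intro: continuous_intros)
next
  case (Suc k)
  show ?case
    by (rule Ck_on_SucI[OF assms(1) has_derivative_add[OF Ck_on_SucD[OF Suc.prems(1)] Ck_on_SucD[OF Suc.prems(2)]]])
       (use Suc in auto)
qed

lemma Ck_on_sum:
  assumes "open S" "\<And>i. i \<in> I \<Longrightarrow> Ck_on k S (f i)"
  shows "Ck_on k S (\<lambda>x. \<Sum>i\<in>I. f i x)"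
  using assms(2)
proof (induction I rule: infinite_finite_induct)
  case (insert i I)
  then show ?case using Ck_on_add[OF assms(1), of k "f i" "\<lambda>x. \<Sum>i\<in>I. f i x"] by simp
qed (simp_all add: Ck_on_const)

lemma Ck_on_scaleR:
  fixes f :: "'a::euclidean_space \<Rightarrow> real"
  assumes "open S" "Ck_on k S f" "Ck_on k S g"
  shows "Ck_on k S (\<lambda>x. f x *\<^sub>R g x)"
  using assms(2,3)
proof (induction k arbitrary: f g)
  case 0
  then show ?case by (auto intro: continuous_intros)
next
  case (Suc k)
  show ?case
    by (rule Ck_on_SucI[OF assms(1) has_derivative_scaleR[OF Ck_on_SucD[OF Suc.prems(1)] Ck_on_SucD[OF Suc.prems(2)]]])
       (use Suc Ck_on_lower[OF Suc.prems(1)] Ck_on_lower[OF Suc.prems(2)] in \<open>auto intro!: Ck_on_add assms(1)\<close>)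
qed

lemma linear_sum_Basis:
  fixes v :: "'a::euclidean_space"
  assumes "linear D"
  shows "D v = (\<Sum>b\<in>Basis. (v \<bullet> b) *\<^sub>R D b)"
proof -
  have "D v = D (\<Sum>b\<in>Basis. (v \<bullet> b) *\<^sub>R b)" by (simp add: euclidean_representation)
  also have "\<dots> = (\<Sum>b\<in>Basis. (v \<bullet> b) *\<^sub>R D b)"
    by (simp add: linear_sum[OF assms] linear_scale[OF assms])
  finally show ?thesis .
qed

text \<open>
  The derivative of a composition, expanded in a basis, is a sum of products of directional
  derivatives of \<open>f\<close> composed with \<open>g\<close> and components of the derivative of \<open>g\<close>. The induction on \<open>k\<close>
  therefore needs no higher derivatives as multilinear maps.
\<close>

lemma Ck_on_compose:
  fixes f :: "'b::euclidean_space \<Rightarrow> 'c::real_normed_vector" and g :: "'a::euclidean_space \<Rightarrow> 'b"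
  assumes "open S" "open T" "g ` S \<subseteq> T" "Ck_on k T f" "Ck_on k S g"
  shows "Ck_on k S (\<lambda>x. f (g x))"
  using assms(4,5)
proof (induction k arbitrary: f)
  case 0
  then show ?case using continuous_on_compose2[of T f S g] assms(3) by auto
next
  case (Suc k)
  let ?F = "\<lambda>x. frechet_derivative f (at (g x))" and ?G = "\<lambda>x. frechet_derivative g (at x)"
  have Df: "(f has_derivative ?F x) (at (g x))" and Dg: "(g has_derivative ?G x) (at x)" if "x \<in> S" for x
    using Ck_on_SucD Suc.prems that assms(3) by blast+
  show ?case
  proof (rule Ck_on_SucI[OF assms(1)])
    show "((\<lambda>x. f (g x)) has_derivative (\<lambda>v. ?F x (?G x v))) (at x)" if "x \<in> S" for x
      using has_derivative_compose[OF Dg Df, OF that that] .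
    have "Ck_on k S (\<lambda>x. \<Sum>b\<in>Basis. (?G x v \<bullet> b) *\<^sub>R ?F x b)" for v
    proof (intro Ck_on_sum Ck_on_scaleR assms(1))
      fix b :: 'b
      have "Ck_on k S (\<lambda>x. ?G x v)" using Suc.prems by simp
      then show "Ck_on k S (\<lambda>x. ?G x v \<bullet> b)"
        using Ck_on_bounded_linear_comp[OF assms(1) bounded_linear_inner_left] by blast
      show "Ck_on k S (\<lambda>x. ?F x b)"
        using Suc.IH[of "\<lambda>y. frechet_derivative f (at y) b"] Suc.prems Ck_on_lower by auto
    qed
    moreover have "(\<Sum>b\<in>Basis. (?G x v \<bullet> b) *\<^sub>R ?F x b) = ?F x (?G x v)" if "x \<in> S" for x v
      using linear_sum_Basis[OF has_derivative_linear[OF Df[OF that]]] by metis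
    ultimately show "Ck_on k S (\<lambda>x. ?F x (?G x v))" for v
      by (rule Ck_on_cong[OF assms(1), rotated])
  qed
qed

lemma Ck_on_inverse: "Ck_on k {0<..} (\<lambda>x::real. inverse x)"
proof (induction k)
  case 0
  then show ?case by (auto intro!: continuous_intros)
next
  case (Suc k)
  show ?case
  proof (rule Ck_on_SucI)
    show "(inverse has_derivative (\<lambda>v. - (inverse x * v * inverse x))) (at x)" if "x \<in> {0<..}" for x :: real
      using that by (auto intro!: has_derivative_inverse')
    have "Ck_on k {0<..} (\<lambda>x::real. (- v) *\<^sub>R (inverse x *\<^sub>R inverse x))" for v
      using Suc by (intro Ck_on_scaleR Ck_on_const) auto
    then show "Ck_on k {0<..} (\<lambda>x::real. - (inverse x * v * inverse x))" for v
      by (simp add: mult_ac)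
  qed auto
qed

text \<open>
  Smoothness as a property of germs, which makes gluing and changes of charts painless.
\<close>

definition smooth_at :: "('a::euclidean_space \<Rightarrow> 'b::real_normed_vector) \<Rightarrow> 'a \<Rightarrow> bool" where
  "smooth_at f x \<longleftrightarrow> (\<exists>S. open S \<and> x \<in> S \<and> smooth_on S f)"

lemma smooth_on_subset: "smooth_on T f \<Longrightarrow> S \<subseteq> T \<Longrightarrow> smooth_on S f"
  unfolding smooth_on_def using Ck_on_subset by blast

lemma smooth_at_cong:
  assumes "smooth_at f x" "open U" "x \<in> U" "\<And>y. y \<in> U \<Longrightarrow> f y = g y"
  shows "smooth_at g x"
proof -
  obtain S where S: "open S" "x \<in> S" "smooth_on S f" using assms(1) unfolding smooth_at_def by blast
  have "smooth_on (S \<inter> U) g"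
    unfolding smooth_on_def
    using Ck_on_cong[of "S \<inter> U" f g] Ck_on_subset[of _ S f "S \<inter> U"] S assms unfolding smooth_on_def by auto
  then show ?thesis unfolding smooth_at_def using S assms by (intro exI[of _ "S \<inter> U"]) auto
qed

lemma smooth_on_iff_smooth_at: "open S \<Longrightarrow> smooth_on S f \<longleftrightarrow> (\<forall>x\<in>S. smooth_at f x)"
proof
  assume S: "\<forall>x\<in>S. smooth_at f x"
  show "smooth_on S f"
    unfolding smooth_on_def
  proof
    show "Ck_on k S f" for k
      by (rule Ck_on_local) (use S in \<open>unfold smooth_at_def smooth_on_def, blast\<close>)
  qed
qed (auto simp: smooth_at_def)

lemma smooth_at_const: "smooth_at (\<lambda>x. c) x"
  unfolding smooth_at_def smooth_on_def by (intro exI[of _ UNIV]) (auto intro: Ck_on_const)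

lemma smooth_at_bounded_linear: "bounded_linear L \<Longrightarrow> smooth_at L x"
  unfolding smooth_at_def smooth_on_def by (intro exI[of _ UNIV]) (auto intro: Ck_on_bounded_linear)

lemma smooth_at_common_nbhd:
  assumes "smooth_at f x" "smooth_at g x"
  obtains S where "open S" "x \<in> S" "smooth_on S f" "smooth_on S g"
proof -
  obtain S T where S: "open S" "x \<in> S" "smooth_on S f" and T: "open T" "x \<in> T" "smooth_on T g"
    using assms unfolding smooth_at_def by blast
  show thesis
    by (rule that[of "S \<inter> T"])
       (use S T in \<open>auto intro: smooth_on_subset[OF S(3)] smooth_on_subset[OF T(3)]\<close>)
qed

lemma smooth_at_add:
  assumes "smooth_at f x" "smooth_at g x" shows "smooth_at (\<lambda>x. f x + g x) x"
proof -
  obtain S where S: "open S" "x \<in> S" "smooth_on S f" "smooth_on S g"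
    using smooth_at_common_nbhd[OF assms] .
  then have "smooth_on S (\<lambda>x. f x + g x)"
    unfolding smooth_on_def by (intro allI Ck_on_add) auto
  with S show ?thesis unfolding smooth_at_def by blast
qed

lemma smooth_at_mult:
  fixes f g :: "'a::euclidean_space \<Rightarrow> real"
  assumes "smooth_at f x" "smooth_at g x" shows "smooth_at (\<lambda>x. f x * g x) x"
proof -
  obtain S where S: "open S" "x \<in> S" "smooth_on S f" "smooth_on S g"
    using smooth_at_common_nbhd[OF assms] .
  then have "smooth_on S (\<lambda>x. f x * g x)"
    unfolding smooth_on_def real_scaleR_def[symmetric] by (intro allI Ck_on_scaleR) auto
  with S show ?thesis unfolding smooth_at_def by blast
qed

lemma smooth_at_sum:
  "(\<And>i. i \<in> I \<Longrightarrow> smooth_at (f i) x) \<Longrightarrow> smooth_at (\<lambda>x. \<Sum>i\<in>I. f i x) x"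
proof (induction I rule: infinite_finite_induct)
  case (insert i I)
  then show ?case using smooth_at_add[of "f i" x "\<lambda>x. \<Sum>i\<in>I. f i x"] by simp
qed (simp_all add: smooth_at_const)

lemma smooth_on_continuous_on: "smooth_on S f \<Longrightarrow> continuous_on S f"
  unfolding smooth_on_def by (metis Ck_on.simps(1))

lemma smooth_at_compose:
  fixes f :: "'b::euclidean_space \<Rightarrow> 'c::real_normed_vector" and g :: "'a::euclidean_space \<Rightarrow> 'b"
  assumes "smooth_at f (g x)" "smooth_at g x" shows "smooth_at (\<lambda>x. f (g x)) x"
proof -
  obtain S T where S: "open S" "x \<in> S" "smooth_on S g" and T: "open T" "g x \<in> T" "smooth_on T f"
    using assms unfolding smooth_at_def by blast
  let ?S = "S \<inter> g -` T"
  have "open ?S" using smooth_on_continuous_on[OF S(3)] S(1) T(1) continuous_open_preimage by blast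
  moreover have "smooth_on ?S (\<lambda>x. f (g x))"
    unfolding smooth_on_def
  proof
    show "Ck_on k ?S (\<lambda>x. f (g x))" for k
      by (rule Ck_on_compose[OF \<open>open ?S\<close> T(1)])
         (use T(3) smooth_on_subset[OF S(3), of ?S] in \<open>auto simp: smooth_on_def\<close>)
  qed
  ultimately show ?thesis unfolding smooth_at_def using S(2) T(2) by blast
qed

lemma smooth_at_diff:
  fixes f g :: "'a::euclidean_space \<Rightarrow> real"
  assumes "smooth_at f x" "smooth_at g x" shows "smooth_at (\<lambda>x. f x - g x) x"
  using smooth_at_add[OF assms(1) smooth_at_mult[OF smooth_at_const[of "-1"] assms(2)]] by simp

lemma smooth_at_divide:
  fixes f g :: "'a::euclidean_space \<Rightarrow> real"
  assumes "smooth_at f x" "smooth_at g x" "g x > 0" shows "smooth_at (\<lambda>x. f x / g x) x"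
proof -
  have "smooth_at (inverse :: real \<Rightarrow> real) (g x)"
    unfolding smooth_at_def smooth_on_def using assms(3)
    by (intro exI[of _ "{0<..}"]) (auto intro: Ck_on_inverse)
  from smooth_at_mult[OF assms(1) smooth_at_compose[OF this assms(2)]]
  show ?thesis by (simp add: divide_inverse)
qed

text \<open>
  The functions $x^{-n} e^{-1/x}$, extended by zero. Their linear span is closed under
  differentiation, so smoothness at the origin follows by proving all the $C^k$ statements
  simultaneously for every \<open>n\<close>.
\<close>

definition flat_exp :: "nat \<Rightarrow> real \<Rightarrow> real" where
  "flat_exp n x = (if x \<le> 0 then 0 else inverse x ^ n * exp (- inverse x))"

lemma flat_exp_limit: "((\<lambda>x. flat_exp n x) \<longlongrightarrow> 0) (at 0)"
proof (rule filterlim_split_at)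
  have "eventually (\<lambda>x::real. x < 0) (at_left 0)" unfolding eventually_at_left_field by (auto intro: exI[of _ "-1"])
  then show "((\<lambda>x. flat_exp n x) \<longlongrightarrow> 0) (at_left 0)"
    by (auto intro!: tendsto_eventually elim!: eventually_mono simp: flat_exp_def)
  have "((\<lambda>x. inverse x ^ n / exp (inverse x)) \<longlongrightarrow> 0) (at_right (0::real))"
    using filterlim_compose[OF tendsto_power_div_exp_0 filterlim_inverse_at_top_right] .
  moreover have "eventually (\<lambda>x::real. x > 0) (at_right 0)" unfolding eventually_at_right_field by (auto intro: exI[of _ 1])
  ultimately show "((\<lambda>x. flat_exp n x) \<longlongrightarrow> 0) (at_right 0)"
    by (auto elim!: Lim_transform_eventually eventually_mono simp: flat_exp_def exp_minus divide_inverse)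
qed

lemma flat_exp_deriv:
  "(flat_exp n has_real_derivative flat_exp (n + 2) x - n * flat_exp (n + 1) x) (at x)"
proof -
  consider "x < 0" | "x = 0" | "x > 0" by linarith
  then show ?thesis
  proof cases
    case 1
    have "((\<lambda>x. 0) has_real_derivative 0) (at x)" by simp
    then have "(flat_exp n has_real_derivative 0) (at x)"
      by (rule has_field_derivative_transform_within_open[of _ _ _ "{..<0}"]) (use 1 in \<open>auto simp: flat_exp_def\<close>)
    then show ?thesis using 1 by (simp add: flat_exp_def)
  next
    case 2
    have "((\<lambda>h. (flat_exp n (0 + h) - flat_exp n 0) / h) \<longlongrightarrow> 0) (at 0)"
      by (rule Lim_transform_eventually[OF flat_exp_limit[of "Suc n"]])
         (auto simp: eventually_at_filter flat_exp_def field_simps)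
    then show ?thesis using 2 by (simp add: DERIV_def flat_exp_def)
  next
    case 3
    have "((\<lambda>x. inverse x ^ n * exp (- inverse x)) has_real_derivative
        (n * inverse x ^ (n - 1) * (- (inverse x * inverse x))) * exp (- inverse x)
          + inverse x ^ n * (exp (- inverse x) * (inverse x * inverse x))) (at x)"
      using 3 by (auto intro!: derivative_eq_intros simp: power2_eq_square)
    moreover have "(n * inverse x ^ (n - 1) * (- (inverse x * inverse x))) * exp (- inverse x)
          + inverse x ^ n * (exp (- inverse x) * (inverse x * inverse x))
        = flat_exp (n + 2) x - n * flat_exp (n + 1) x"
      using 3 by (cases n) (simp_all add: flat_exp_def algebra_simps)
    ultimately have "((\<lambda>x. inverse x ^ n * exp (- inverse x)) has_real_derivative
        flat_exp (n + 2) x - n * flat_exp (n + 1) x) (at x)" by simp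
    then show ?thesis
      by (rule has_field_derivative_transform_within_open[of _ _ _ "{0<..}"]) (use 3 in \<open>auto simp: flat_exp_def\<close>)
  qed
qed

lemma Ck_on_flat_exp: "Ck_on k UNIV (flat_exp n)"
proof (induction k arbitrary: n)
  case 0
  show ?case
    unfolding Ck_on.simps(1) by (intro continuous_at_imp_continuous_on ballI DERIV_isCont[OF flat_exp_deriv])
next
  case (Suc k)
  show ?case
  proof (rule Ck_on_SucI)
    show "(flat_exp n has_derivative (\<lambda>v. (flat_exp (n + 2) x - n * flat_exp (n + 1) x) * v)) (at x)" for x
      using flat_exp_deriv by (simp add: has_field_derivative_def)
    have "Ck_on k UNIV (\<lambda>x. v *\<^sub>R flat_exp (n + 2) x + (- v * n) *\<^sub>R flat_exp (n + 1) x)" for v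
      by (intro Ck_on_add Ck_on_scaleR Ck_on_const Suc) auto
    then show "Ck_on k UNIV (\<lambda>x. (flat_exp (n + 2) x - n * flat_exp (n + 1) x) * v)" for v
      by (simp add: algebra_simps)
  qed auto
qed

text \<open>
  A smooth transition from 0 on the negative half-line to 1 on \<open>{1..}\<close>.
\<close>

definition smooth_step :: "real \<Rightarrow> real" where
  "smooth_step s = flat_exp 0 s / (flat_exp 0 s + flat_exp 0 (1 - s))"

lemma flat_exp_pos: "flat_exp n s > 0 \<longleftrightarrow> s > 0" and flat_exp_nonneg: "flat_exp n s \<ge> 0"
  by (auto simp: flat_exp_def)

lemma smooth_step_denom: "flat_exp 0 s + flat_exp 0 (1 - s) > 0"
proof (cases "s > 0")
  case True
  then show ?thesis by (intro add_pos_nonneg) (simp_all add: flat_exp_pos flat_exp_nonneg)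
next
  case False
  then show ?thesis by (intro add_nonneg_pos) (simp_all add: flat_exp_pos flat_exp_nonneg)
qed

lemma smooth_step_range: "0 \<le> smooth_step s" "smooth_step s \<le> 1"
  using smooth_step_denom[of s] flat_exp_nonneg[of 0 s] flat_exp_nonneg[of 0 "1 - s"]
  by (simp_all add: smooth_step_def divide_le_eq)

lemma smooth_step_eq_0: "s \<le> 0 \<Longrightarrow> smooth_step s = 0"
  and smooth_step_eq_1: "s \<ge> 1 \<Longrightarrow> smooth_step s = 1"
  using smooth_step_denom[of s] by (auto simp: smooth_step_def flat_exp_def)

lemma smooth_at_step: "smooth_at smooth_step x"
proof -
  have E: "smooth_at (flat_exp 0) y" for y
    unfolding smooth_at_def smooth_on_def using Ck_on_flat_exp by blast
  have "smooth_at (\<lambda>s. 1 - s) x"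
    by (intro smooth_at_diff smooth_at_const smooth_at_bounded_linear bounded_linear_ident)
  from smooth_at_compose[OF E this] show ?thesis
    unfolding smooth_step_def by (intro smooth_at_divide smooth_at_add E smooth_step_denom)
qed

text \<open>
  A plateau of radius \<open>r\<close>, supported in the ball of radius \<open>2 * r\<close>. Using the squared norm avoids the
  singularity of the norm at the origin.
\<close>

definition bump :: "real \<Rightarrow> 'a::euclidean_space \<Rightarrow> real" where
  "bump r x = smooth_step (2 - (x \<bullet> x) / r\<^sup>2)"

lemma bump_range: "0 \<le> bump r x" "bump r x \<le> 1"
  unfolding bump_def by (rule smooth_step_range)+

lemma bump_eq_1: assumes "norm x \<le> r" "0 < r" shows "bump r x = 1"
proof -
  have "x \<bullet> x \<le> r\<^sup>2" using assms by (simp add: dot_square_norm power_mono)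
  then show ?thesis unfolding bump_def using assms by (intro smooth_step_eq_1) (simp add: field_simps)
qed

lemma bump_eq_0: assumes "norm x \<ge> 2 * r" "0 < r" shows "bump r x = 0"
proof -
  have "(2 * r)\<^sup>2 \<le> (norm x)\<^sup>2" using assms by (intro power_mono) auto
  then have "4 * r\<^sup>2 \<le> (norm x)\<^sup>2" by (simp add: power_mult_distrib)
  then have "2 * r\<^sup>2 \<le> x \<bullet> x" using zero_le_power2[of r] unfolding dot_square_norm by linarith
  then show ?thesis unfolding bump_def using assms by (intro smooth_step_eq_0) (simp add: field_simps)
qed

lemma smooth_at_inner_self: "smooth_at (\<lambda>x::'a::euclidean_space. x \<bullet> x) x"
proof -
  have "smooth_at (\<lambda>x::'a. \<Sum>b\<in>Basis. (x \<bullet> b) * (x \<bullet> b)) x"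
    by (intro smooth_at_sum smooth_at_mult smooth_at_bounded_linear bounded_linear_inner_left)
  then show ?thesis by (simp add: euclidean_inner[symmetric])
qed

lemma smooth_at_bump: "smooth_at (bump r) x"
proof -
  have "smooth_at (\<lambda>x::'a. 2 - (x \<bullet> x) * inverse (r\<^sup>2)) x"
    by (intro smooth_at_diff smooth_at_mult smooth_at_const smooth_at_inner_self)
  from smooth_at_compose[OF smooth_at_step this] show ?thesis
    unfolding bump_def[abs_def] by (simp add: divide_inverse)
qed

section \<open>Germs of semiconcave functions\<close>

text \<open>
  Expansions at \<open>x\<close> that hold on the set \<open>S\<close>, with one constant \<open>C\<close> for the slope and the quadratic
  error. The slopes are covectors, represented by the inner product, except in the Taylor
  expansion, which is also used for vector-valued functions.
\<close>

abbreviation touched_above :: "('a::euclidean_space \<Rightarrow> real) \<Rightarrow> 'a set \<Rightarrow> real \<Rightarrow> 'a \<Rightarrow> bool" where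
  "touched_above F S C x \<equiv>
     \<exists>p. norm p \<le> C \<and> (\<forall>y\<in>S. F y \<le> F x + p \<bullet> (y - x) + C * (norm (y - x))\<^sup>2)"

abbreviation touched_both :: "('a::euclidean_space \<Rightarrow> real) \<Rightarrow> 'a set \<Rightarrow> real \<Rightarrow> 'a \<Rightarrow> bool" where
  "touched_both F S C x \<equiv>
     \<exists>m. norm m \<le> C \<and> (\<forall>y\<in>S. \<bar>F y - F x - m \<bullet> (y - x)\<bar> \<le> C * (norm (y - x))\<^sup>2)"

abbreviation taylor_expansion ::
    "('a::euclidean_space \<Rightarrow> 'b::real_normed_vector) \<Rightarrow> 'a set \<Rightarrow> real \<Rightarrow> 'a \<Rightarrow> bool" where
  "taylor_expansion f S C x \<equiv> \<exists>D. linear D \<and> (\<forall>v. norm (D v) \<le> C * norm v) \<and>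
     (\<forall>y\<in>S. norm (f y - f x - D (y - x)) \<le> C * (norm (y - x))\<^sup>2)"

lemma Ck_on_1_bounds:
  assumes "open S" "Ck_on 1 S f" "compact K" "convex K" "K \<subseteq> S"
  obtains C where "C \<ge> 0" "\<And>x v. x \<in> K \<Longrightarrow> norm (frechet_derivative f (at x) v) \<le> C * norm v"
    "\<And>x y. x \<in> K \<Longrightarrow> y \<in> K \<Longrightarrow> norm (f y - f x) \<le> C * norm (y - x)"
proof -
  let ?D = "\<lambda>x. frechet_derivative f (at x)"
  have Ck: "Ck_on (Suc 0) S f" using assms(2) by simp
  have D: "(f has_derivative ?D x) (at x)" if "x \<in> S" for x
    using Ck_on_SucD[OF Ck that] .
  have "\<exists>M\<ge>0. \<forall>x\<in>K. norm (?D x b) \<le> M" for b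
  proof -
    have "continuous_on K (\<lambda>x. ?D x b)"
      using Ck by (intro continuous_on_subset[OF _ assms(5)]) simp
    from compact_imp_bounded[OF compact_continuous_image[OF this assms(3)]]
    obtain M where M: "\<forall>y\<in>(\<lambda>x. ?D x b) ` K. norm y \<le> M" unfolding bounded_iff by blast
    then show ?thesis by (intro exI[of _ "max M 0"]) fastforce
  qed
  then obtain M where M: "\<And>b. M b \<ge> 0" "\<And>b x. x \<in> K \<Longrightarrow> norm (?D x b) \<le> M b" by metis
  define C where "C = (\<Sum>b\<in>Basis. M b)"
  have C: "norm (?D x v) \<le> C * norm v" if "x \<in> K" for x v
  proof -
    have x: "x \<in> S" using that assms(5) by blast
    have "norm (?D x v) = norm (\<Sum>b\<in>Basis. (v \<bullet> b) *\<^sub>R ?D x b)"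
      using linear_sum_Basis[OF has_derivative_linear[OF D[OF x]], of v] by simp
    also have "\<dots> \<le> (\<Sum>b\<in>Basis. norm v * M b)"
      by (rule sum_norm_le) (auto intro!: mult_mono M that simp: Basis_le_norm)
    also have "\<dots> = C * norm v" by (simp add: C_def sum_distrib_left mult.commute)
    finally show ?thesis .
  qed
  show thesis
  proof (rule that[of C])
    show "C \<ge> 0" unfolding C_def by (intro sum_nonneg M)
    show "norm (f y - f x) \<le> C * norm (y - x)" if "x \<in> K" "y \<in> K" for x y
    proof (rule differentiable_bound[OF assms(4)])
      show "(f has_derivative ?D z) (at z within K)" if "z \<in> K" for z
        using D that assms(5) has_derivative_at_withinI by blast
      show "onorm (?D z) \<le> C" if "z \<in> K" for z using C[OF that] by (rule onorm_le)
    qed (use that in auto)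
  qed (use C in auto)
qed

text \<open>
  The directional derivatives in the basis directions are continuously differentiable, so they are
  Lipschitz on a compact convex set, and so is the derivative. The mean value theorem applied to \<open>f\<close> minus its linearization gives the expansion. Convexity keeps the segment inside.
\<close>

lemma Ck_on_2_taylor:
  assumes "open S" "Ck_on 2 S f" "compact K" "convex K" "K \<subseteq> S"
  obtains C where "C \<ge> 0" "\<And>x. x \<in> K \<Longrightarrow> taylor_expansion f K C x"
proof -
  let ?D = "\<lambda>x. frechet_derivative f (at x)"
  have Ck: "Ck_on (Suc 1) S f" using assms(2) by (simp add: numeral_2_eq_2)
  have D: "(f has_derivative ?D x) (at x)" if "x \<in> S" for x
    using Ck_on_SucD[OF Ck that] .
  obtain C where C: "C \<ge> 0" "\<And>x v. x \<in> K \<Longrightarrow> norm (?D x v) \<le> C * norm v"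
    "\<And>x y. x \<in> K \<Longrightarrow> y \<in> K \<Longrightarrow> norm (f y - f x) \<le> C * norm (y - x)"
    by (rule Ck_on_1_bounds[OF assms(1) Ck_on_lower[OF Ck] assms(3-5)]) (rule that)
  have Ckb: "Ck_on 1 S (\<lambda>x. ?D x b)" for b
    using Ck by (simp only: Ck_on.simps(2))
  have "\<exists>M\<ge>0. \<forall>x\<in>K. \<forall>y\<in>K. norm (?D y b - ?D x b) \<le> M * norm (y - x)" for b
    by (rule Ck_on_1_bounds[OF assms(1) Ckb[of b] assms(3-5)]) blast
  then obtain M where M: "\<And>b. M b \<ge> 0"
    "\<And>b x y. x \<in> K \<Longrightarrow> y \<in> K \<Longrightarrow> norm (?D y b - ?D x b) \<le> M b * norm (y - x)" by metis
  define L where "L = (\<Sum>b\<in>Basis. M b)"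
  have L: "norm (?D y v - ?D x v) \<le> L * norm (y - x) * norm v" if "x \<in> K" "y \<in> K" for x y v
  proof -
    have xy: "x \<in> S" "y \<in> S" using that assms(5) by blast+
    have "?D y v - ?D x v = (\<Sum>b\<in>Basis. (v \<bullet> b) *\<^sub>R ?D y b) - (\<Sum>b\<in>Basis. (v \<bullet> b) *\<^sub>R ?D x b)"
      using linear_sum_Basis[OF has_derivative_linear[OF D[OF xy(1)]], of v]
        linear_sum_Basis[OF has_derivative_linear[OF D[OF xy(2)]], of v] by simp
    also have "\<dots> = (\<Sum>b\<in>Basis. (v \<bullet> b) *\<^sub>R (?D y b - ?D x b))"
      by (simp add: sum_subtractf scaleR_diff_right)
    also have "norm \<dots> \<le> (\<Sum>b\<in>Basis. norm v * (M b * norm (y - x)))"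
    proof (rule sum_norm_le)
      fix b :: 'a assume "b \<in> Basis"
      then show "norm ((v \<bullet> b) *\<^sub>R (?D y b - ?D x b)) \<le> norm v * (M b * norm (y - x))"
        unfolding norm_scaleR real_norm_def by (intro mult_mono M(2) that Basis_le_norm) auto
    qed
    also have "\<dots> = L * norm (y - x) * norm v"
      by (simp add: L_def sum_distrib_left sum_distrib_right mult_ac)
    finally show ?thesis .
  qed
  have L0: "L \<ge> 0" unfolding L_def by (intro sum_nonneg M)
  have T: "norm (f y - f x - ?D x (y - x)) \<le> L * (norm (y - x))\<^sup>2" if "x \<in> K" "y \<in> K" for x y
  proof -
    have seg: "closed_segment x y \<subseteq> K" using that assms(4) by (simp add: closed_segment_subset)
    have xS: "x \<in> S" using that assms(5) by blast
    have bl: "bounded_linear (?D x)" using D[OF xS] by (rule has_derivative_bounded_linear)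
    have "norm ((f y - ?D x y) - (f x - ?D x x)) \<le> (L * norm (y - x)) * norm (y - x)"
    proof (rule differentiable_bound[OF convex_closed_segment[of x y]])
      fix z assume z: "z \<in> closed_segment x y"
      then have zK: "z \<in> K" using seg by blast
      show "((\<lambda>z. f z - ?D x z) has_derivative (\<lambda>v. ?D z v - ?D x v)) (at z within closed_segment x y)"
        by (rule has_derivative_diff[OF has_derivative_at_withinI[OF D] bounded_linear_imp_has_derivative[OF bl]])
           (use zK assms(5) in blast)
      have "norm (z - x) \<le> norm (y - x)" using segment_bound(1)[OF z] .
      then have "L * norm (z - x) \<le> L * norm (y - x)" using L0 by (rule mult_left_mono)
      then show "onorm (\<lambda>v. ?D z v - ?D x v) \<le> L * norm (y - x)"
        by (intro onorm_le order_trans[OF L[OF that(1) zK]] mult_right_mono) auto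
    qed auto
    moreover have "f y - f x - ?D x (y - x) = (f y - ?D x y) - (f x - ?D x x)"
      by (simp add: linear_diff[OF has_derivative_linear[OF D[OF xS]]])
    ultimately show ?thesis by (simp only: power2_eq_square mult.assoc)
  qed
  show thesis
  proof (rule that[of "max C L"])
    fix x assume x: "x \<in> K"
    show "taylor_expansion f K (max C L) x"
    proof (intro exI[of _ "?D x"] conjI allI ballI)
      show "linear (?D x)" using D x assms(5) has_derivative_linear by blast
      show "norm (?D x v) \<le> max C L * norm v" for v
        using C(2)[OF x, of v] by (rule order_trans) (simp add: mult_right_mono)
      show "norm (f y - f x - ?D x (y - x)) \<le> max C L * (norm (y - x))\<^sup>2" if "y \<in> K" for y
        using T[OF x that] by (rule order_trans) (simp add: mult_right_mono)
    qed
  qed (use C in auto)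
qed

lemma smooth_at_taylor:
  assumes "smooth_at f x0" "open U" "x0 \<in> U"
  obtains e C where "0 < e" "e \<le> 1" "ball x0 e \<subseteq> U" "1 \<le> C"
    "\<And>x. x \<in> ball x0 e \<Longrightarrow> taylor_expansion f (ball x0 e) C x"
proof -
  obtain S where S: "open S" "x0 \<in> S" "smooth_on S f" using assms(1) unfolding smooth_at_def by blast
  have "open (S \<inter> U)" "x0 \<in> S \<inter> U" using S assms by auto
  then obtain e where e: "e > 0" "cball x0 e \<subseteq> S \<inter> U" by (meson open_contains_cball)
  have "Ck_on 2 S f" using S(3) unfolding smooth_on_def by blast
  moreover have "cball x0 e \<subseteq> S" using e by blast
  ultimately obtain C where C: "C \<ge> 0" "\<And>x. x \<in> cball x0 e \<Longrightarrow> taylor_expansion f (cball x0 e) C x"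
    by (rule Ck_on_2_taylor[OF S(1) _ compact_cball convex_cball]) (rule that)
  have sub: "ball x0 (min e 1) \<subseteq> cball x0 e" by auto
  show thesis
  proof (rule that[of "min e 1" "max 1 C"])
    fix x assume "x \<in> ball x0 (min e 1)"
    then obtain D where D: "linear D" "\<And>v. norm (D v) \<le> C * norm v"
      "\<And>y. y \<in> cball x0 e \<Longrightarrow> norm (f y - f x - D (y - x)) \<le> C * (norm (y - x))\<^sup>2"
      using C(2) sub by blast
    show "taylor_expansion f (ball x0 (min e 1)) (max 1 C) x"
    proof (intro exI[of _ D] conjI allI ballI)
      show "norm (D v) \<le> max 1 C * norm v" for v
        using D(2)[of v] by (rule order_trans) (simp add: mult_right_mono)
      show "norm (f y - f x - D (y - x)) \<le> max 1 C * (norm (y - x))\<^sup>2" if "y \<in> ball x0 (min e 1)" for y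
        using D(3)[of y] that sub by (intro order_trans[OF D(3)] mult_right_mono) auto
    qed (rule D)
  qed (use e sub in auto)
qed

text \<open>
  Local semiconcavity with linear modulus, stated through the paraboloids that touch the graph from
  above. Unlike the definition by a concave function in some chart, this is visibly invariant under
  diffeomorphisms. The bound on the slope is part of the condition because a change of variables
  turns slope into curvature.
\<close>

definition semiconcave_at :: "('a::euclidean_space \<Rightarrow> real) \<Rightarrow> 'a \<Rightarrow> bool" where
  "semiconcave_at F x0 \<longleftrightarrow> (\<exists>e>0. \<exists>C. \<forall>x\<in>ball x0 e. touched_above F (ball x0 e) C x)"

lemma semiconcave_atE:
  assumes "semiconcave_at F x0" "open U" "x0 \<in> U"
  obtains e C where "0 < e" "e \<le> 1" "ball x0 e \<subseteq> U" "1 \<le> C"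
    "\<And>x. x \<in> ball x0 e \<Longrightarrow> touched_above F (ball x0 e) C x"
proof -
  obtain e C where e: "e > 0" and C: "\<And>x. x \<in> ball x0 e \<Longrightarrow> touched_above F (ball x0 e) C x"
    using assms(1) unfolding semiconcave_at_def by blast
  obtain d where d: "d > 0" "ball x0 d \<subseteq> U" using assms(2,3) by (meson open_contains_ball)
  let ?e = "min 1 (min e d)" and ?C = "max 1 C"
  show thesis
  proof (rule that[of ?e ?C])
    fix x assume "x \<in> ball x0 ?e"
    then obtain p where p: "norm p \<le> C"
      "\<And>y. y \<in> ball x0 e \<Longrightarrow> F y \<le> F x + p \<bullet> (y - x) + C * (norm (y - x))\<^sup>2" using C[of x] by auto
    show "\<exists>p. norm p \<le> ?C \<and> (\<forall>y\<in>ball x0 ?e. F y \<le> F x + p \<bullet> (y - x) + ?C * (norm (y - x))\<^sup>2)"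
    proof (intro exI[of _ p] conjI ballI)
      fix y assume "y \<in> ball x0 ?e"
      then have "F y \<le> F x + p \<bullet> (y - x) + C * (norm (y - x))\<^sup>2" using p(2) by auto
      also have "\<dots> \<le> F x + p \<bullet> (y - x) + ?C * (norm (y - x))\<^sup>2" by (simp add: mult_right_mono)
      finally show "F y \<le> F x + p \<bullet> (y - x) + ?C * (norm (y - x))\<^sup>2" .
    qed (use p in auto)
  qed (use e d in auto)
qed

lemma semiconcave_at_cong:
  assumes "semiconcave_at F x" "open U" "x \<in> U" "\<And>y. y \<in> U \<Longrightarrow> F y = G y"
  shows "semiconcave_at G x"
proof -
  obtain e C where e: "0 < e" "e \<le> 1" "ball x e \<subseteq> U" "1 \<le> C"
    and C: "\<And>z. z \<in> ball x e \<Longrightarrow> touched_above F (ball x e) C z"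
    by (rule semiconcave_atE[OF assms(1-3)]) (rule that)
  have "F y = G y" if "y \<in> ball x e" for y using that e assms(4) by blast
  then have "touched_above G (ball x e) C z"
    if "z \<in> ball x e" for z using C[OF that] that by simp
  then show ?thesis unfolding semiconcave_at_def using e(1) by blast
qed

text \<open>
  The paraboloid at the centre bounds \<open>F x - F x0\<close> from above; the one at \<open>x\<close>, evaluated at the centre,
  bounds it from below.
\<close>

lemma semiconcave_at_osc:
  assumes "semiconcave_at F x0" "open U" "x0 \<in> U"
  obtains e C where "0 < e" "ball x0 e \<subseteq> U" "0 \<le> C"
     "\<And>x. x \<in> ball x0 e \<Longrightarrow> \<bar>F x - F x0\<bar> \<le> C * norm (x - x0)"
proof -
  obtain e C where e: "0 < e" "e \<le> 1" "ball x0 e \<subseteq> U" "1 \<le> C"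
    and C: "\<And>x. x \<in> ball x0 e \<Longrightarrow> touched_above F (ball x0 e) C x"
    by (rule semiconcave_atE[OF assms]) (rule that)
  have A: "F y - F x \<le> 3 * C * norm (y - x)" if xy: "x \<in> ball x0 e" "y \<in> ball x0 e" for x y
  proof -
    obtain p where p: "norm p \<le> C" "F y \<le> F x + p \<bullet> (y - x) + C * (norm (y - x))\<^sup>2"
      using C[OF xy(1)] xy(2) by blast
    have "dist y x < 2"
      using dist_triangle_less_add[of y x0 e x e] xy e(2) by (simp add: dist_commute)
    then have n: "norm (y - x) \<le> 2" by (simp add: dist_norm)
    have "p \<bullet> (y - x) \<le> norm p * norm (y - x)" by (rule norm_cauchy_schwarz)
    also have "\<dots> \<le> C * norm (y - x)" using p by (intro mult_right_mono) auto
    finally have 1: "p \<bullet> (y - x) \<le> C * norm (y - x)" .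
    have "(norm (y - x))\<^sup>2 \<le> 2 * norm (y - x)"
      unfolding power2_eq_square using n by (rule mult_right_mono) simp
    then have "C * (norm (y - x))\<^sup>2 \<le> C * (2 * norm (y - x))" using e by (intro mult_left_mono) auto
    then show ?thesis using 1 p by simp
  qed
  show thesis
  proof (rule that[of e "3 * C"])
    fix x assume "x \<in> ball x0 e"
    then show "\<bar>F x - F x0\<bar> \<le> 3 * C * norm (x - x0)"
      using A[of x0 x] A[of x x0] e by (auto simp: norm_minus_commute abs_le_iff)
  qed (use e in auto)
qed

lemma semiconcave_at_isCont:
  assumes "semiconcave_at F x0" shows "isCont F x0"
proof -
  obtain e C where e: "0 < e" "ball x0 e \<subseteq> UNIV" "0 \<le> C"
     "\<And>x. x \<in> ball x0 e \<Longrightarrow> \<bar>F x - F x0\<bar> \<le> C * norm (x - x0)"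
    by (rule semiconcave_at_osc[OF assms open_UNIV UNIV_I]) (rule that)
  have "eventually (\<lambda>x. x \<in> ball x0 e) (at x0)"
    using e(1) by (intro eventually_at_in_open'[OF open_ball]) auto
  then have "eventually (\<lambda>x. norm (F x - F x0) \<le> C * norm (x - x0)) (at x0)"
    by (rule eventually_mono) (use e in auto)
  moreover have "((\<lambda>x. C * norm (x - x0)) \<longlongrightarrow> 0) (at x0)"
    by (auto intro!: tendsto_eq_intros)
  ultimately have "((\<lambda>x. F x - F x0) \<longlongrightarrow> 0) (at x0)"
    by (rule Lim_null_comparison)
  then show ?thesis unfolding isCont_def using LIM_zero_cancel by blast
qed

text \<open>
  The pullback of a covector under a linear map, represented again by an inner product.
\<close>

lemma functional_as_inner:
  fixes D :: "'a::euclidean_space \<Rightarrow> 'b::euclidean_space"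
  assumes "linear D" "\<And>v. norm (D v) \<le> B * norm v" "norm p \<le> C" "0 \<le> B"
  obtains q where "norm q \<le> B * C" "\<And>v. q \<bullet> v = p \<bullet> D v"
proof
  let ?q = "adjoint D p"
  show q: "?q \<bullet> v = p \<bullet> D v" for v
    using adjoint_works[OF assms(1), of v p] by (simp add: inner_commute)
  have C: "0 \<le> C" using assms(3) norm_ge_zero order_trans by blast
  have "norm ?q * norm ?q = p \<bullet> D ?q" using q[of ?q] by (simp add: dot_square_norm power2_eq_square)
  also have "\<dots> \<le> norm p * norm (D ?q)" by (rule norm_cauchy_schwarz)
  also have "\<dots> \<le> C * (B * norm ?q)" using assms C by (intro mult_mono) auto
  finally have "norm ?q * norm ?q \<le> B * C * norm ?q" by (simp add: mult_ac)
  then show "norm ?q \<le> B * C" using assms(4) C by (cases "norm ?q = 0") auto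
qed

lemma semiconcave_at_smooth_comp:
  fixes \<phi> :: "'a::euclidean_space \<Rightarrow> 'b::euclidean_space"
  assumes "semiconcave_at F (\<phi> x0)" "smooth_at \<phi> x0"
  shows "semiconcave_at (\<lambda>x. F (\<phi> x)) x0"
proof -
  obtain e C where e: "0 < e" "e \<le> 1" "ball (\<phi> x0) e \<subseteq> UNIV" "1 \<le> C"
    and C: "\<And>x. x \<in> ball (\<phi> x0) e \<Longrightarrow> \<exists>p. norm p \<le> C \<and>
     (\<forall>y\<in>ball (\<phi> x0) e. F y \<le> F x + p \<bullet> (y - x) + C * (norm (y - x))\<^sup>2)"
    by (rule semiconcave_atE[OF assms(1) open_UNIV UNIV_I]) (rule that)
  obtain S where S: "open S" "x0 \<in> S" "smooth_on S \<phi>" using assms(2) unfolding smooth_at_def by blast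
  have "open (S \<inter> \<phi> -` ball (\<phi> x0) e)"
    using smooth_on_continuous_on[OF S(3)] S(1) open_ball by (rule continuous_open_preimage)
  moreover have "x0 \<in> S \<inter> \<phi> -` ball (\<phi> x0) e" using S e by simp
  ultimately obtain d B where d: "0 < d" "d \<le> 1" "ball x0 d \<subseteq> S \<inter> \<phi> -` ball (\<phi> x0) e" and B: "1 \<le> B"
    "\<And>x. x \<in> ball x0 d \<Longrightarrow> taylor_expansion \<phi> (ball x0 d) B x"
    by (rule smooth_at_taylor[OF assms(2)]) (rule that)
  have C0: "0 \<le> C" using e by simp
  have B0: "0 \<le> B" using B by simp
  let ?K = "B * C + 9 * C * B\<^sup>2"
  have K: "B * C \<le> ?K" using C0 by simp
  have "\<exists>q. norm q \<le> ?K \<and> (\<forall>y\<in>ball x0 d. F (\<phi> y) \<le> F (\<phi> x) + q \<bullet> (y - x) + ?K * (norm (y - x))\<^sup>2)"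
    if x: "x \<in> ball x0 d" for x
  proof -
    obtain p where p: "norm p \<le> C"
      "\<And>y. y \<in> ball (\<phi> x0) e \<Longrightarrow> F y \<le> F (\<phi> x) + p \<bullet> (y - \<phi> x) + C * (norm (y - \<phi> x))\<^sup>2"
    proof -
      have "\<phi> x \<in> ball (\<phi> x0) e" using x d(3) by blast
      from C[OF this] show thesis using that by blast
    qed
    obtain D where D: "linear D" "\<And>v. norm (D v) \<le> B * norm v"
      "\<And>y. y \<in> ball x0 d \<Longrightarrow> norm (\<phi> y - \<phi> x - D (y - x)) \<le> B * (norm (y - x))\<^sup>2"
      using B(2)[OF x] by blast
    obtain q where q: "norm q \<le> B * C" "\<And>v. q \<bullet> v = p \<bullet> D v"
      using functional_as_inner[OF D(1,2) p(1) B0] by blast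
    have "F (\<phi> y) \<le> F (\<phi> x) + q \<bullet> (y - x) + ?K * (norm (y - x))\<^sup>2" if y: "y \<in> ball x0 d" for y
    proof -
      let ?n = "norm (y - x)" and ?r = "\<phi> y - \<phi> x - D (y - x)"
      have "dist y x < 2"
        using dist_triangle_less_add[of y x0 d x d] x y d(2) by (simp add: dist_commute)
      then have n: "?n \<le> 2" by (simp add: dist_norm)
      have r: "norm ?r \<le> B * ?n\<^sup>2" using D(3)[OF y] .
      have "B * ?n\<^sup>2 = B * ?n * ?n" by (simp add: power2_eq_square)
      also have "\<dots> \<le> B * ?n * 2" using n B0 by (intro mult_left_mono) auto
      finally have r': "norm ?r \<le> 2 * B * ?n" using r by simp
      have "norm (\<phi> y - \<phi> x) = norm (D (y - x) + ?r)" by simp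
      also have "\<dots> \<le> 3 * B * ?n" using norm_triangle_ineq[of "D (y - x)" ?r] D(2)[of "y - x"] r' by linarith
      finally have "(norm (\<phi> y - \<phi> x))\<^sup>2 \<le> (3 * B * ?n)\<^sup>2" by (intro power_mono) auto
      then have 2: "C * (norm (\<phi> y - \<phi> x))\<^sup>2 \<le> 9 * C * B\<^sup>2 * ?n\<^sup>2"
        using mult_left_mono[OF _ C0] by (fastforce simp: power_mult_distrib mult_ac)
      have "p \<bullet> ?r \<le> norm p * norm ?r" by (rule norm_cauchy_schwarz)
      also have "\<dots> \<le> C * (B * ?n\<^sup>2)" using p r C0 by (intro mult_mono) auto
      finally have "p \<bullet> ?r \<le> B * C * ?n\<^sup>2" by (simp add: mult_ac)
      moreover have "p \<bullet> (\<phi> y - \<phi> x) = q \<bullet> (y - x) + p \<bullet> ?r"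
        unfolding q(2) inner_add_right[symmetric] by simp
      ultimately have "p \<bullet> (\<phi> y - \<phi> x) \<le> q \<bullet> (y - x) + B * C * ?n\<^sup>2" by simp
      moreover have "\<phi> y \<in> ball (\<phi> x0) e" using y d(3) by auto
      ultimately show ?thesis using p(2)[of "\<phi> y"] 2 by (simp add: algebra_simps)
    qed
    then show ?thesis using q K by (intro exI[of _ q]) auto
  qed
  then show ?thesis unfolding semiconcave_at_def using d(1) by (intro exI[of _ d] conjI exI[of _ ?K]) auto
qed

lemma semiconcave_at_add:
  assumes "semiconcave_at F x0" "semiconcave_at G x0"
  shows "semiconcave_at (\<lambda>x. F x + G x) x0"
proof -
  obtain e C where e: "0 < e" and C: "\<And>x. x \<in> ball x0 e \<Longrightarrow> touched_above F (ball x0 e) C x"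
    using assms(1) unfolding semiconcave_at_def by blast
  have "x0 \<in> ball x0 e" using e by simp
  then obtain d B where d: "0 < d" "d \<le> 1" "ball x0 d \<subseteq> ball x0 e" "1 \<le> B" and B: "\<And>x. x \<in> ball x0 d \<Longrightarrow> touched_above G (ball x0 d) B x"
    by (rule semiconcave_atE[OF assms(2) open_ball]) (rule that)
  have "\<exists>p. norm p \<le> C + B \<and>
     (\<forall>y\<in>ball x0 d. F y + G y \<le> F x + G x + p \<bullet> (y - x) + (C + B) * (norm (y - x))\<^sup>2)"
    if x: "x \<in> ball x0 d" for x
  proof -
    obtain p where p: "norm p \<le> C"
      "\<And>y. y \<in> ball x0 e \<Longrightarrow> F y \<le> F x + p \<bullet> (y - x) + C * (norm (y - x))\<^sup>2" using C[of x] d(3) x by blast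
    obtain q where q: "norm q \<le> B"
      "\<And>y. y \<in> ball x0 d \<Longrightarrow> G y \<le> G x + q \<bullet> (y - x) + B * (norm (y - x))\<^sup>2" using B[OF x] by blast
    show ?thesis
    proof (intro exI[of _ "p + q"] conjI ballI)
      show "norm (p + q) \<le> C + B" using norm_triangle_le p q by (metis add_mono)
      show "F y + G y \<le> F x + G x + (p + q) \<bullet> (y - x) + (C + B) * (norm (y - x))\<^sup>2" if "y \<in> ball x0 d" for y
        using p(2)[of y] q(2)[of y] that d by (auto simp: inner_add_left algebra_simps)
    qed
  qed
  then show ?thesis unfolding semiconcave_at_def using d(1) by blast
qed

lemma semiconcave_at_smooth:
  fixes f :: "'a::euclidean_space \<Rightarrow> real"
  assumes "smooth_at f x0"
  shows "semiconcave_at f x0"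
proof -
  obtain e C where e: "0 < e" "e \<le> 1" "ball x0 e \<subseteq> UNIV" "1 \<le> C" and C: "\<And>x. x \<in> ball x0 e \<Longrightarrow>
      taylor_expansion f (ball x0 e) C x"
    by (rule smooth_at_taylor[OF assms open_UNIV UNIV_I]) (rule that)
  have "touched_above f (ball x0 e) C x"
    if x: "x \<in> ball x0 e" for x
  proof -
    obtain D where D: "linear D" "\<And>v. norm (D v) \<le> C * norm v"
      "\<And>y. y \<in> ball x0 e \<Longrightarrow> norm (f y - f x - D (y - x)) \<le> C * (norm (y - x))\<^sup>2"
      using C[OF x] by blast
    obtain p where p: "norm p \<le> C * 1" "\<And>v. p \<bullet> v = 1 \<bullet> D v"
      using functional_as_inner[OF D(1,2), of 1 1] e by auto
    show ?thesis using p D(3) by (intro exI[of _ p]) (force simp: abs_le_iff)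
  qed
  then show ?thesis unfolding semiconcave_at_def using e(1) by blast
qed

text \<open>
  In \<open>\<psi> y * F y - \<psi> x * F x\<close> the paraboloid for \<open>F\<close> may be multiplied by \<open>\<psi> y \<ge> 0\<close>; all other terms are
  controlled on both sides by the Taylor expansion of \<open>\<psi>\<close> and the local boundedness of \<open>F\<close>.
\<close>

lemma semiconcave_at_smooth_mult:
  fixes \<psi> :: "'a::euclidean_space \<Rightarrow> real"
  assumes "semiconcave_at F x0" "smooth_at \<psi> x0" "\<And>x. 0 \<le> \<psi> x"
  shows "semiconcave_at (\<lambda>x. \<psi> x * F x) x0"
proof -
  obtain e B where e: "0 < e" "e \<le> 1" "ball x0 e \<subseteq> UNIV" "1 \<le> B" and B: "\<And>x. x \<in> ball x0 e \<Longrightarrow>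
      taylor_expansion \<psi> (ball x0 e) B x"
    by (rule smooth_at_taylor[OF assms(2) open_UNIV UNIV_I]) (rule that)
  have "x0 \<in> ball x0 e" using e by simp
  then obtain e1 M where e1: "0 < e1" "ball x0 e1 \<subseteq> ball x0 e" "0 \<le> M"
    "\<And>x. x \<in> ball x0 e1 \<Longrightarrow> \<bar>F x - F x0\<bar> \<le> M * norm (x - x0)"
    by (rule semiconcave_at_osc[OF assms(1) open_ball]) (rule that)
  have "x0 \<in> ball x0 e1" using e1 by simp
  then obtain d C where d: "0 < d" "d \<le> 1" "ball x0 d \<subseteq> ball x0 e1" "1 \<le> C"
    and C: "\<And>x. x \<in> ball x0 d \<Longrightarrow> touched_above F (ball x0 d) C x"
    by (rule semiconcave_atE[OF assms(1) open_ball]) (rule that)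
  define N where "N = \<bar>F x0\<bar> + M"
  have N: "\<bar>F x\<bar> \<le> N" if "x \<in> ball x0 d" for x
  proof -
    have "norm (x - x0) \<le> 1" using that d(2) by (simp add: dist_norm norm_minus_commute)
    then have "M * norm (x - x0) \<le> M" using e1(3) by (simp add: mult_left_le)
    moreover have "\<bar>F x - F x0\<bar> \<le> M * norm (x - x0)" using e1(4) d(3) that by blast
    ultimately show ?thesis unfolding N_def by linarith
  qed
  have N0: "0 \<le> N" unfolding N_def using e1 by simp
  have d_e: "ball x0 d \<subseteq> ball x0 e" using d(3) e1(2) by blast
  have psi: "\<bar>\<psi> y - \<psi> x\<bar> \<le> 3 * B * norm (y - x)" if xy: "x \<in> ball x0 d" "y \<in> ball x0 d" for x y
  proof -
    have "x \<in> ball x0 e" "y \<in> ball x0 e" using xy d_e by blast+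
    then obtain D where D: "norm (D (y - x)) \<le> B * norm (y - x)"
      "norm (\<psi> y - \<psi> x - D (y - x)) \<le> B * (norm (y - x))\<^sup>2"
      using B[of x] by blast
    have "dist y x < 2"
      using dist_triangle_less_add[of y x0 d x d] xy d(2) by (simp add: dist_commute)
    then have "norm (y - x) * norm (y - x) \<le> 2 * norm (y - x)"
      by (intro mult_right_mono) (auto simp: dist_norm)
    then have "B * (norm (y - x))\<^sup>2 \<le> B * (2 * norm (y - x))"
      unfolding power2_eq_square using e by (intro mult_left_mono) auto
    then show ?thesis using D by simp
  qed
  define P where "P = \<psi> x0 + 3 * B"
  have P: "\<psi> x \<le> P" if "x \<in> ball x0 d" for x
  proof -
    have "norm (x - x0) \<le> 1" using that d(2) by (simp add: dist_norm norm_minus_commute)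
    then have "3 * B * norm (x - x0) \<le> 3 * B" using e by (simp add: mult_left_le)
    then show ?thesis unfolding P_def using psi[of x0 x] that d by auto
  qed
  have P0: "0 \<le> P" using P[of x0] assms(3)[of x0] d by auto
  define K where "K = N * B + P * C + 3 * B * C"
  have K1: "N * B + P * C \<le> K" unfolding K_def using e d by simp
  have "\<exists>q. norm q \<le> K \<and> (\<forall>y\<in>ball x0 d. \<psi> y * F y \<le> \<psi> x * F x + q \<bullet> (y - x) + K * (norm (y - x))\<^sup>2)"
    if x: "x \<in> ball x0 d" for x
  proof -
    obtain p where p: "norm p \<le> C"
      "\<And>y. y \<in> ball x0 d \<Longrightarrow> F y \<le> F x + p \<bullet> (y - x) + C * (norm (y - x))\<^sup>2" using C[OF x] by blast
    have xe: "x \<in> ball x0 e" using x d_e by blast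
    obtain D where D: "linear D" "\<And>v. norm (D v) \<le> B * norm v"
      "\<And>y. y \<in> ball x0 e \<Longrightarrow> norm (\<psi> y - \<psi> x - D (y - x)) \<le> B * (norm (y - x))\<^sup>2"
      using B[OF xe] by blast
    obtain h where h: "norm h \<le> B * 1" "\<And>v. h \<bullet> v = 1 \<bullet> D v"
      using functional_as_inner[OF D(1,2), of 1 1] e by auto
    let ?q = "F x *\<^sub>R h + \<psi> x *\<^sub>R p"
    have "norm ?q \<le> \<bar>F x\<bar> * norm h + \<psi> x * norm p"
      using norm_triangle_ineq[of "F x *\<^sub>R h" "\<psi> x *\<^sub>R p"] assms(3)[of x] by simp
    also have "\<dots> \<le> N * B + P * C"
      using N[OF x] h(1) P[OF x] p(1) N0 P0 e d assms(3)[of x] by (intro add_mono mult_mono) auto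
    finally have q: "norm ?q \<le> K" using K1 by linarith
    have "\<psi> y * F y \<le> \<psi> x * F x + ?q \<bullet> (y - x) + K * (norm (y - x))\<^sup>2" if y: "y \<in> ball x0 d" for y
    proof -
      let ?n = "norm (y - x)" and ?u = "p \<bullet> (y - x)"
      have u: "\<bar>?u\<bar> \<le> C * ?n"
        using Cauchy_Schwarz_ineq2[of p "y - x"] mult_right_mono[OF p(1), of ?n] by simp
      have "\<psi> y * F y \<le> \<psi> y * (F x + ?u + C * ?n\<^sup>2)"
        using p(2)[OF y] assms(3)[of y] by (rule mult_left_mono)
      also have "\<dots> = \<psi> x * F x + \<psi> x * ?u + F x * (\<psi> y - \<psi> x) + (\<psi> y - \<psi> x) * ?u + \<psi> y * C * ?n\<^sup>2"
        by (simp add: algebra_simps)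
      also have "F x * (\<psi> y - \<psi> x) = F x * (h \<bullet> (y - x)) + F x * (\<psi> y - \<psi> x - D (y - x))"
        unfolding h(2) inner_real_def by (simp add: algebra_simps)
      also have "F x * (\<psi> y - \<psi> x - D (y - x)) \<le> N * (B * ?n\<^sup>2)"
      proof -
        have "y \<in> ball x0 e" using y d_e by blast
        then have "\<bar>F x * (\<psi> y - \<psi> x - D (y - x))\<bar> \<le> N * (B * ?n\<^sup>2)"
          unfolding abs_mult using D(3)[of y] N[OF x] N0 by (intro mult_mono) auto
        then show ?thesis by linarith
      qed
      also have "(\<psi> y - \<psi> x) * ?u \<le> (3 * B * ?n) * (C * ?n)"
      proof -
        have "\<bar>(\<psi> y - \<psi> x) * ?u\<bar> \<le> (3 * B * ?n) * (C * ?n)"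
          unfolding abs_mult using psi[OF x y] u e by (intro mult_mono) auto
        then show ?thesis by linarith
      qed
      also have "\<psi> y * C * ?n\<^sup>2 \<le> P * C * ?n\<^sup>2"
        using P[OF y] d by (intro mult_right_mono) auto
      finally have "\<psi> y * F y \<le> \<psi> x * F x + \<psi> x * ?u + (F x * (h \<bullet> (y - x)) + N * (B * ?n\<^sup>2))
          + (3 * B * ?n) * (C * ?n) + P * C * ?n\<^sup>2" by simp
      also have "\<dots> = \<psi> x * F x + ?q \<bullet> (y - x) + K * ?n\<^sup>2"
        by (simp add: K_def inner_add_left algebra_simps power2_eq_square)
      finally show ?thesis .
    qed
    then show ?thesis using q by blast
  qed
  then show ?thesis unfolding semiconcave_at_def using d(1) by blast
qed

text \<open>
  A hyperplane separating the point \<open>(x, h x)\<close> from the strict epigraph is the graph of the required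
  affine function, provided that it is not vertical. It cannot be vertical since \<open>x\<close> is interior.
\<close>

lemma convex_on_subgradient:
  fixes h :: "'a::euclidean_space \<Rightarrow> real"
  assumes "open U" "convex_on U h" "x \<in> U"
  obtains p where "\<And>y. y \<in> U \<Longrightarrow> h y \<ge> h x + p \<bullet> (y - x)"
proof -
  define S where "S = {(y, t). y \<in> U \<and> h y < t}"
  have cU: "convex U" using assms(2) by (simp add: convex_on_imp_convex)
  have "convex S"
    unfolding convex_alt
  proof (intro ballI allI impI)
    fix a b :: "'a \<times> real" and u :: real
    assume "a \<in> S" "b \<in> S" and u: "0 \<le> u \<and> u \<le> 1"
    then obtain y s z t where ab: "a = (y, s)" "b = (z, t)" "y \<in> U" "z \<in> U" "h y < s" "h z < t"
      unfolding S_def by auto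
    have "h ((1 - u) *\<^sub>R y + u *\<^sub>R z) \<le> (1 - u) * h y + u * h z"
      using convex_onD[OF assms(2), of u y z] u ab by auto
    also have "\<dots> < (1 - u) * s + u * t"
    proof (cases "u = 0")
      case False
      then have "u * h z < u * t" using u ab by simp
      moreover have "(1 - u) * h y \<le> (1 - u) * s" using u ab by (intro mult_left_mono) auto
      ultimately show ?thesis by linarith
    qed (use ab in auto)
    finally show "(1 - u) *\<^sub>R a + u *\<^sub>R b \<in> S"
      using convexD_alt[OF cU ab(3,4), of u] u unfolding S_def ab by auto
  qed
  moreover have "(x, h x) \<notin> S" unfolding S_def by auto
  ultimately have "convex ((\<lambda>w. w - (x, h x)) ` S)" "0 \<notin> (\<lambda>w. w - (x, h x)) ` S"
    by (auto simp only: convex_translation_subtract_eq image_iff eq_iff_diff_eq_0[symmetric, of _ "(x, h x)"]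
        dest!: sym[of 0])
  from separating_hyperplane_set_0[OF this]
  obtain a where a: "a \<noteq> 0" "\<And>z. z \<in> (\<lambda>w. w - (x, h x)) ` S \<Longrightarrow> 0 \<le> a \<bullet> z" by blast
  obtain q \<tau> where a_eq: "a = (q, \<tau>)" by (cases a)
  have sep: "0 \<le> q \<bullet> (y - x) + \<tau> * (t - h x)" if "y \<in> U" "h y < t" for y t
  proof -
    have "(y, t) - (x, h x) \<in> (\<lambda>w. w - (x, h x)) ` S"
      by (rule imageI) (use that in \<open>simp add: S_def\<close>)
    from a(2)[OF this] show ?thesis unfolding a_eq by simp
  qed
  (* Points high above x rule out a negative vertical component. *)
  have "\<tau> \<ge> 0" using sep[of x "h x + 1"] assms(3) by simp
  moreover have "\<tau> \<noteq> 0"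
  proof
    assume t0: "\<tau> = 0"
    obtain e where e: "e > 0" "ball x e \<subseteq> U" using assms by (meson open_contains_ball)
    have q0: "q \<noteq> 0" using a(1) t0 a_eq by (auto simp: zero_prod_def)
    define y where "y = x - (e / 2 / norm q) *\<^sub>R q"
    have "dist x y = e / 2" unfolding y_def dist_norm using q0 e by simp
    then have "y \<in> U" using e by auto
    then have "0 \<le> q \<bullet> (y - x)" using sep[of y "h y + 1"] t0 by simp
    then have "0 \<le> - (e / 2 / norm q) * (norm q)\<^sup>2" unfolding y_def by (simp add: dot_square_norm)
    moreover have "(e / 2 / norm q) * (norm q)\<^sup>2 > 0" using e q0 by simp
    ultimately show False by simp
  qed
  ultimately have tau: "\<tau> > 0" by simp
  show thesis
  proof (rule that[of "(- 1 / \<tau>) *\<^sub>R q"])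
    fix y assume y: "y \<in> U"
    show "h x + ((- 1 / \<tau>) *\<^sub>R q) \<bullet> (y - x) \<le> h y"
    proof (rule field_le_epsilon)
      fix d :: real assume "d > 0"
      then have "0 \<le> q \<bullet> (y - x) + \<tau> * (h y + d - h x)" using sep[OF y] by simp
      then have "0 \<le> (q \<bullet> (y - x) + \<tau> * (h y + d - h x)) / \<tau>" using tau by simp
      also have "\<dots> = (q \<bullet> (y - x)) / \<tau> + (h y + d - h x)" using tau by (simp add: add_divide_distrib)
      finally show "h x + ((- 1 / \<tau>) *\<^sub>R q) \<bullet> (y - x) \<le> h y + d" by simp
    qed
  qed
qed

text \<open>
  Supergradients exist everywhere, and they are bounded near \<open>x0\<close> because a supergradient of norm \<open>N\<close>
  makes the function drop by at least \<open>N * e / 2\<close> at some point at distance \<open>e / 2\<close>.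
\<close>

lemma semiconcave_at_concave:
  assumes "open U" "concave_on U h" "x0 \<in> U"
  shows "semiconcave_at h x0"
proof -
  have cv: "convex_on U (\<lambda>x. - h x)" using assms(2) unfolding concave_on_def .
  obtain e where e: "e > 0" "cball x0 e \<subseteq> U" using assms by (meson open_contains_cball)
  have "continuous_on U (\<lambda>x. - h x)" using convex_on_continuous[OF assms(1) cv] .
  then have "continuous_on (cball x0 e) (\<lambda>x. - h x)" using e(2) continuous_on_subset by blast
  then have "bounded ((\<lambda>x. - h x) ` cball x0 e)"
    using compact_cball compact_continuous_image compact_imp_bounded by blast
  then obtain M where "\<forall>x\<in>cball x0 e. \<bar>h x\<bar> \<le> M" unfolding bounded_iff by auto
  then have M: "\<bar>h x\<bar> \<le> M" if "x \<in> cball x0 e" for x using that by blast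
  have M0: "0 \<le> M" using M[of x0] e by force
  define C where "C = 4 * M / e"
  have C0: "0 \<le> C" unfolding C_def using M0 e by simp
  have "\<exists>p. norm p \<le> C \<and> (\<forall>y\<in>ball x0 (e / 2). h y \<le> h x + p \<bullet> (y - x) + C * (norm (y - x))\<^sup>2)"
    if x: "x \<in> ball x0 (e / 2)" for x
  proof -
    have xU: "x \<in> U" "x \<in> cball x0 e" using x e by auto
    obtain p where p: "\<And>y. y \<in> U \<Longrightarrow> - h y \<ge> - h x + p \<bullet> (y - x)"
      using convex_on_subgradient[OF assms(1) cv xU(1)] by blast
    have "norm p \<le> C"
    proof (cases "p = 0")
      case False
      define y where "y = x + (e / 2 / norm p) *\<^sub>R p"
      have "dist x y = e / 2" unfolding y_def dist_norm using False e by simp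
      then have yc: "y \<in> cball x0 e" using x dist_triangle[of x0 y x] by auto
      have "p \<bullet> (y - x) = e / 2 * norm p" unfolding y_def using False
        by (simp add: dot_square_norm power2_eq_square)
      then have "e / 2 * norm p \<le> 2 * M" using p[of y] yc e M[OF yc] M[OF xU(2)] by auto
      then show ?thesis unfolding C_def using e by (simp add: field_simps)
    qed (use C0 in auto)
    moreover have "h y \<le> h x + (- p) \<bullet> (y - x) + C * (norm (y - x))\<^sup>2" if "y \<in> ball x0 (e / 2)" for y
    proof -
      have "y \<in> U" using that e by auto
      then show ?thesis using p[of y] mult_nonneg_nonneg[OF C0 zero_le_power2[of "norm (y - x)"]] by simp
    qed
    ultimately show ?thesis by (intro exI[of _ "- p"]) auto
  qed
  then show ?thesis unfolding semiconcave_at_def using e(1) half_gt_zero by blast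
qed

text \<open>
  If a paraboloid with slope \<open>p\<close> touches from above and one with slope \<open>- q\<close> from below, the difference
  of the two is nonnegative near \<open>x\<close> and vanishes at \<open>x\<close>, which forces \<open>p = - q\<close>.
\<close>

lemma semiconcave_both_gradient:
  assumes "semiconcave_at F x0" "semiconcave_at (\<lambda>x. - F x) x0"
  obtains e C where "0 < e" "0 \<le> C" "\<And>x. x \<in> ball x0 e \<Longrightarrow> \<exists>p. \<forall>y\<in>ball x0 e.
    \<bar>F y - F x - p \<bullet> (y - x)\<bar> \<le> C * (norm (y - x))\<^sup>2"
proof -
  obtain e C where e: "0 < e" and C: "\<And>x. x \<in> ball x0 e \<Longrightarrow> touched_above F (ball x0 e) C x"
    using assms(1) unfolding semiconcave_at_def by blast
  have "x0 \<in> ball x0 e" using e by simp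
  then obtain d B where d: "0 < d" "d \<le> 1" "ball x0 d \<subseteq> ball x0 e" "1 \<le> B" and B: "\<And>x. x \<in> ball x0 d \<Longrightarrow> \<exists>p. norm p \<le> B \<and>
     (\<forall>y\<in>ball x0 d. - F y \<le> - F x + p \<bullet> (y - x) + B * (norm (y - x))\<^sup>2)"
    by (rule semiconcave_atE[OF assms(2) open_ball]) (rule that)
  have C0: "0 \<le> C" using C[of x0] e norm_ge_zero order_trans by (metis centre_in_ball)
  have "\<exists>p. \<forall>y\<in>ball x0 d. \<bar>F y - F x - p \<bullet> (y - x)\<bar> \<le> (C + B) * (norm (y - x))\<^sup>2"
    if x: "x \<in> ball x0 d" for x
  proof -
    obtain p where p: "\<And>y. y \<in> ball x0 d \<Longrightarrow> F y \<le> F x + p \<bullet> (y - x) + C * (norm (y - x))\<^sup>2"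
      using C[of x] x d(3) by blast
    obtain q where q: "\<And>y. y \<in> ball x0 d \<Longrightarrow> - F y \<le> - F x + q \<bullet> (y - x) + B * (norm (y - x))\<^sup>2"
      using B[OF x] by blast
    have "p + q = 0"
    proof (rule ccontr)
      assume ne: "p + q \<noteq> 0"
      obtain r where r: "r > 0" "ball x r \<subseteq> ball x0 d" using x open_ball open_contains_ball by metis
      let ?n = "norm (p + q)"
      (* Moving by t against p + q lowers the linear term by t * ?n, more than the quadratic
         term can compensate. *)
      define t where "t = min (r / 2) (?n / (2 * (C + B)))"
      have CB: "C + B > 0" using C0 d by simp
      have t: "0 < t" "t < r" "t \<le> ?n / (2 * (C + B))" unfolding t_def using r ne CB by auto
      define y where "y = x - (t / ?n) *\<^sub>R (p + q)"
      have n: "norm (y - x) = t" unfolding y_def using ne t by simp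
      then have "y \<in> ball x0 d" using r t by (auto simp: dist_norm norm_minus_commute)
      then have "0 \<le> (p + q) \<bullet> (y - x) + (C + B) * t\<^sup>2"
        using p[of y] q[of y] n by (simp add: inner_add_left algebra_simps)
      moreover have "(p + q) \<bullet> (y - x) = - t * ?n"
      proof -
        have "(p + q) \<bullet> (y - x) = - (t / ?n * ((p + q) \<bullet> (p + q)))" unfolding y_def by simp
        also have "\<dots> = - t * ?n" using ne unfolding dot_square_norm power2_eq_square by simp
        finally show ?thesis .
      qed
      ultimately have "t * ?n \<le> t * ((C + B) * t)" by (simp add: power2_eq_square mult_ac)
      then have "?n \<le> (C + B) * t" using t by simp
      also have "\<dots> \<le> (C + B) * (?n / (2 * (C + B)))" using t CB by (intro mult_left_mono) auto
      also have "\<dots> = ?n / 2" using CB by (simp add: field_simps)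
      finally show False using ne by simp
    qed
    then have q': "q = - p" by (simp add: eq_neg_iff_add_eq_0 add.commute)
    show ?thesis
    proof (intro exI[of _ p] ballI)
      fix y assume y: "y \<in> ball x0 d"
      have "0 \<le> C * (norm (y - x))\<^sup>2" "0 \<le> B * (norm (y - x))\<^sup>2" using C0 d by auto
      then show "\<bar>F y - F x - p \<bullet> (y - x)\<bar> \<le> (C + B) * (norm (y - x))\<^sup>2"
        using p[OF y] q[OF y] unfolding q' by (simp add: abs_le_iff algebra_simps)
    qed
  qed
  then show thesis using that[of d "C + B"] d C0 by auto
qed

text \<open>
  Two-sided paraboloids at every point determine the gradient. Comparing the expansions at \<open>x\<close> and \<open>y\<close>
  at the point \<open>x + v\<close>, where \<open>v\<close> has the length of \<open>x - y\<close> and the direction of the difference of the two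
  gradients, shows that the gradient is Lipschitz.
\<close>

lemma locally_C11_onI:
  assumes "open S" "\<And>x. x \<in> S \<Longrightarrow> semiconcave_at F x" "\<And>x. x \<in> S \<Longrightarrow> semiconcave_at (\<lambda>x. - F x) x"
  shows "locally_C11_on S F"
proof -
  have loc: "\<exists>e>0. \<exists>C\<ge>0. \<exists>p. \<forall>x\<in>ball x0 e. \<forall>y\<in>ball x0 e.
    \<bar>F y - F x - p x \<bullet> (y - x)\<bar> \<le> C * (norm (y - x))\<^sup>2" if "x0 \<in> S" for x0
    using semiconcave_both_gradient[OF assms(2,3)[OF that]] by metis
  have der: "(F has_derivative (\<lambda>v. p \<bullet> v)) (at x)"
    if "e > 0" "x \<in> ball x0 e" "\<forall>y\<in>ball x0 e. \<bar>F y - F x - p \<bullet> (y - x)\<bar> \<le> C * (norm (y - x))\<^sup>2"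
    for x x0 e C and p :: 'a
    unfolding has_derivative_at2
  proof
    show "bounded_linear ((\<bullet>) p)" by (rule bounded_linear_inner_right)
    have "eventually (\<lambda>y. y \<in> ball x0 e) (at x)"
      using that by (intro eventually_at_in_open'[OF open_ball]) auto
    then have "eventually (\<lambda>y. norm ((1 / norm (y - x)) *\<^sub>R (F y - (F x + p \<bullet> (y - x)))) \<le> C * norm (y - x)) (at x)"
    proof (rule eventually_mono)
      fix y assume "y \<in> ball x0 e"
      then have "\<bar>F y - F x - p \<bullet> (y - x)\<bar> \<le> C * (norm (y - x))\<^sup>2" using that(3) by blast
      then show "norm ((1 / norm (y - x)) *\<^sub>R (F y - (F x + p \<bullet> (y - x)))) \<le> C * norm (y - x)"
        by (cases "y = x") (auto simp: field_simps power2_eq_square)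
    qed
    moreover have "((\<lambda>y. C * norm (y - x)) \<longlongrightarrow> 0) (at x)"
      by (auto intro!: tendsto_eq_intros)
    ultimately show "(\<lambda>y. (1 / norm (y - x)) *\<^sub>R (F y - (F x + p \<bullet> (y - x)))) \<midarrow>x\<rightarrow> 0"
      by (rule Lim_null_comparison)
  qed
  have "\<exists>p. (F has_derivative (\<lambda>v. p \<bullet> v)) (at x)" if x: "x \<in> S" for x
  proof -
    obtain e C p where "e > 0" "\<forall>x'\<in>ball x e. \<forall>y\<in>ball x e.
      \<bar>F y - F x' - p x' \<bullet> (y - x')\<bar> \<le> C * (norm (y - x'))\<^sup>2" using loc[OF x] by blast
    then show ?thesis using der[of e x x "p x" C] by auto
  qed
  then obtain G where G: "\<And>x. x \<in> S \<Longrightarrow> (F has_derivative (\<lambda>v. G x \<bullet> v)) (at x)" by metis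
  have lip: "\<exists>e>0. \<exists>L. L-lipschitz_on (ball x0 e \<inter> S) (\<lambda>x. blinfun_inner_right (G x))"
    if x0: "x0 \<in> S" for x0
  proof -
    obtain e C p where e: "e > 0" "C \<ge> 0" and p: "\<And>x y. x \<in> ball x0 e \<Longrightarrow> y \<in> ball x0 e \<Longrightarrow>
      \<bar>F y - F x - p x \<bullet> (y - x)\<bar> \<le> C * (norm (y - x))\<^sup>2" using loc[OF x0] by blast
    have pG: "p x = G x" if "x \<in> ball x0 e" "x \<in> S" for x
    proof -
      have "(F has_derivative (\<lambda>v. p x \<bullet> v)) (at x)" using der[OF e(1) that(1)] p[OF that(1)] by blast
      from has_derivative_unique[OF this G[OF that(2)]] have "p x \<bullet> v = G x \<bullet> v" for v by meson
      then show ?thesis using vector_eq_rdot by blast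
    qed
    have "norm (G x - G y) \<le> 6 * C * norm (x - y)"
      if xy: "x \<in> ball x0 (e / 3)" "y \<in> ball x0 (e / 3)" "x \<in> S" "y \<in> S" for x y
    proof (cases "G x = G y")
      case False
      let ?n = "norm (x - y)" and ?w = "G x - G y"
      have n0: "?n > 0" using False by auto
      define v where "v = (?n / norm ?w) *\<^sub>R ?w"
      have nv: "norm v = ?n" unfolding v_def using False by simp
      have wv: "?w \<bullet> v = ?n * norm ?w"
      proof -
        have "?w \<bullet> v = ?n / norm ?w * (?w \<bullet> ?w)" unfolding v_def by simp
        also have "\<dots> = ?n * norm ?w" using False unfolding dot_square_norm power2_eq_square by simp
        finally show ?thesis .
      qed
      have xb: "x \<in> ball x0 e" "y \<in> ball x0 e" using xy e by auto
      have "dist x y < e / 3 + e / 3"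
        using dist_triangle_less_add[of x x0 "e / 3" y "e / 3"] xy by (simp add: dist_commute)
      then have "norm v < 2 * e / 3" using nv by (simp add: dist_norm)
      then have "dist x0 (x + v) < e"
        using dist_triangle[of x0 "x + v" x] xy(1) by (simp add: dist_norm)
      then have xv: "x + v \<in> ball x0 e" by simp
      have 1: "\<bar>F (x + v) - F x - G x \<bullet> v\<bar> \<le> C * ?n\<^sup>2" using p[OF xb(1) xv] pG[OF xb(1)] xy nv by simp
      have 2: "\<bar>F x - F y - G y \<bullet> (x - y)\<bar> \<le> C * ?n\<^sup>2" using p[OF xb(2,1)] pG[OF xb(2)] xy by simp
      have 3: "\<bar>F (x + v) - F y - G y \<bullet> (x + v - y)\<bar> \<le> C * (norm (x + v - y))\<^sup>2"
        using p[OF xb(2) xv] pG[OF xb(2)] xy by simp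
      have "norm (x + v - y) \<le> 2 * ?n" using norm_triangle_ineq[of "x - y" v] nv by (simp add: algebra_simps)
      then have "(norm (x + v - y))\<^sup>2 \<le> (2 * ?n)\<^sup>2" by (intro power_mono) auto
      then have "C * (norm (x + v - y))\<^sup>2 \<le> C * (4 * ?n\<^sup>2)" using e(2)
        by (intro mult_left_mono) (auto simp: power_mult_distrib)
      then have "?w \<bullet> v \<le> 6 * C * ?n\<^sup>2" using 1 2 3
        by (simp add: inner_diff_left inner_diff_right inner_add_right abs_le_iff)
      then have "?n * norm ?w \<le> ?n * (6 * C * ?n)" unfolding wv by (simp add: power2_eq_square mult_ac)
      then show ?thesis using n0 by simp
    qed (use e in auto)
    then have "dist (blinfun_inner_right (G x)) (blinfun_inner_right (G y)) \<le> 6 * C * dist x y"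
      if xy: "x \<in> ball x0 (e / 3)" "y \<in> ball x0 (e / 3)" "x \<in> S" "y \<in> S" for x y
    proof -
      have "norm (blinfun_inner_right (G x) - blinfun_inner_right (G y)) \<le> norm (G x - G y)"
        by (rule norm_blinfun_bound)
           (auto simp: blinfun.diff_left inner_diff_left[symmetric] Cauchy_Schwarz_ineq2)
      also have "\<dots> \<le> 6 * C * norm (x - y)" using \<open>\<And>y x. _ \<Longrightarrow> _ \<Longrightarrow> _ \<Longrightarrow> _ \<Longrightarrow> norm (G x - G y) \<le> _\<close> xy by blast
      finally show ?thesis by (simp add: dist_norm)
    qed
    then have "(6 * C)-lipschitz_on (ball x0 (e / 3) \<inter> S) (\<lambda>x. blinfun_inner_right (G x))"
      using e by (intro lipschitz_onI) auto
    then show ?thesis using e(1) by (intro exI[of _ "e / 3"] conjI exI[of _ "6 * C"]) auto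
  qed
  show ?thesis unfolding locally_C11_on_def
  proof (intro exI[of _ "\<lambda>x. blinfun_inner_right (G x)"] conjI ballI)
    show "(F has_derivative blinfun_apply (blinfun_inner_right (G x))) (at x)" if "x \<in> S" for x
      using G[OF that] by simp
    show "continuous_on S (\<lambda>x. blinfun_inner_right (G x))"
    proof (rule continuous_at_imp_continuous_on, rule ballI)
      fix x0 assume x0: "x0 \<in> S"
      then obtain e L where "e > 0" "L-lipschitz_on (ball x0 e \<inter> S) (\<lambda>x. blinfun_inner_right (G x))"
        using lip by blast
      then show "isCont (\<lambda>x. blinfun_inner_right (G x)) x0"
        using lipschitz_on_continuous_on[of L "ball x0 e \<inter> S"] x0 assms(1)
        by (metis IntI centre_in_ball continuous_on_eq_continuous_at open_Int open_ball)
    qed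
    show "\<exists>e>0. \<exists>L. L-lipschitz_on (ball x e \<inter> S) (\<lambda>x. blinfun_inner_right (G x))" if "x \<in> S" for x
      using lip[OF that] .
  qed
qed

section \<open>Insertion between a semiconvex and a semiconcave function\<close>

text \<open>
  A second-order expansion of \<open>F\<close> at \<open>x\<close> in the rescaled variable \<open>(y - x) / r\<close>, with all coefficients
  bounded by \<open>C\<close>. Estimates in this form are invariant under scaling, so that they can be used with
  \<open>r\<close> tending to zero and \<open>C\<close> fixed.
\<close>

definition taylor_bound :: "'a::euclidean_space \<Rightarrow> real \<Rightarrow> 'a set \<Rightarrow> real \<Rightarrow> ('a \<Rightarrow> real) \<Rightarrow> bool" where
  "taylor_bound x r U C F \<longleftrightarrow> \<bar>F x\<bar> \<le> C \<and> (\<exists>m. norm m \<le> C / r \<and>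
     (\<forall>y\<in>U. \<bar>F y - F x - m \<bullet> (y - x)\<bar> \<le> C * (norm (y - x) / r)\<^sup>2))"

lemma taylor_bound_mono:
  assumes "taylor_bound x r U C F" "C \<le> C'" "0 < r"
  shows "taylor_bound x r U C' F"
proof -
  obtain m where m: "norm m \<le> C / r" "\<And>y. y \<in> U \<Longrightarrow> \<bar>F y - F x - m \<bullet> (y - x)\<bar> \<le> C * (norm (y - x) / r)\<^sup>2"
    and F: "\<bar>F x\<bar> \<le> C" using assms(1) unfolding taylor_bound_def by blast
  have "norm m \<le> C' / r" using m(1) assms(2,3) divide_right_mono[of C C' r] by linarith
  moreover have "C * (norm (y - x) / r)\<^sup>2 \<le> C' * (norm (y - x) / r)\<^sup>2" for y
    using assms(2) by (rule mult_right_mono) simp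
  ultimately show ?thesis unfolding taylor_bound_def using m(2) F assms(2)
    by (intro conjI exI[of _ m] ballI) (auto intro: order_trans)
qed

lemma taylor_bound_add:
  assumes "taylor_bound x r U C F" "taylor_bound x r U C' G"
  shows "taylor_bound x r U (C + C') (\<lambda>y. F y + G y)"
proof -
  obtain m where m: "norm m \<le> C / r" "\<And>y. y \<in> U \<Longrightarrow> \<bar>F y - F x - m \<bullet> (y - x)\<bar> \<le> C * (norm (y - x) / r)\<^sup>2"
    and F: "\<bar>F x\<bar> \<le> C" using assms(1) unfolding taylor_bound_def by blast
  obtain l where l: "norm l \<le> C' / r" "\<And>y. y \<in> U \<Longrightarrow> \<bar>G y - G x - l \<bullet> (y - x)\<bar> \<le> C' * (norm (y - x) / r)\<^sup>2"
    and G: "\<bar>G x\<bar> \<le> C'" using assms(2) unfolding taylor_bound_def by blast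
  show ?thesis unfolding taylor_bound_def
  proof (intro conjI exI[of _ "m + l"] ballI)
    show "\<bar>F x + G x\<bar> \<le> C + C'" using F G by linarith
    show "norm (m + l) \<le> (C + C') / r"
      using norm_triangle_ineq[of m l] m(1) l(1) unfolding add_divide_distrib by linarith
    fix y assume "y \<in> U"
    then show "\<bar>F y + G y - (F x + G x) - (m + l) \<bullet> (y - x)\<bar> \<le> (C + C') * (norm (y - x) / r)\<^sup>2"
      using m(2)[of y] l(2)[of y] unfolding inner_add_left distrib_right by linarith
  qed
qed

lemma taylor_bound_sum:
  assumes "finite I" "\<And>i. i \<in> I \<Longrightarrow> taylor_bound x r U C (F i)"
  shows "taylor_bound x r U (real (card I) * C) (\<lambda>y. \<Sum>i\<in>I. F i y)"
  using assms
proof (induction I rule: finite_induct)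
  case empty
  show ?case unfolding taylor_bound_def by (auto intro: exI[of _ 0])
next
  case (insert i I)
  then have "taylor_bound x r U (C + real (card I) * C) (\<lambda>y. F i y + (\<Sum>i\<in>I. F i y))"
    by (intro taylor_bound_add) auto
  then show ?case using insert by (simp add: distrib_right)
qed

lemma taylor_bound_mult:
  assumes "taylor_bound x r U C F" "taylor_bound x r U C' G" "0 < r" "U \<subseteq> cball x r"
  shows "taylor_bound x r U (6 * (C * C')) (\<lambda>y. F y * G y)"
proof -
  obtain m where m: "norm m \<le> C / r" "\<And>y. y \<in> U \<Longrightarrow> \<bar>F y - F x - m \<bullet> (y - x)\<bar> \<le> C * (norm (y - x) / r)\<^sup>2"
    and F: "\<bar>F x\<bar> \<le> C" using assms(1) unfolding taylor_bound_def by blast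
  obtain l where l: "norm l \<le> C' / r" "\<And>y. y \<in> U \<Longrightarrow> \<bar>G y - G x - l \<bullet> (y - x)\<bar> \<le> C' * (norm (y - x) / r)\<^sup>2"
    and G: "\<bar>G x\<bar> \<le> C'" using assms(2) unfolding taylor_bound_def by blast
  have C0: "0 \<le> C" "0 \<le> C'" using F G by linarith+
  have CC: "0 \<le> C * C'" using C0 by simp
  show ?thesis unfolding taylor_bound_def
  proof (intro conjI exI[of _ "F x *\<^sub>R l + G x *\<^sub>R m"] ballI)
    have "\<bar>F x * G x\<bar> \<le> C * C'" unfolding abs_mult using F G C0 by (intro mult_mono) auto
    then show "\<bar>F x * G x\<bar> \<le> 6 * (C * C')" using CC by linarith
    have "norm (F x *\<^sub>R l + G x *\<^sub>R m) \<le> \<bar>F x\<bar> * norm l + \<bar>G x\<bar> * norm m"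
      using norm_triangle_ineq[of "F x *\<^sub>R l" "G x *\<^sub>R m"] by simp
    also have "\<dots> \<le> C * (C' / r) + C' * (C / r)"
      using F G m(1) l(1) C0 assms(3) by (intro add_mono mult_mono) auto
    also have "\<dots> = (2 * (C * C')) / r" by (simp add: add_divide_distrib[symmetric])
    also have "\<dots> \<le> (6 * (C * C')) / r" using CC assms(3) by (intro divide_right_mono) auto
    finally show "norm (F x *\<^sub>R l + G x *\<^sub>R m) \<le> 6 * (C * C') / r" .
    fix y assume y: "y \<in> U"
    define \<tau> where "\<tau> = norm (y - x) / r"
    have \<tau>: "0 \<le> \<tau>" "\<tau> \<le> 1" using y assms(3,4) unfolding \<tau>_def
      by (auto simp: dist_norm norm_minus_commute)
    then have \<tau>2: "\<tau> * \<tau>\<^sup>2 \<le> \<tau>\<^sup>2" "\<tau>\<^sup>2 * \<tau>\<^sup>2 \<le> \<tau>\<^sup>2"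
      using power_le_one[OF \<tau>, of 2] by (intro mult_left_le_one_le; simp)+
    define u v \<epsilon> \<delta> where "u = m \<bullet> (y - x)" and "v = l \<bullet> (y - x)"
      and "\<epsilon> = F y - F x - u" and "\<delta> = G y - G x - v"
    have eps: "\<bar>\<epsilon>\<bar> \<le> C * \<tau>\<^sup>2" "\<bar>\<delta>\<bar> \<le> C' * \<tau>\<^sup>2"
      using m(2)[OF y] l(2)[OF y] unfolding \<epsilon>_def \<delta>_def u_def v_def \<tau>_def by auto
    have u: "\<bar>u\<bar> \<le> C * \<tau>"
      using Cauchy_Schwarz_ineq2[of m "y - x"] mult_right_mono[OF m(1), of "norm (y - x)"]
      unfolding u_def \<tau>_def by simp
    have v: "\<bar>v\<bar> \<le> C' * \<tau>"
      using Cauchy_Schwarz_ineq2[of l "y - x"] mult_right_mono[OF l(1), of "norm (y - x)"]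
      unfolding v_def \<tau>_def by simp
    have prod: "\<bar>a * b\<bar> \<le> C * C' * (s * t)"
      if "\<bar>a\<bar> \<le> C * s" "\<bar>b\<bar> \<le> C' * t" "0 \<le> s" "0 \<le> t" for a b s t
    proof -
      have "\<bar>a * b\<bar> \<le> (C * s) * (C' * t)" unfolding abs_mult using that C0 by (intro mult_mono) auto
      then show ?thesis by (simp add: mult_ac)
    qed
    have e1: "\<bar>F x * \<delta>\<bar> \<le> C * C' * \<tau>\<^sup>2" using prod[of "F x" 1 \<delta> "\<tau>\<^sup>2"] F eps by simp
    have e2: "\<bar>\<epsilon> * G x\<bar> \<le> C * C' * \<tau>\<^sup>2" using prod[of \<epsilon> "\<tau>\<^sup>2" "G x" 1] G eps by simp
    have e3: "\<bar>u * v\<bar> \<le> C * C' * \<tau>\<^sup>2" using prod[OF u v \<tau>(1) \<tau>(1)] by (simp add: power2_eq_square)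
    have e4: "\<bar>u * \<delta>\<bar> \<le> C * C' * (\<tau> * \<tau>\<^sup>2)" using prod[OF u eps(2) \<tau>(1)] by simp
    have e5: "\<bar>\<epsilon> * v\<bar> \<le> C * C' * (\<tau> * \<tau>\<^sup>2)" using prod[OF eps(1) v _ \<tau>(1)] by (simp add: mult_ac)
    have e6: "\<bar>\<epsilon> * \<delta>\<bar> \<le> C * C' * (\<tau>\<^sup>2 * \<tau>\<^sup>2)" using prod[OF eps] by simp
    have t1: "C * C' * (\<tau> * \<tau>\<^sup>2) \<le> C * C' * \<tau>\<^sup>2" "C * C' * (\<tau>\<^sup>2 * \<tau>\<^sup>2) \<le> C * C' * \<tau>\<^sup>2"
      using \<tau>2 CC by (auto intro: mult_left_mono)
    have "F y * G y - F x * G x - (F x *\<^sub>R l + G x *\<^sub>R m) \<bullet> (y - x)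
        = F x * \<delta> + \<epsilon> * G x + u * v + u * \<delta> + \<epsilon> * v + \<epsilon> * \<delta>"
      unfolding \<epsilon>_def \<delta>_def inner_add_left inner_scaleR_left u_def[symmetric] v_def[symmetric]
      by (simp add: algebra_simps)
    then have "\<bar>F y * G y - F x * G x - (F x *\<^sub>R l + G x *\<^sub>R m) \<bullet> (y - x)\<bar> \<le> 6 * (C * C' * \<tau>\<^sup>2)"
      using e1 e2 e3 e4 e5 e6 t1 by linarith
    then show "\<bar>F y * G y - F x * G x - (F x *\<^sub>R l + G x *\<^sub>R m) \<bullet> (y - x)\<bar>
        \<le> 6 * (C * C') * (norm (y - x) / r)\<^sup>2" unfolding \<tau>_def by (simp only: mult.assoc)
  qed
qed

lemma taylor_bound_inverse:
  assumes "taylor_bound x r U C S" "0 < r" "U \<subseteq> cball x r" "x \<in> U" "\<And>y. y \<in> U \<Longrightarrow> 1 \<le> S y"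
  shows "taylor_bound x r U (3 * C\<^sup>2) (\<lambda>y. 1 / S y)"
proof -
  obtain m where m: "norm m \<le> C / r" "\<And>y. y \<in> U \<Longrightarrow> \<bar>S y - S x - m \<bullet> (y - x)\<bar> \<le> C * (norm (y - x) / r)\<^sup>2"
    and S: "\<bar>S x\<bar> \<le> C" using assms(1) unfolding taylor_bound_def by blast
  define a where "a = S x"
  have a: "1 \<le> a" "a \<le> C" using assms(4,5) S unfolding a_def by auto
  have C1: "1 \<le> C" using a by linarith
  have C2: "C \<le> C\<^sup>2" using C1 by (simp add: power2_eq_square)
  have a2: "1 \<le> a\<^sup>2" using a by simp
  show ?thesis unfolding taylor_bound_def
  proof (intro conjI exI[of _ "(- 1 / a\<^sup>2) *\<^sub>R m"] ballI)
    have "\<bar>1 / a\<bar> \<le> 1" using a by simp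
    then show "\<bar>1 / S x\<bar> \<le> 3 * C\<^sup>2" using C1 C2 unfolding a_def by linarith
    have "norm ((- 1 / a\<^sup>2) *\<^sub>R m) \<le> 1 * norm m"
      unfolding norm_scaleR using a2 by (intro mult_right_mono) (auto simp: divide_le_eq)
    also have "\<dots> \<le> C / r" using m by simp
    also have "\<dots> \<le> 3 * C\<^sup>2 / r" using C2 C1 assms(2) by (intro divide_right_mono) auto
    finally show "norm ((- 1 / a\<^sup>2) *\<^sub>R m) \<le> 3 * C\<^sup>2 / r" .
    fix y assume y: "y \<in> U"
    define \<tau> where "\<tau> = norm (y - x) / r"
    have \<tau>: "0 \<le> \<tau>" "\<tau> \<le> 1" using y assms(2,3) unfolding \<tau>_def
      by (auto simp: dist_norm norm_minus_commute)
    define u \<epsilon> where "u = m \<bullet> (y - x)" and "\<epsilon> = S y - a - u"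
    have eps: "\<bar>\<epsilon>\<bar> \<le> C * \<tau>\<^sup>2" using m(2)[OF y] unfolding \<epsilon>_def u_def \<tau>_def a_def by auto
    have u: "\<bar>u\<bar> \<le> C * \<tau>"
      using Cauchy_Schwarz_ineq2[of m "y - x"] mult_right_mono[OF m(1), of "norm (y - x)"]
      unfolding u_def \<tau>_def by simp
    then have u': "\<bar>u\<bar> \<le> C" using \<tau> C1 by (smt (verit) mult_left_le)
    have Sy: "1 \<le> S y" using assms(5)[OF y] .
    have id: "1 / S y - 1 / a - ((- 1 / a\<^sup>2) *\<^sub>R m) \<bullet> (y - x) = (u\<^sup>2 + u * \<epsilon> - a * \<epsilon>) / (a\<^sup>2 * S y)"
    proof -
      have m_eq: "((- 1 / a\<^sup>2) *\<^sub>R m) \<bullet> (y - x) = - u / a\<^sup>2" unfolding u_def by simp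
      have "1 / S y - 1 / a - (- u / a\<^sup>2) = (a\<^sup>2 - a * S y + u * S y) / (a\<^sup>2 * S y)"
        using a Sy by (simp add: field_simps power2_eq_square)
      moreover have "a\<^sup>2 - a * S y + u * S y = u\<^sup>2 + u * \<epsilon> - a * \<epsilon>"
        unfolding \<epsilon>_def by (simp add: algebra_simps power2_eq_square)
      ultimately show ?thesis unfolding m_eq by (simp only:)
    qed
    have "1 \<le> a\<^sup>2 * S y" using mult_mono[OF a2 Sy] a2 by simp
    then have "\<bar>(u\<^sup>2 + u * \<epsilon> - a * \<epsilon>) / (a\<^sup>2 * S y)\<bar> \<le> \<bar>u\<^sup>2 + u * \<epsilon> - a * \<epsilon>\<bar>"
      unfolding abs_divide by (simp add: divide_le_eq mult_le_cancel_left1)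
    also have "\<dots> \<le> 3 * C\<^sup>2 * \<tau>\<^sup>2"
    proof -
      have "u\<^sup>2 \<le> (C * \<tau>)\<^sup>2" using u power_mono[of "\<bar>u\<bar>" "C * \<tau>" 2] by simp
      moreover have "\<bar>u * \<epsilon>\<bar> \<le> C * (C * \<tau>\<^sup>2)" unfolding abs_mult using u' eps C1 by (intro mult_mono) auto
      moreover have "\<bar>a * \<epsilon>\<bar> \<le> C * (C * \<tau>\<^sup>2)" unfolding abs_mult using a eps C1 by (intro mult_mono) auto
      ultimately have "\<bar>u\<^sup>2 + u * \<epsilon> - a * \<epsilon>\<bar> \<le> C\<^sup>2 * \<tau>\<^sup>2 + C * (C * \<tau>\<^sup>2) + C * (C * \<tau>\<^sup>2)"
        using zero_le_power2[of u] unfolding power_mult_distrib by linarith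
      then show ?thesis by (simp add: power2_eq_square algebra_simps)
    qed
    finally show "\<bar>1 / S y - 1 / S x - ((- 1 / a\<^sup>2) *\<^sub>R m) \<bullet> (y - x)\<bar> \<le> 3 * C\<^sup>2 * (norm (y - x) / r)\<^sup>2"
      unfolding a_def[symmetric] id \<tau>_def .
  qed
qed

text \<open>
  Rescaled bumps have scale-invariant expansions as long as their radius is comparable with \<open>r\<close>. The
  constant 30 bounds, in units of the bump radius, the distances that occur between a centre and the
  points at which its bump is expanded.
\<close>

lemma bump_taylor_bound:
  assumes "0 < d"
  shows "\<exists>B\<ge>1. \<forall>(x::'a::euclidean_space) c s r \<kappa> U. 0 < s \<longrightarrow> 0 < r \<longrightarrow> 1 \<le> \<kappa> \<longrightarrow> r \<le> \<kappa> * s \<longrightarrow> x \<in> U \<longrightarrow>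
      (\<forall>y\<in>U. norm (y - c) \<le> 30 * d * s) \<longrightarrow>
      taylor_bound x r U (B * \<kappa>\<^sup>2) (\<lambda>y. bump d ((1 / s) *\<^sub>R (y - c)))"
proof -
  have "Ck_on 2 UNIV (bump d :: 'a \<Rightarrow> real)"
    using smooth_on_iff_smooth_at[of UNIV "bump d :: 'a \<Rightarrow> real"] smooth_at_bump
    unfolding smooth_on_def by blast
  then obtain C where C0: "C \<ge> 0" and C: "\<And>x::'a. x \<in> cball 0 (30 * d) \<Longrightarrow>
      taylor_expansion (bump d) (cball 0 (30 * d)) C x"
    by (rule Ck_on_2_taylor[OF open_UNIV _ compact_cball convex_cball subset_UNIV]) (rule that)
  define B where "B = max 1 C"
  have B: "1 \<le> B" "C \<le> B" unfolding B_def by auto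
  show ?thesis
  proof (intro exI[of _ B] conjI B(1) allI impI)
    fix x c :: 'a and s r \<kappa> :: real and U :: "'a set"
    assume s: "0 < s" and r: "0 < r" and \<kappa>: "1 \<le> \<kappa>" "r \<le> \<kappa> * s" and xU: "x \<in> U"
      and "\<forall>y\<in>U. norm (y - c) \<le> 30 * d * s"
    then have U: "norm (y - c) \<le> 30 * d * s" if "y \<in> U" for y using that by blast
    let ?t = "\<lambda>y. (1 / s) *\<^sub>R (y - c)"
    have t: "?t y \<in> cball 0 (30 * d)" if "y \<in> U" for y
    proof -
      have "norm (?t y) = norm (y - c) / s" using s by simp
      also have "\<dots> \<le> 30 * d" using U[OF that] s by (simp add: divide_le_eq)
      finally show ?thesis by simp
    qed
    obtain D where D: "linear D" "\<And>v. norm (D v) \<le> C * norm v"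
      "\<And>z. z \<in> cball 0 (30 * d) \<Longrightarrow> norm (bump d z - bump d (?t x) - D (z - ?t x)) \<le> C * (norm (z - ?t x))\<^sup>2"
      using C[OF t[OF xU]] by blast
    obtain p where p: "norm p \<le> C * 1" "\<And>v. p \<bullet> v = 1 \<bullet> D v"
      using functional_as_inner[OF D(1,2), of 1 1] C0 by auto
    have \<kappa>2: "\<kappa> \<le> \<kappa>\<^sup>2" "1 \<le> \<kappa>\<^sup>2" using \<kappa>(1) one_le_power[OF \<kappa>(1), of 2] self_le_power[OF \<kappa>(1), of 2] by auto
    have Bk: "1 \<le> B * \<kappa>\<^sup>2" using mult_mono[OF B(1) \<kappa>2(2)] B by simp
    have inv: "1 / s \<le> \<kappa> / r" using \<kappa>(2) s r by (simp add: field_simps)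
    show "taylor_bound x r U (B * \<kappa>\<^sup>2) (\<lambda>y. bump d (?t y))"
      unfolding taylor_bound_def
    proof (intro conjI exI[of _ "(1 / s) *\<^sub>R p"] ballI)
      show "\<bar>bump d (?t x)\<bar> \<le> B * \<kappa>\<^sup>2" using bump_range[of d "?t x"] Bk by simp
      have "norm ((1 / s) *\<^sub>R p) = 1 / s * norm p" using s by simp
      also have "\<dots> \<le> \<kappa> / r * B" using inv p(1) B C0 s r \<kappa> by (intro mult_mono) auto
      also have "\<dots> = B * \<kappa> / r" by simp
      also have "\<dots> \<le> B * \<kappa>\<^sup>2 / r" using \<kappa>2 B r by (intro divide_right_mono mult_left_mono) auto
      finally show "norm ((1 / s) *\<^sub>R p) \<le> B * \<kappa>\<^sup>2 / r" .
      fix y assume y: "y \<in> U"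
      have tt: "?t y - ?t x = (1 / s) *\<^sub>R (y - x)" by (simp add: scaleR_diff_right)
      have "\<bar>bump d (?t y) - bump d (?t x) - ((1 / s) *\<^sub>R p) \<bullet> (y - x)\<bar>
          \<le> C * (norm ((1 / s) *\<^sub>R (y - x)))\<^sup>2"
        using D(3)[OF t[OF y]] p(2)[of "?t y - ?t x"] unfolding tt by simp
      also have "norm ((1 / s) *\<^sub>R (y - x)) = 1 / s * norm (y - x)" using s by simp
      also have "C * (1 / s * norm (y - x))\<^sup>2 \<le> B * (\<kappa> / r * norm (y - x))\<^sup>2"
        using B C0 inv s by (intro mult_mono power_mono mult_right_mono) auto
      also have "\<dots> = B * \<kappa>\<^sup>2 * (norm (y - x) / r)\<^sup>2" by (simp add: power_mult_distrib power_divide)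
      finally show "\<bar>bump d (?t y) - bump d (?t x) - ((1 / s) *\<^sub>R p) \<bullet> (y - x)\<bar>
          \<le> B * \<kappa>\<^sup>2 * (norm (y - x) / r)\<^sup>2" .
    qed
  qed
qed

definition int_lattice :: "'a::euclidean_space set" where
  "int_lattice = {z. \<forall>b\<in>Basis. z \<bullet> b \<in> \<int>}"

lemma int_lattice_near:
  fixes y :: "'a::euclidean_space"
  obtains z where "z \<in> int_lattice" "norm (y - z) \<le> real DIM('a)"
proof
  let ?z = "\<Sum>b\<in>Basis. real_of_int \<lfloor>y \<bullet> b\<rfloor> *\<^sub>R b"
  show "?z \<in> int_lattice" unfolding int_lattice_def by simp
  have "norm (y - ?z) \<le> (\<Sum>b\<in>Basis. \<bar>(y - ?z) \<bullet> b\<bar>)" by (rule norm_le_l1)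
  also have "\<dots> \<le> (\<Sum>b\<in>(Basis::'a set). 1)"
  proof (rule sum_mono)
    fix b :: 'a assume "b \<in> Basis"
    then have "(y - ?z) \<bullet> b = y \<bullet> b - real_of_int \<lfloor>y \<bullet> b\<rfloor>" by (simp add: inner_diff_left)
    then show "\<bar>(y - ?z) \<bullet> b\<bar> \<le> 1" by linarith
  qed
  finally show "norm (y - ?z) \<le> real DIM('a)" by simp
qed

lemma finite_int_lattice_cball: "finite (int_lattice \<inter> cball (0::'a::euclidean_space) R)"
proof (rule inj_on_finite)
  let ?\<Phi> = "\<lambda>z::'a. restrict (\<lambda>b. \<lfloor>z \<bullet> b\<rfloor>) Basis"
  show "inj_on ?\<Phi> (int_lattice \<inter> cball 0 R)"
  proof (rule inj_onI)
    fix x y :: 'a assume x: "x \<in> int_lattice \<inter> cball 0 R" and y: "y \<in> int_lattice \<inter> cball 0 R"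
      and eq: "?\<Phi> x = ?\<Phi> y"
    show "x = y"
    proof (rule euclidean_eqI)
      fix b :: 'a assume b: "b \<in> Basis"
      then have "\<lfloor>x \<bullet> b\<rfloor> = \<lfloor>y \<bullet> b\<rfloor>" using fun_cong[OF eq, of b] by simp
      then show "x \<bullet> b = y \<bullet> b" using x y b unfolding int_lattice_def
        by (auto elim!: Ints_cases)
    qed
  qed
  show "?\<Phi> ` (int_lattice \<inter> cball 0 R) \<subseteq> Basis \<rightarrow>\<^sub>E {\<lfloor>- R\<rfloor>..\<lceil>R\<rceil>}"
  proof (intro image_subsetI PiE_I)
    fix x b :: 'a assume x: "x \<in> int_lattice \<inter> cball 0 R" and b: "b \<in> Basis"
    then have "\<bar>x \<bullet> b\<bar> \<le> R" using Basis_le_norm[OF b, of x] by auto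
    then show "?\<Phi> x b \<in> {\<lfloor>- R\<rfloor>..\<lceil>R\<rceil>}" using b by (auto simp: abs_le_iff intro: floor_mono) linarith+
  qed auto
  show "finite ((Basis::'a set) \<rightarrow>\<^sub>E {\<lfloor>- R\<rfloor>..\<lceil>R\<rceil>})" by (intro finite_PiE) auto
qed

text \<open>
  Translating by a lattice point reduces the count to a ball around the origin, at the price of
  enlarging the radius by a bound for the covering radius of the lattice. This is what bounds the overlap of the
  bumps independently of the point.
\<close>

lemma card_int_lattice_cball:
  obtains N where "\<And>y::'a::euclidean_space. finite (int_lattice \<inter> cball y R) \<and> card (int_lattice \<inter> cball y R) \<le> N"
proof
  let ?A = "int_lattice \<inter> cball (0::'a) (R + real DIM('a))"
  fix y :: 'a
  obtain z where z: "z \<in> int_lattice" "norm (y - z) \<le> real DIM('a)" using int_lattice_near .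
  have sub: "int_lattice \<inter> cball y R \<subseteq> (+) z ` ?A"
  proof
    fix x assume x: "x \<in> int_lattice \<inter> cball y R"
    have "norm (x - z) \<le> R + real DIM('a)"
      using norm_triangle_ineq[of "x - y" "y - z"] x z by (simp add: dist_norm norm_minus_commute)
    then have "x - z \<in> ?A" using x z by (auto simp: int_lattice_def inner_diff_left)
    then show "x \<in> (+) z ` ?A" by (rule rev_image_eqI) simp
  qed
  have fin: "finite ((+) z ` ?A)" using finite_int_lattice_cball by blast
  have "card ((+) z ` ?A) \<le> card ?A" by (rule card_image_le) (rule finite_int_lattice_cball)
  then show "finite (int_lattice \<inter> cball y R) \<and> card (int_lattice \<inter> cball y R) \<le> card ?A"
    using finite_subset[OF sub fin] card_mono[OF fin sub] by linarith
qed

text \<open>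
  The data for inserting a function between \<open>f\<close> and \<open>g\<close> near a contact point \<open>x0\<close>: \<open>p x\<close> is the slope of a
  paraboloid below \<open>f\<close> and \<open>q x\<close> that of a paraboloid above \<open>g\<close>. The paraboloids are available on the
  large ball of radius \<open>R\<close>, while the points \<open>x\<close> range over the small ball of radius \<open>e\<close>; together with
  the smallness of the gap this leaves room for moving from \<open>x\<close> by a distance comparable with the
  square root of the gap.
\<close>

locale squeezed_pair =
  fixes f g :: "'a::euclidean_space \<Rightarrow> real" and x0 :: 'a and R e K d :: real and p q :: "'a \<Rightarrow> 'a"
  assumes e: "0 < e" "e \<le> R / 8" and K: "1 \<le> K" and d: "d = real DIM('a)"
    and f_below: "\<And>x y. x \<in> ball x0 R \<Longrightarrow> y \<in> ball x0 R \<Longrightarrow> f x + p x \<bullet> (y - x) - K * (norm (y - x))\<^sup>2 \<le> f y"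
    and g_above: "\<And>x y. x \<in> ball x0 R \<Longrightarrow> y \<in> ball x0 R \<Longrightarrow> g y \<le> g x + q x \<bullet> (y - x) + K * (norm (y - x))\<^sup>2"
    and p_bound: "\<And>x. x \<in> ball x0 R \<Longrightarrow> norm (p x) \<le> K"
    and f_le_g: "\<And>x. x \<in> ball x0 R \<Longrightarrow> f x \<le> g x"
    and contact: "f x0 = g x0"
    and gap_small: "\<And>x. x \<in> ball x0 e \<Longrightarrow> sqrt (g x - f x) \<le> R / 8"
begin

text \<open>
  The square root of the gap is the natural length scale at \<open>x\<close>.
\<close>

definition "\<rho> x = sqrt (g x - f x)"
definition "L = 1 + 2 * K"

lemma L_ge: "3 \<le> L" and K_le: "2 * K \<le> L" "0 < L"
  unfolding L_def using K by auto

lemma R_pos: "0 < R" using e by linarith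

lemma small_ball: "x \<in> ball x0 e \<Longrightarrow> x \<in> ball x0 R"
  using e R_pos by auto

lemma \<rho>_nonneg: "x \<in> ball x0 R \<Longrightarrow> 0 \<le> \<rho> x"
  unfolding \<rho>_def using f_le_g by simp

lemma \<rho>_sq: "x \<in> ball x0 R \<Longrightarrow> (\<rho> x)\<^sup>2 = g x - f x"
  unfolding \<rho>_def using f_le_g by simp

lemma \<rho>_small: "x \<in> ball x0 e \<Longrightarrow> \<rho> x \<le> R / 8"
  unfolding \<rho>_def using gap_small .

text \<open>
  The gap \<open>g - f\<close> is nonnegative and lies below a paraboloid with slope \<open>q x - p x\<close>. Moving against
  this slope by the distance \<open>\<rho> x\<close> would make the gap negative if the slope were larger.
\<close>

lemma slope_gap:
  assumes x: "x \<in> ball x0 e"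
  shows "norm (q x - p x) \<le> L * \<rho> x"
proof (cases "q x - p x = 0")
  case True
  then show ?thesis using \<rho>_nonneg[OF small_ball[OF x]] K_le by simp
next
  case False
  let ?l = "q x - p x"
  have xR: "x \<in> ball x0 R" using small_ball[OF x] .
  have step: "t * norm ?l \<le> (\<rho> x)\<^sup>2 + 2 * K * t\<^sup>2" if t: "0 < t" "t \<le> R / 8" for t
  proof -
    define v where "v = - (t / norm ?l) *\<^sub>R ?l"
    have nv: "norm v = t" unfolding v_def using False t by simp
    have "dist x0 (x + v) < R"
      using dist_triangle[of x0 "x + v" x] x nv e t by (simp add: dist_norm)
    then have y: "x + v \<in> ball x0 R" by simp
    have "?l \<bullet> v = - (t / norm ?l * (?l \<bullet> ?l))" unfolding v_def by simp
    also have "\<dots> = - (t * norm ?l)" using False unfolding dot_square_norm power2_eq_square by simp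
    finally have lv: "?l \<bullet> v = - (t * norm ?l)" .
    have "0 \<le> g (x + v) - f (x + v)" using f_le_g[OF y] by simp
    also have "\<dots> \<le> (g x - f x) + ?l \<bullet> v + 2 * K * t\<^sup>2"
      using g_above[OF xR y] f_below[OF xR y] nv by (simp add: inner_diff_left)
    finally show ?thesis unfolding \<rho>_sq[OF xR] lv by simp
  qed
  show ?thesis
  proof (cases "\<rho> x = 0")
    case True
    define t where "t = min (R / 8) (norm ?l / (4 * K))"
    have t: "0 < t" "t \<le> R / 8" "t \<le> norm ?l / (4 * K)" unfolding t_def using False R_pos K by auto
    have "t * norm ?l \<le> t * (2 * K * t)" using step[OF t(1,2)] True by (simp add: power2_eq_square mult_ac)
    then have "norm ?l \<le> 2 * K * t" using t by simp
    also have "\<dots> \<le> 2 * K * (norm ?l / (4 * K))" using t(3) K by (intro mult_left_mono) auto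
    also have "\<dots> = norm ?l / 2" using K by simp
    finally show ?thesis using False by simp
  next
    case False
    then have r: "0 < \<rho> x" using \<rho>_nonneg[OF xR] by simp
    have "\<rho> x * norm ?l \<le> \<rho> x * (L * \<rho> x)"
      using step[OF r \<rho>_small[OF x]] unfolding L_def by (simp add: power2_eq_square algebra_simps)
    then show ?thesis using r by simp
  qed
qed

lemma slope_gap_inner:
  assumes x: "x \<in> ball x0 e"
  shows "q x \<bullet> v \<le> p x \<bullet> v + L * \<rho> x * norm v"
proof -
  have "(q x - p x) \<bullet> v \<le> norm (q x - p x) * norm v" by (rule norm_cauchy_schwarz)
  also have "\<dots> \<le> L * \<rho> x * norm v" using slope_gap[OF x] by (rule mult_right_mono) simp
  finally show ?thesis by (simp add: inner_diff_left)
qed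

text \<open>
  The paraboloid above the gap at \<open>x\<close> is dominated by the perfect square \<open>(\<rho> x + L * norm (y - x))\<^sup>2\<close>.
\<close>

lemma \<rho>_lipschitz:
  assumes x: "x \<in> ball x0 e" and y: "y \<in> ball x0 R"
  shows "\<rho> y \<le> \<rho> x + L * norm (y - x)"
proof -
  have xR: "x \<in> ball x0 R" using small_ball[OF x] .
  let ?n = "norm (y - x)"
  have "(\<rho> y)\<^sup>2 \<le> (\<rho> x)\<^sup>2 + (L * \<rho> x * ?n) + 2 * K * ?n\<^sup>2"
    unfolding \<rho>_sq[OF xR] \<rho>_sq[OF y]
    using g_above[OF xR y] f_below[OF xR y] slope_gap_inner[OF x, of "y - x"] by simp
  also have "\<dots> \<le> (\<rho> x + L * ?n)\<^sup>2"
  proof -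
    have "2 * K \<le> L\<^sup>2" using K_le L_ge by (simp add: power2_eq_square) (smt (verit) mult_le_cancel_right1)
    then have "2 * K * ?n\<^sup>2 \<le> L\<^sup>2 * ?n\<^sup>2" by (rule mult_right_mono) simp
    moreover have "0 \<le> L * \<rho> x * ?n" using \<rho>_nonneg[OF xR] K_le by simp
    ultimately show ?thesis by (simp add: power2_sum power_mult_distrib mult_ac)
  qed
  finally show ?thesis
    by (rule power2_le_imp_le) (use \<rho>_nonneg[OF xR] K_le in simp)
qed

text \<open>
  At distances at least \<open>\<rho> x\<close> from \<open>x\<close>, the functions \<open>f\<close> and \<open>g\<close>, and with them everything in between,
  have the same second-order expansion up to a quadratic error.
\<close>

lemma between_expansion:
  assumes x: "x \<in> ball x0 e" and y: "y \<in> ball x0 R" and a: "f y \<le> a" "a \<le> g y"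
  shows "\<bar>a - f x - p x \<bullet> (y - x)\<bar> \<le> L * (\<rho> x + norm (y - x))\<^sup>2"
proof -
  have xR: "x \<in> ball x0 R" using small_ball[OF x] .
  let ?n = "norm (y - x)"
  have r0: "0 \<le> \<rho> x" using \<rho>_nonneg[OF xR] .
  have sq: "L * (\<rho> x + ?n)\<^sup>2 = L * (\<rho> x)\<^sup>2 + 2 * (L * \<rho> x * ?n) + L * ?n\<^sup>2"
    by (simp add: power2_sum algebra_simps)
  have i: "(\<rho> x)\<^sup>2 \<le> L * (\<rho> x)\<^sup>2" "K * ?n\<^sup>2 \<le> L * ?n\<^sup>2" "0 \<le> L * \<rho> x * ?n" "0 \<le> L * (\<rho> x)\<^sup>2"
    using L_ge K_le r0 K by (auto simp: mult_le_cancel_right1 intro!: mult_right_mono)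
  have "a - f x - p x \<bullet> (y - x) \<le> L * (\<rho> x + ?n)\<^sup>2"
    using a(2) g_above[OF xR y] slope_gap_inner[OF x, of "y - x"] \<rho>_sq[OF xR] i unfolding sq by linarith
  moreover have "- (L * (\<rho> x + ?n)\<^sup>2) \<le> a - f x - p x \<bullet> (y - x)"
    using a(1) f_below[OF xR y] i unfolding sq by linarith
  ultimately show ?thesis by (simp add: abs_le_iff)
qed

text \<open>
  Both slopes have to be compatible with \<open>f\<close> at the point \<open>y + v\<close>, where \<open>v\<close> points in the direction of
  their difference and has length \<open>s\<close>: there \<open>f\<close> is bounded below by the paraboloid at \<open>y\<close> and above
  by the expansion at \<open>x\<close>.
\<close>

lemma slope_variation:
  assumes x: "x \<in> ball x0 e" and y: "y \<in> ball x0 e"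
  shows "norm (p y - p x) \<le> 6 * L * (\<rho> x + norm (y - x))"
proof (cases "p y = p x")
  case True
  then show ?thesis using \<rho>_nonneg[OF small_ball[OF x]] K_le by simp
next
  case False
  have xR: "x \<in> ball x0 R" and yR: "y \<in> ball x0 R" using small_ball x y by blast+
  let ?w = "p y - p x"
  define s where "s = \<rho> x + norm (y - x)"
  have w: "norm ?w > 0" using False by simp
  have s0: "0 < s" using False \<rho>_nonneg[OF xR] unfolding s_def by (cases "x = y") (auto intro: add_nonneg_pos)
  have "dist y x < e + e"
    using dist_triangle_less_add[of y x0 e x e] x y by (simp add: dist_commute)
  then have sR: "s \<le> 3 * R / 8" unfolding s_def using \<rho>_small[OF x] e by (simp add: dist_norm)
  define v where "v = (s / norm ?w) *\<^sub>R ?w"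
  have nv: "norm v = s" unfolding v_def using w s0 by simp
  have wv: "?w \<bullet> v = s * norm ?w"
  proof -
    have "?w \<bullet> v = s / norm ?w * (?w \<bullet> ?w)" unfolding v_def by simp
    also have "\<dots> = s * norm ?w" using w unfolding dot_square_norm power2_eq_square by simp
    finally show ?thesis .
  qed
  have "dist x0 (y + v) < R"
    using dist_triangle[of x0 "y + v" y] y nv sR e R_pos by (simp add: dist_norm)
  then have z: "y + v \<in> ball x0 R" by simp
  have 1: "f y + p y \<bullet> v - K * s\<^sup>2 \<le> f (y + v)" using f_below[OF yR z] nv by simp
  have 2: "f (y + v) \<le> f x + p x \<bullet> (y + v - x) + L * (2 * s)\<^sup>2"
  proof -
    have "\<rho> x + norm (y + v - x) \<le> 2 * s"
      using norm_triangle_ineq[of "y - x" v] nv unfolding s_def by (simp add: algebra_simps)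
    then have "L * (\<rho> x + norm (y + v - x))\<^sup>2 \<le> L * (2 * s)\<^sup>2"
      using \<rho>_nonneg[OF xR] K_le by (intro mult_left_mono power_mono) auto
    then show ?thesis using between_expansion[OF x z order_refl f_le_g[OF z]] by linarith
  qed
  have 3: "f x + p x \<bullet> (y - x) - L * s\<^sup>2 \<le> f y"
    using between_expansion[OF x yR order_refl f_le_g[OF yR]] unfolding s_def by linarith
  have "p x \<bullet> (y + v - x) = p x \<bullet> (y - x) + p x \<bullet> v" by (simp add: inner_diff_right inner_add_right)
  then have "?w \<bullet> v \<le> K * s\<^sup>2 + 4 * (L * s\<^sup>2) + L * s\<^sup>2"
    using 1 2 3 by (simp add: inner_diff_left power_mult_distrib)
  also have "\<dots> \<le> 6 * L * s\<^sup>2"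
  proof -
    have "K * s\<^sup>2 \<le> L * s\<^sup>2" using K_le K by (intro mult_right_mono) auto
    then show ?thesis by simp
  qed
  finally have "s * norm ?w \<le> s * (6 * L * s)" unfolding wv by (simp add: power2_eq_square mult_ac)
  then show ?thesis using s0 unfolding s_def by simp
qed

text \<open>
  The affine function through the midpoint of the gap at \<open>x\<close>, with the slope of the paraboloid below \<open>f\<close>.
\<close>

definition "mid_affine x y = f x + (\<rho> x)\<^sup>2 / 2 + p x \<bullet> (y - x)"

text \<open>
  Within distance \<open>\<rho> x / (8 * L)\<close> the gap keeps at least 49/64 of its size, while the curvature
  terms and the difference of the slopes cost at most 1/64 and 1/8 of it; half of the gap on either
  side is enough for this.
\<close>

lemma mid_affine_between:
  assumes x: "x \<in> ball x0 e" and y: "y \<in> ball x0 e" and pos: "0 < \<rho> x"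
    and close: "L * norm (y - x) \<le> \<rho> x / 8"
  shows "f y < mid_affine x y" "mid_affine x y < g y"
proof -
  have xR: "x \<in> ball x0 R" and yR: "y \<in> ball x0 R" using small_ball x y by blast+
  let ?n = "norm (y - x)"
  have "\<rho> x \<le> \<rho> y + L * ?n" using \<rho>_lipschitz[OF y xR] by (simp add: norm_minus_commute)
  then have "7 / 8 * \<rho> x \<le> \<rho> y" using close by simp
  then have "(7 / 8 * \<rho> x)\<^sup>2 \<le> (\<rho> y)\<^sup>2" using pos by (intro power_mono) auto
  then have hy: "49 / 64 * (\<rho> x)\<^sup>2 \<le> g y - f y" unfolding \<rho>_sq[OF yR] by (simp add: power2_eq_square)
  have Kn: "K * ?n\<^sup>2 \<le> (\<rho> x)\<^sup>2 / 64"
  proof -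
    have "K \<le> L\<^sup>2" using K_le L_ge K by (simp add: power2_eq_square) (smt (verit) mult_le_cancel_right1)
    then have "K * ?n\<^sup>2 \<le> L\<^sup>2 * ?n\<^sup>2" by (rule mult_right_mono) simp
    also have "\<dots> = (L * ?n)\<^sup>2" by (simp add: power_mult_distrib)
    also have "\<dots> \<le> (\<rho> x / 8)\<^sup>2" using close K_le by (intro power_mono) auto
    finally show ?thesis by (simp add: power_divide)
  qed
  have Lr: "L * \<rho> x * ?n \<le> (\<rho> x)\<^sup>2 / 8"
    using mult_left_mono[OF close, of "\<rho> x"] pos by (simp add: power2_eq_square mult_ac)
  have r2: "0 < (\<rho> x)\<^sup>2" using pos by simp
  show "mid_affine x y < g y" unfolding mid_affine_def using f_below[OF xR yR] hy Kn r2 by linarith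
  show "f y < mid_affine x y" unfolding mid_affine_def
    using g_above[OF xR yR] slope_gap_inner[OF x, of "y - x"] \<rho>_sq[OF xR] hy Kn Lr r2 by linarith
qed

text \<open>
  The Whitney cells: a cell is a pair of a dyadic level \<open>k\<close> and a lattice point, its centre is that
  point scaled by the mesh \<open>s k\<close>, and it is used when the mesh is comparable with \<open>\<rho>\<close> at the centre. The
  factor \<open>a\<close> makes the support of the bump \<open>b i\<close>, a ball of radius \<open>2 * d * s k\<close>, fit into the ball on
  which the affine function of the centre lies between \<open>f\<close> and \<open>g\<close>. The ratio 5 between the two
  bounds on \<open>\<rho>\<close>, rather than 2, leaves room for the variation of \<open>\<rho>\<close> from a point to the centre of a
  cell covering it.
\<close>

definition "a = 16 * L * d"
definition "s k = e / 2 ^ k"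
definition "ctr i = s (fst i) *\<^sub>R snd i"
definition "cells = {i. snd i \<in> (int_lattice :: 'a set) \<and> ctr i \<in> ball x0 e \<and>
  a * s (fst i) \<le> \<rho> (ctr i) \<and> \<rho> (ctr i) \<le> 5 * a * s (fst i)}"
definition "b i y = bump d ((1 / s (fst i)) *\<^sub>R (y - ctr i))"

lemma d_ge: "1 \<le> d" unfolding d using DIM_positive[where 'a='a] by linarith

lemma a_pos: "0 < a" unfolding a_def using K_le d_ge by simp

lemma s_pos: "0 < s k" unfolding s_def using e by simp

lemma b_range: "0 \<le> b i y" "b i y \<le> 1" unfolding b_def by (rule bump_range)+

lemma b_nonzero: assumes "b i y \<noteq> 0" shows "norm (y - ctr i) < 2 * d * s (fst i)"
proof -
  have "norm ((1 / s (fst i)) *\<^sub>R (y - ctr i)) < 2 * d"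
    using bump_eq_0[of d "(1 / s (fst i)) *\<^sub>R (y - ctr i)"] assms d_ge unfolding b_def by force
  moreover have "norm ((1 / s (fst i)) *\<^sub>R (y - ctr i)) = norm (y - ctr i) / s (fst i)"
    using s_pos[of "fst i"] by simp
  ultimately show ?thesis using s_pos[of "fst i"] by (simp add: divide_less_eq)
qed

lemma I_radius: assumes "i \<in> cells" shows "L * (2 * d * s (fst i)) \<le> \<rho> (ctr i) / 8" "0 < \<rho> (ctr i)" "ctr i \<in> ball x0 e"
proof -
  show "L * (2 * d * s (fst i)) \<le> \<rho> (ctr i) / 8" "ctr i \<in> ball x0 e" using assms unfolding cells_def a_def by auto
  have "0 < a * s (fst i)" using a_pos s_pos by simp
  then show "0 < \<rho> (ctr i)" using assms unfolding cells_def by auto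
qed

lemma half_ball: "x \<in> ball x0 (e / 2) \<Longrightarrow> x \<in> ball x0 e" using e by auto

lemma \<rho>_half_ball: assumes "y \<in> ball x0 (e / 2)" shows "\<rho> y \<le> L * e / 2"
proof -
  have "x0 \<in> ball x0 e" using e by simp
  from \<rho>_lipschitz[OF this small_ball[OF half_ball[OF assms]]]
  have "\<rho> y \<le> L * norm (y - x0)" using contact by (simp add: \<rho>_def)
  also have "\<dots> \<le> L * (e / 2)" using assms K_le by (intro mult_left_mono) (auto simp: dist_norm norm_minus_commute)
  finally show ?thesis by simp
qed

text \<open>
  Take the first level whose mesh is small with respect to \<open>\<rho> y\<close> and round \<open>y\<close> to the lattice of that
  level. That the level 0 already has a large enough mesh follows from \<open>\<rho>_half_ball\<close>.
\<close>

lemma covered: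
  assumes y: "y \<in> ball x0 (e / 2)" and pos: "0 < \<rho> y"
  shows "\<exists>i\<in>cells. b i y = 1"
proof -
  have yB: "y \<in> ball x0 e" and yR: "y \<in> ball x0 R" using half_ball small_ball y by blast+
  have "\<exists>k. 2 * a * s k \<le> \<rho> y"
  proof -
    obtain k where "(1 / 2) ^ k < \<rho> y / (2 * a * e)"
      using real_arch_pow_inv[of "\<rho> y / (2 * a * e)" "1 / 2"] pos a_pos e by auto
    then have "2 * a * s k \<le> \<rho> y" unfolding s_def using a_pos e by (simp add: field_simps)
    then show ?thesis ..
  qed
  then obtain k where k: "2 * a * s k \<le> \<rho> y" and least: "\<And>j. j < k \<Longrightarrow> \<not> 2 * a * s j \<le> \<rho> y"
    using exists_least_iff[of "\<lambda>k. 2 * a * s k \<le> \<rho> y"] by blast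
  have up: "\<rho> y \<le> 4 * a * s k"
  proof (cases k)
    case 0
    have "L * e / 2 \<le> 4 * a * e"
    proof -
      have "L * 1 \<le> L * (128 * d)" using K_le d_ge by (intro mult_left_mono) auto
      then have "L * 1 * e \<le> L * (128 * d) * e" using e by (intro mult_right_mono) auto
      then show ?thesis unfolding a_def by simp
    qed
    then show ?thesis using \<rho>_half_ball[OF y] 0 unfolding s_def by simp
  next
    case (Suc j)
    have "s j = 2 * s k" unfolding s_def Suc by simp
    then show ?thesis using least[of j] Suc by simp
  qed
  obtain z where z: "z \<in> int_lattice" "norm ((1 / s k) *\<^sub>R y - z) \<le> d" unfolding d using int_lattice_near .
  define i where "i = (k, z)"
  have ds: "norm (y - ctr i) \<le> d * s k"
  proof -
    have "y - ctr i = s k *\<^sub>R ((1 / s k) *\<^sub>R y - z)"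
      unfolding ctr_def i_def using s_pos[of k] by (simp add: scaleR_diff_right)
    then have "norm (y - ctr i) = s k * norm ((1 / s k) *\<^sub>R y - z)" using s_pos[of k] by simp
    also have "\<dots> \<le> s k * d" using z s_pos[of k] by (intro mult_left_mono) auto
    finally show ?thesis by (simp add: mult.commute)
  qed
  have Lds: "L * (d * s k) = a * s k / 16" unfolding a_def by simp
  have "L * (d * s k) \<le> L * e / 64" unfolding Lds using k \<rho>_half_ball[OF y] by linarith
  then have dse: "d * s k \<le> e / 64" using K_le by simp
  have cB: "ctr i \<in> ball x0 e"
    using dist_triangle[of x0 "ctr i" y] y ds dse e by (simp add: dist_norm)
  have Ln: "L * norm (y - ctr i) \<le> a * s k / 16" using mult_left_mono[OF ds, of L] Lds K_le by simp
  have "\<rho> (ctr i) \<le> \<rho> y + a * s k / 16"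
    using \<rho>_lipschitz[OF yB small_ball[OF cB]] Ln by (simp add: norm_minus_commute)
  moreover have "\<rho> y \<le> \<rho> (ctr i) + a * s k / 16" using \<rho>_lipschitz[OF cB yR] Ln by simp
  moreover have "0 < a * s k" using a_pos s_pos by simp
  ultimately have "i \<in> cells" unfolding cells_def using z cB k up by (auto simp: i_def)
  moreover have "b i y = 1" unfolding b_def
  proof (rule bump_eq_1)
    show "norm ((1 / s (fst i)) *\<^sub>R (y - ctr i)) \<le> d"
    proof -
      have "fst i = k" by (simp add: i_def)
      then have "norm ((1 / s (fst i)) *\<^sub>R (y - ctr i)) = norm (y - ctr i) / s k"
        using s_pos[of k] by simp
      also have "\<dots> \<le> d" using ds s_pos[of k] by (simp add: divide_le_eq)
      finally show ?thesis .
    qed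
  qed (use d_ge in simp)
  ultimately show ?thesis ..
qed

text \<open>
  The cells whose bumps may be nonzero on the patch of \<open>x\<close>.
\<close>

definition "nbrs x = {i \<in> cells. norm (ctr i - x) \<le> 2 * d * s (fst i) + \<rho> x / (8 * L)}"
definition "patch x = ball x (\<rho> x / (8 * L)) \<inter> ball x0 (e / 2)"

lemma patch_bounds:
  assumes x: "x \<in> ball x0 (e / 2)" and y: "y \<in> patch x"
  shows "L * norm (y - x) \<le> \<rho> x / 8" "y \<in> ball x0 (e / 2)" "7 / 8 * \<rho> x \<le> \<rho> y" "norm (y - x) \<le> \<rho> x / (8 * L)"
proof -
  have n: "norm (y - x) \<le> \<rho> x / (8 * L)" using y unfolding patch_def by (simp add: dist_norm norm_minus_commute)
  then show 1: "L * norm (y - x) \<le> \<rho> x / 8" using K_le by (simp add: field_simps)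
  show yB: "y \<in> ball x0 (e / 2)" using y unfolding patch_def by simp
  show "7 / 8 * \<rho> x \<le> \<rho> y"
    using \<rho>_lipschitz[OF half_ball[OF yB] small_ball[OF half_ball[OF x]]] 1 by (simp add: norm_minus_commute)
qed (use y in \<open>simp add: patch_def dist_norm norm_minus_commute\<close>)

lemma nbrs_active:
  assumes "y \<in> patch x" "i \<in> cells" "b i y \<noteq> 0"
  shows "i \<in> nbrs x"
proof -
  have "norm (ctr i - x) \<le> norm (y - ctr i) + norm (y - x)"
    using norm_triangle_ineq[of "ctr i - y" "y - x"] by (simp add: norm_minus_commute)
  also have "\<dots> \<le> 2 * d * s (fst i) + \<rho> x / (8 * L)"
    using b_nonzero[OF assms(3)] assms(1) unfolding patch_def by (intro add_mono) (auto simp: dist_norm norm_minus_commute)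
  finally show ?thesis unfolding nbrs_def using assms(2) by simp
qed

text \<open>
  As \<open>\<rho>\<close> is Lipschitz and the cell meets the patch, all the lengths attached to the cell are
  comparable with \<open>\<rho> x\<close>.
\<close>

lemma nbrs_scale:
  assumes x: "x \<in> ball x0 (e / 2)" and pos: "0 < \<rho> x" and i: "i \<in> nbrs x"
  shows "7 * \<rho> x \<le> 9 * \<rho> (ctr i)" "7 * \<rho> (ctr i) \<le> 9 * \<rho> x" "norm (ctr i - x) \<le> \<rho> x"
    "\<rho> x \<le> 7 * a * s (fst i)" "7 * a * s (fst i) \<le> 9 * \<rho> x" "norm (ctr i - x) \<le> 16 * d * s (fst i)"
proof -
  have iI: "i \<in> cells" and n: "norm (ctr i - x) \<le> 2 * d * s (fst i) + \<rho> x / (8 * L)" using i unfolding nbrs_def by auto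
  have xB: "x \<in> ball x0 e" and xR: "x \<in> ball x0 R" using half_ball small_ball x by blast+
  note r = I_radius[OF iI]
  have Ln: "L * norm (ctr i - x) \<le> \<rho> (ctr i) / 8 + \<rho> x / 8"
  proof -
    have "L * norm (ctr i - x) \<le> L * (2 * d * s (fst i) + \<rho> x / (8 * L))" using n K_le by (intro mult_left_mono) auto
    also have "\<dots> = L * (2 * d * s (fst i)) + \<rho> x / 8" using K_le by (simp add: distrib_left)
    finally show ?thesis using r(1) by simp
  qed
  show 1: "7 * \<rho> x \<le> 9 * \<rho> (ctr i)"
    using \<rho>_lipschitz[OF r(3) xR] Ln by (simp add: norm_minus_commute)
  show 2: "7 * \<rho> (ctr i) \<le> 9 * \<rho> x" using \<rho>_lipschitz[OF xB small_ball[OF r(3)]] Ln by simp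
  have "3 * norm (ctr i - x) \<le> L * norm (ctr i - x)" using L_ge by (rule mult_right_mono) simp
  then show "norm (ctr i - x) \<le> \<rho> x" using Ln 2 pos by simp
  have I5: "\<rho> (ctr i) \<le> 5 * a * s (fst i)" "a * s (fst i) \<le> \<rho> (ctr i)" using iI unfolding cells_def by auto
  have as: "0 < a * s (fst i)" using a_pos s_pos by simp
  then show 3: "\<rho> x \<le> 7 * a * s (fst i)" using I5 1 by simp
  show "7 * a * s (fst i) \<le> 9 * \<rho> x" using I5 2 by simp
  have "\<rho> x / (8 * L) \<le> 7 * a * s (fst i) / (8 * L)" using 3 K_le by (intro divide_right_mono) auto
  also have "\<dots> = 14 * d * s (fst i)" unfolding a_def using K_le by simp
  finally show "norm (ctr i - x) \<le> 16 * d * s (fst i)" using n by simp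
qed

text \<open>
  At most four dyadic levels are comparable with \<open>\<rho> x\<close>, and on each level the number of centres near
  \<open>x\<close> is a number of lattice points in a ball of fixed radius.
\<close>

lemma nbrs_card:
  obtains N where "\<And>x. x \<in> ball x0 (e / 2) \<Longrightarrow> 0 < \<rho> x \<Longrightarrow> finite (nbrs x) \<and> card (nbrs x) \<le> N"
proof -
  obtain N where N: "\<And>y::'a. finite (int_lattice \<inter> cball y (16 * d)) \<and> card (int_lattice \<inter> cball y (16 * d)) \<le> N"
    by (rule card_int_lattice_cball) (rule that)
  have "finite (nbrs x) \<and> card (nbrs x) \<le> 4 * N" if x: "x \<in> ball x0 (e / 2)" and pos: "0 < \<rho> x" for x
  proof (cases "nbrs x = {}")
    case False
    define k0 where "k0 = (LEAST k. k \<in> fst ` nbrs x)"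
    have k0: "k0 \<in> fst ` nbrs x" unfolding k0_def using False by (auto intro: LeastI)
    have k0_le: "k0 \<le> k" if "k \<in> fst ` nbrs x" for k unfolding k0_def using that by (rule Least_le)
    let ?A = "\<lambda>k. int_lattice \<inter> cball ((1 / s k) *\<^sub>R x) (16 * d)"
    have sub: "nbrs x \<subseteq> Sigma {k0..<k0 + 4} ?A"
    proof
      fix i assume i: "i \<in> nbrs x"
      have z: "snd i \<in> int_lattice" using i unfolding nbrs_def cells_def by auto
      let ?s = "s (fst i)"
      have "(1 / ?s) *\<^sub>R x - snd i = (1 / ?s) *\<^sub>R (x - ctr i)"
        unfolding ctr_def using s_pos[of "fst i"] by (simp add: scaleR_diff_right)
      then have "norm ((1 / ?s) *\<^sub>R x - snd i) = norm (ctr i - x) / ?s"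
        using s_pos[of "fst i"] by (simp add: norm_minus_commute)
      also have "\<dots> \<le> 16 * d" using nbrs_scale(6)[OF x pos i] s_pos[of "fst i"] by (simp add: field_simps)
      finally have A: "snd i \<in> ?A (fst i)" using z by (simp add: dist_norm)
      have "fst i < k0 + 4"
      proof (rule ccontr)
        assume "\<not> fst i < k0 + 4"
        then have "(2::real) ^ (k0 + 4) \<le> 2 ^ fst i" by (intro power_increasing) auto
        then have "e / 2 ^ fst i \<le> e / 2 ^ (k0 + 4)" using e by (intro divide_left_mono) auto
        then have "16 * s (fst i) \<le> s k0" unfolding s_def by (simp add: power_add)
        then have "16 * (7 * a * s (fst i)) \<le> 7 * a * s k0" using a_pos by simp
        moreover have "7 * a * s k0 \<le> 9 * \<rho> x" using k0 nbrs_scale(5)[OF x pos] by auto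
        ultimately show False using nbrs_scale(4)[OF x pos i] pos by linarith
      qed
      moreover have "k0 \<le> fst i" using k0_le i by blast
      ultimately show "i \<in> Sigma {k0..<k0 + 4} ?A" using A \<open>fst i < k0 + 4\<close>
        using mem_Sigma_iff[of "fst i" "snd i" "{k0..<k0 + 4}" ?A] unfolding prod.collapse by simp
    qed
    have fin: "finite (Sigma {k0..<k0 + 4} ?A)" using N by (intro finite_SigmaI) auto
    have "card (Sigma {k0..<k0 + 4} ?A) = (\<Sum>k\<in>{k0..<k0 + 4}. card (?A k))" using N by (intro card_SigmaI) auto
    also have "\<dots> \<le> of_nat (card {k0..<k0 + 4}) * N" using N by (intro sum_bounded_above) auto
    finally have "card (Sigma {k0..<k0 + 4} ?A) \<le> 4 * N" by simp
    then show ?thesis using finite_subset[OF sub fin] card_mono[OF fin sub] by linarith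
  qed auto
  then show thesis using that by blast
qed

text \<open>
  The values of the affine functions averaged with the bumps as weights. On the contact set all
  requirements leave no choice.
\<close>

definition "blend y = (if \<rho> y = 0 then f y else
  (\<Sum>i\<in>{i\<in>cells. b i y \<noteq> 0}. b i y * mid_affine (ctr i) y) / (\<Sum>i\<in>{i\<in>cells. b i y \<noteq> 0}. b i y))"

lemma finite_nbrs: "x \<in> ball x0 (e / 2) \<Longrightarrow> 0 < \<rho> x \<Longrightarrow> finite (nbrs x)"
  using nbrs_card by metis

lemma self_in_patch: "x \<in> ball x0 (e / 2) \<Longrightarrow> 0 < \<rho> x \<Longrightarrow> x \<in> patch x"
  unfolding patch_def using K_le by simp

lemma active_sums:
  assumes x: "x \<in> ball x0 (e / 2)" and pos: "0 < \<rho> x" and y: "y \<in> patch x"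
  shows "(\<Sum>i\<in>{i\<in>cells. b i y \<noteq> 0}. b i y * F i) = (\<Sum>i\<in>nbrs x. b i y * F i)"
    "(\<Sum>i\<in>{i\<in>cells. b i y \<noteq> 0}. b i y) = (\<Sum>i\<in>nbrs x. b i y)"
    "1 \<le> (\<Sum>i\<in>nbrs x. b i y)"
proof -
  have sub: "{i\<in>cells. b i y \<noteq> 0} \<subseteq> nbrs x" using nbrs_active[OF y] by blast
  have fin: "finite (nbrs x)" using finite_nbrs[OF x pos] .
  have rest: "\<forall>i\<in>nbrs x - {i\<in>cells. b i y \<noteq> 0}. b i y = 0" unfolding nbrs_def by auto
  show "(\<Sum>i\<in>{i\<in>cells. b i y \<noteq> 0}. b i y) = (\<Sum>i\<in>nbrs x. b i y)"
    by (rule sum.mono_neutral_left[OF fin sub rest])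
  show "(\<Sum>i\<in>{i\<in>cells. b i y \<noteq> 0}. b i y * F i) = (\<Sum>i\<in>nbrs x. b i y * F i)"
  proof (rule sum.mono_neutral_left[OF fin sub], rule ballI)
    fix i assume "i \<in> nbrs x - {i\<in>cells. b i y \<noteq> 0}"
    with rest have "b i y = 0" by blast
    then show "b i y * F i = 0" by simp
  qed
  have yB: "y \<in> ball x0 (e / 2)" and "0 < \<rho> y" using patch_bounds[OF x y] pos by auto
  then obtain i where i: "i \<in> cells" "b i y = 1" using covered by blast
  then have "i \<in> nbrs x" using nbrs_active[OF y] by simp
  then have "b i y \<le> (\<Sum>i\<in>nbrs x. b i y)" using fin b_range by (intro member_le_sum) auto
  then show "1 \<le> (\<Sum>i\<in>nbrs x. b i y)" using i by simp
qed

lemma blend_near: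
  assumes x: "x \<in> ball x0 (e / 2)" and pos: "0 < \<rho> x" and y: "y \<in> patch x"
  shows "blend y = (\<Sum>i\<in>nbrs x. b i y * mid_affine (ctr i) y) / (\<Sum>i\<in>nbrs x. b i y)"
proof -
  have "\<rho> y \<noteq> 0" using patch_bounds(3)[OF x y] pos by simp
  then show ?thesis unfolding blend_def active_sums(1)[OF x pos y, of "\<lambda>i. mid_affine (ctr i) y"] active_sums(2)[OF x pos y] by simp
qed

text \<open>
  Every affine function entering the average at \<open>y\<close> lies strictly between \<open>f y\<close> and \<open>g y\<close>.
\<close>

lemma blend_between:
  assumes y: "y \<in> ball x0 (e / 2)"
  shows "f y \<le> blend y" "blend y \<le> g y" "f y < g y \<Longrightarrow> f y < blend y" "f y < g y \<Longrightarrow> blend y < g y"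
proof -
  have yR: "y \<in> ball x0 R" using half_ball small_ball y by blast
  have strict: "f y < blend y \<and> blend y < g y" if lt: "f y < g y"
  proof -
    have pos: "0 < \<rho> y" unfolding \<rho>_def using lt by simp
    have yU: "y \<in> patch y" using self_in_patch[OF y pos] .
    let ?J = "{i\<in>cells. b i y \<noteq> 0}"
    have S: "1 \<le> sum (\<lambda>i. b i y) ?J" using active_sums(2,3)[OF y pos yU] by simp
    have "?J \<subseteq> nbrs y" by (rule subsetI, rule nbrs_active[OF yU]) simp_all
    then have fin: "finite ?J" by (rule finite_subset[OF _ finite_nbrs[OF y pos]])
    have ne: "?J \<noteq> {}"
    proof
      assume "?J = {}"
      then show False using S by (simp only: sum.empty)
    qed
    have mid_affine: "f y < mid_affine (ctr i) y" "mid_affine (ctr i) y < g y" if i: "i \<in> ?J" for i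
    proof -
      have "L * norm (y - ctr i) \<le> L * (2 * d * s (fst i))"
        using b_nonzero[of i y] i K_le by (intro mult_left_mono) auto
      then have "L * norm (y - ctr i) \<le> \<rho> (ctr i) / 8" using I_radius(1)[of i] i by simp
      then show "f y < mid_affine (ctr i) y" "mid_affine (ctr i) y < g y"
        using mid_affine_between[OF I_radius(3) half_ball[OF y] I_radius(2)] i by auto
    qed
    have bp: "0 < b i y" if "i \<in> ?J" for i using b_range(1)[of i y] that by simp
    have "(\<Sum>i\<in>?J. b i y * f y) < (\<Sum>i\<in>?J. b i y * mid_affine (ctr i) y)"
      using mid_affine bp by (intro sum_strict_mono[OF fin ne]) auto
    moreover have "(\<Sum>i\<in>?J. b i y * mid_affine (ctr i) y) < (\<Sum>i\<in>?J. b i y * g y)"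
      using mid_affine bp by (intro sum_strict_mono[OF fin ne]) auto
    ultimately have "f y * sum (\<lambda>i. b i y) ?J < (\<Sum>i\<in>?J. b i y * mid_affine (ctr i) y)"
      "(\<Sum>i\<in>?J. b i y * mid_affine (ctr i) y) < g y * sum (\<lambda>i. b i y) ?J"
      by (simp_all only: sum_distrib_right[symmetric] mult.commute[of _ "f y"] mult.commute[of _ "g y"]
          sum_distrib_left)
    then show ?thesis unfolding blend_def using pos S by (simp add: field_simps)
  qed
  have eq: "blend y = f y" if "f y = g y" unfolding blend_def \<rho>_def using that by simp
  show "f y \<le> blend y" "blend y \<le> g y" using strict eq f_le_g[OF yR] by (cases "f y = g y"; force)+
  show "f y < g y \<Longrightarrow> f y < blend y" "f y < g y \<Longrightarrow> blend y < g y" using strict by auto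
qed

lemma smooth_at_b: "smooth_at (b i) y"
proof -
  have "smooth_at (\<lambda>y. (1 / s (fst i)) *\<^sub>R y + (- (1 / s (fst i)) *\<^sub>R ctr i)) y"
    by (intro smooth_at_add smooth_at_const smooth_at_bounded_linear bounded_linear_scaleR_right)
  from smooth_at_compose[OF smooth_at_bump this, of d]
  show ?thesis unfolding b_def by (simp add: scaleR_diff_right)
qed

lemma smooth_at_mid_affine: "smooth_at (mid_affine x) y"
proof -
  have "smooth_at (\<lambda>y. p x \<bullet> y + (f x + (\<rho> x)\<^sup>2 / 2 - p x \<bullet> x)) y"
    by (intro smooth_at_add smooth_at_const smooth_at_bounded_linear bounded_linear_inner_right)
  then show ?thesis unfolding mid_affine_def by (simp add: inner_diff_right algebra_simps)
qed

lemma smooth_at_blend: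
  assumes x: "x \<in> ball x0 (e / 2)" and lt: "f x < g x"
  shows "smooth_at blend x"
proof -
  have pos: "0 < \<rho> x" unfolding \<rho>_def using lt by simp
  have S: "0 < (\<Sum>i\<in>nbrs x. b i x)" using active_sums(3)[OF x pos self_in_patch[OF x pos]] by simp
  have "smooth_at (\<lambda>y. (\<Sum>i\<in>nbrs x. b i y * mid_affine (ctr i) y) / (\<Sum>i\<in>nbrs x. b i y)) x"
    by (intro smooth_at_divide smooth_at_sum smooth_at_mult smooth_at_b smooth_at_mid_affine S)
  then show ?thesis
    by (rule smooth_at_cong[of _ _ "patch x"]) (use self_in_patch[OF x pos] blend_near[OF x pos] in \<open>auto simp: patch_def\<close>)
qed

text \<open>
  Near \<open>x\<close>, within the scale \<open>\<rho> x\<close>, the blend differs from the affine function of \<open>x\<close> by \<open>(\<rho> x)\<^sup>2\<close> times a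
  quotient of sums of functions with scale-invariant expansions, so the factors of \<open>\<rho> x\<close> cancel in the
  second-order term. Beyond that scale, or on the contact set, \<open>between_expansion\<close> suffices. The
  constant does not depend on \<open>x\<close>, which is what gives regularity across the contact set.
\<close>

lemma blend_expansion:
  obtains C where "0 \<le> C" "\<And>x. x \<in> ball x0 (e / 2) \<Longrightarrow> touched_both blend (ball x0 (e / 2)) C x"
proof -
  obtain N where N: "\<And>x. x \<in> ball x0 (e / 2) \<Longrightarrow> 0 < \<rho> x \<Longrightarrow> finite (nbrs x) \<and> card (nbrs x) \<le> N"
    using nbrs_card by blast
  have d0: "0 < d" using d_ge by simp
  obtain B where B: "1 \<le> B" "\<forall>(x::'a) c s r \<kappa> U. 0 < s \<longrightarrow> 0 < r \<longrightarrow> 1 \<le> \<kappa> \<longrightarrow> r \<le> \<kappa> * s \<longrightarrow> x \<in> U \<longrightarrow>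
      (\<forall>y\<in>U. norm (y - c) \<le> 30 * d * s) \<longrightarrow>
      taylor_bound x r U (B * \<kappa>\<^sup>2) (\<lambda>y. bump d ((1 / s) *\<^sub>R (y - c)))"
    using bump_taylor_bound[OF d0] by blast
  define C1 where "C1 = B * (7 * a)\<^sup>2"
  have "1 * 1 \<le> L * d" using L_ge d_ge by (intro mult_mono) auto
  then have a1: "1 \<le> 7 * a" unfolding a_def by simp
  have C1: "1 \<le> C1"
    unfolding C1_def using mult_mono[OF B(1) one_le_power[OF a1, of 2]] B(1) by simp
  define C2 where "C2 = real N * (6 * (C1 * (14 * L)))"
  define C3 where "C3 = 3 * (real N * C1)\<^sup>2"
  define C where "C = 6 * (C2 * C3)"
  have C0: "0 \<le> C" unfolding C_def C2_def C3_def using C1 K_le by simp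
  have near: "\<exists>m. norm m \<le> C * \<rho> x \<and>
    (\<forall>y\<in>patch x. \<bar>blend y - blend x - (p x + m) \<bullet> (y - x)\<bar> \<le> C * (norm (y - x))\<^sup>2)"
    if x: "x \<in> ball x0 (e / 2)" and pos: "0 < \<rho> x" for x
  proof -
    let ?r = "\<rho> x"
    have xB: "x \<in> ball x0 e" and xR: "x \<in> ball x0 R" using half_ball small_ball x by blast+
    have xU: "x \<in> patch x" using self_in_patch[OF x pos] .
    have Ur: "patch x \<subseteq> cball x ?r"
    proof
      fix y assume "y \<in> patch x"
      from patch_bounds(1)[OF x this] have "3 * norm (y - x) \<le> ?r / 8"
        using mult_right_mono[OF L_ge, of "norm (y - x)"] by simp
      then show "y \<in> cball x ?r" using pos by (simp add: dist_norm norm_minus_commute)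
    qed
    note N = N[OF x pos]
    have Tb: "taylor_bound x ?r (patch x) C1 (b i)" if i: "i \<in> nbrs x" for i
      unfolding C1_def b_def
    proof (rule B(2)[rule_format])
      show "?r \<le> 7 * a * s (fst i)" using nbrs_scale(4)[OF x pos i] .
      fix y assume y: "y \<in> patch x"
      have "norm (y - ctr i) \<le> norm (y - x) + norm (ctr i - x)"
        using norm_triangle_ineq[of "y - x" "x - ctr i"] by (simp add: norm_minus_commute)
      also have "norm (y - x) \<le> 14 * d * s (fst i)"
      proof -
        have "norm (y - x) \<le> ?r / (8 * L)" using patch_bounds(4)[OF x y] .
        also have "\<dots> \<le> 7 * a * s (fst i) / (8 * L)"
          using nbrs_scale(4)[OF x pos i] K_le by (intro divide_right_mono) auto
        also have "\<dots> = 14 * d * s (fst i)" unfolding a_def using K_le by simp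
        finally show ?thesis .
      qed
      also have "norm (ctr i - x) \<le> 16 * d * s (fst i)" using nbrs_scale(6)[OF x pos i] .
      finally show "norm (y - ctr i) \<le> 30 * d * s (fst i)" by simp
    qed (use s_pos pos a1 xU in auto)
    (* Neighbouring affine functions differ by a multiple of the squared scale; dividing by it
       leaves expansions with uniform bounds. *)
    let ?Q = "\<lambda>i y. (mid_affine (ctr i) y - mid_affine x y) / ?r\<^sup>2"
    have TQ: "taylor_bound x ?r (patch x) (14 * L) (?Q i)" if i: "i \<in> nbrs x" for i
      unfolding taylor_bound_def
    proof (intro conjI exI[of _ "(1 / ?r\<^sup>2) *\<^sub>R (p (ctr i) - p x)"] ballI)
      have cB: "ctr i \<in> ball x0 e" using I_radius(3) i unfolding nbrs_def by blast
      have cR: "ctr i \<in> ball x0 R" using small_ball[OF cB] .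
      have sum: "\<rho> (ctr i) + norm (ctr i - x) \<le> 16 / 7 * ?r" using nbrs_scale(2,3)[OF x pos i] by simp
      have rc: "0 \<le> \<rho> (ctr i)" using \<rho>_nonneg[OF cR] .
      have "\<bar>f x - f (ctr i) - p (ctr i) \<bullet> (x - ctr i)\<bar> \<le> L * (\<rho> (ctr i) + norm (ctr i - x))\<^sup>2"
        using between_expansion[OF cB xR order_refl f_le_g[OF xR]] by (simp add: norm_minus_commute)
      also have "\<dots> \<le> L * (16 / 7 * ?r)\<^sup>2" using sum rc K_le by (intro mult_left_mono power_mono) auto
      also have "\<dots> = (256 / 49) * (L * ?r\<^sup>2)" by (simp add: power_mult_distrib power_divide)
      finally have 1: "\<bar>f x - f (ctr i) - p (ctr i) \<bullet> (x - ctr i)\<bar> \<le> (256 / 49) * (L * ?r\<^sup>2)" .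
      have "(\<rho> (ctr i))\<^sup>2 \<le> (9 / 7 * ?r)\<^sup>2" using nbrs_scale(2)[OF x pos i] rc by (intro power_mono) auto
      then have 2: "(\<rho> (ctr i))\<^sup>2 \<le> 81 / 49 * ?r\<^sup>2" by (simp add: power_mult_distrib power_divide)
      have 3: "3 * ?r\<^sup>2 \<le> L * ?r\<^sup>2" using L_ge by (rule mult_right_mono) simp
      have "mid_affine (ctr i) x - mid_affine x x = - (f x - f (ctr i) - p (ctr i) \<bullet> (x - ctr i)) + (\<rho> (ctr i))\<^sup>2 / 2 - ?r\<^sup>2 / 2"
        unfolding mid_affine_def by simp
      then have "\<bar>mid_affine (ctr i) x - mid_affine x x\<bar> \<le> 14 * (L * ?r\<^sup>2)"
        using 1 2 3 zero_le_power2[of ?r] zero_le_power2[of "\<rho> (ctr i)"] by linarith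
      then show "\<bar>?Q i x\<bar> \<le> 14 * L" using pos by (simp add: divide_le_eq)
      have "norm (p (ctr i) - p x) = norm (p x - p (ctr i))" by (rule norm_minus_commute)
      also have "\<dots> \<le> 6 * L * (\<rho> (ctr i) + norm (x - ctr i))" by (rule slope_variation[OF cB xB])
      also have "\<dots> \<le> 6 * L * (16 / 7 * ?r)" using sum K_le by (intro mult_left_mono) (auto simp: norm_minus_commute)
      also have "\<dots> \<le> 14 * L * ?r" using K_le pos by simp
      finally have "norm (p (ctr i) - p x) / ?r\<^sup>2 \<le> 14 * L * ?r / ?r\<^sup>2"
        by (rule divide_right_mono) simp
      then show "norm ((1 / ?r\<^sup>2) *\<^sub>R (p (ctr i) - p x)) \<le> 14 * L / ?r"
        using pos by (simp add: power2_eq_square)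
      fix y
      have "(mid_affine (ctr i) y - mid_affine x y) - (mid_affine (ctr i) x - mid_affine x x) = (p (ctr i) - p x) \<bullet> (y - x)"
        unfolding mid_affine_def by (simp add: inner_diff_left inner_diff_right)
      then have "?Q i y - ?Q i x = ((1 / ?r\<^sup>2) *\<^sub>R (p (ctr i) - p x)) \<bullet> (y - x)"
        unfolding diff_divide_distrib[symmetric] inner_scaleR_left by simp
      then show "\<bar>?Q i y - ?Q i x - ((1 / ?r\<^sup>2) *\<^sub>R (p (ctr i) - p x)) \<bullet> (y - x)\<bar> \<le> 14 * L * (norm (y - x) / ?r)\<^sup>2"
        using K_le by simp
    qed
    have card_le: "real (card (nbrs x)) \<le> real N" using N by simp
    have "taylor_bound x ?r (patch x) (real (card (nbrs x)) * (6 * (C1 * (14 * L)))) (\<lambda>y. \<Sum>i\<in>nbrs x. b i y * ?Q i y)"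
      using N by (intro taylor_bound_sum taylor_bound_mult Tb TQ pos Ur) auto
    then have T: "taylor_bound x ?r (patch x) C2 (\<lambda>y. \<Sum>i\<in>nbrs x. b i y * ?Q i y)"
      unfolding C2_def by (rule taylor_bound_mono) (use card_le C1 K_le pos in \<open>auto intro!: mult_right_mono\<close>)
    have "taylor_bound x ?r (patch x) (real (card (nbrs x)) * C1) (\<lambda>y. \<Sum>i\<in>nbrs x. b i y)"
      using N by (intro taylor_bound_sum Tb) auto
    then have "taylor_bound x ?r (patch x) (real N * C1) (\<lambda>y. \<Sum>i\<in>nbrs x. b i y)"
      by (rule taylor_bound_mono) (use card_le C1 pos in \<open>auto intro!: mult_right_mono\<close>)
    then have "taylor_bound x ?r (patch x) C3 (\<lambda>y. 1 / (\<Sum>i\<in>nbrs x. b i y))"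
      unfolding C3_def by (rule taylor_bound_inverse[OF _ pos Ur xU active_sums(3)[OF x pos]])
    from taylor_bound_mult[OF T this pos Ur]
    have TT: "taylor_bound x ?r (patch x) C (\<lambda>y. (\<Sum>i\<in>nbrs x. b i y * ?Q i y) * (1 / (\<Sum>i\<in>nbrs x. b i y)))"
      unfolding C_def .
    let ?T = "\<lambda>y. (\<Sum>i\<in>nbrs x. b i y * ?Q i y) * (1 / (\<Sum>i\<in>nbrs x. b i y))"
    obtain m where m: "norm m \<le> C / ?r"
      "\<And>y. y \<in> patch x \<Longrightarrow> \<bar>?T y - ?T x - m \<bullet> (y - x)\<bar> \<le> C * (norm (y - x) / ?r)\<^sup>2"
      using TT unfolding taylor_bound_def by blast
    have wT: "blend y = mid_affine x y + ?r\<^sup>2 * ?T y" if y: "y \<in> patch x" for y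
    proof -
      let ?S = "\<Sum>i\<in>nbrs x. b i y"
      have S: "?S \<noteq> 0" using active_sums(3)[OF x pos y] by simp
      have "?r\<^sup>2 * (\<Sum>i\<in>nbrs x. b i y * ?Q i y) = (\<Sum>i\<in>nbrs x. b i y * (mid_affine (ctr i) y - mid_affine x y))"
        unfolding sum_distrib_left using pos by (intro sum.cong) auto
      also have "\<dots> = (\<Sum>i\<in>nbrs x. b i y * mid_affine (ctr i) y) - mid_affine x y * ?S"
        by (simp add: right_diff_distrib sum_subtractf sum_distrib_left mult.commute)
      finally have "?r\<^sup>2 * ?T y = (\<Sum>i\<in>nbrs x. b i y * mid_affine (ctr i) y) / ?S - mid_affine x y"
        using S by (simp add: field_simps)
      then show ?thesis unfolding blend_near[OF x pos y] by simp
    qed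
    show ?thesis
    proof (intro exI[of _ "?r\<^sup>2 *\<^sub>R m"] conjI ballI)
      have "?r\<^sup>2 * norm m \<le> ?r\<^sup>2 * (C / ?r)" using m(1) by (rule mult_left_mono) simp
      then show "norm (?r\<^sup>2 *\<^sub>R m) \<le> C * ?r" using pos by (simp add: power2_eq_square mult_ac)
      fix y assume y: "y \<in> patch x"
      have "blend y - blend x - (p x + ?r\<^sup>2 *\<^sub>R m) \<bullet> (y - x) = ?r\<^sup>2 * (?T y - ?T x - m \<bullet> (y - x))"
        unfolding wT[OF y] wT[OF xU] mid_affine_def by (simp add: inner_add_left algebra_simps del: times_divide_eq_right)
      then have "\<bar>blend y - blend x - (p x + ?r\<^sup>2 *\<^sub>R m) \<bullet> (y - x)\<bar> = ?r\<^sup>2 * \<bar>?T y - ?T x - m \<bullet> (y - x)\<bar>"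
        by (simp add: abs_mult)
      also have "\<dots> \<le> ?r\<^sup>2 * (C * (norm (y - x) / ?r)\<^sup>2)" using m(2)[OF y] by (rule mult_left_mono) simp
      also have "\<dots> = C * (norm (y - x))\<^sup>2" using pos by (simp add: power_divide)
      finally show "\<bar>blend y - blend x - (p x + ?r\<^sup>2 *\<^sub>R m) \<bullet> (y - x)\<bar> \<le> C * (norm (y - x))\<^sup>2" .
    qed
  qed
  define E where "E = L * (8 * L + 1)\<^sup>2 + 64 * L\<^sup>2 + 8 * L * C"
  have E0: "0 \<le> E" unfolding E_def using K_le C0 by simp
  define M where "M = K + C * R + C + E"
  have M: "0 \<le> M" "C \<le> M" "E \<le> M" unfolding M_def using C0 E0 K R_pos by auto
  have "touched_both blend (ball x0 (e / 2)) M x"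
    if x: "x \<in> ball x0 (e / 2)" for x
  proof -
    have xB: "x \<in> ball x0 e" and xR: "x \<in> ball x0 R" using half_ball small_ball x by blast+
    have r0: "0 \<le> \<rho> x" using \<rho>_nonneg[OF xR] .
    have "\<exists>m. norm m \<le> C * \<rho> x \<and>
      (\<forall>y\<in>patch x. \<bar>blend y - blend x - (p x + m) \<bullet> (y - x)\<bar> \<le> C * (norm (y - x))\<^sup>2)"
    proof (cases "\<rho> x = 0")
      case True
      then show ?thesis unfolding patch_def by (intro exI[of _ 0]) simp
    next
      case False
      then show ?thesis using near[OF x] r0 by simp
    qed
    then obtain m where m: "norm m \<le> C * \<rho> x"
      "\<And>y. y \<in> patch x \<Longrightarrow> \<bar>blend y - blend x - (p x + m) \<bullet> (y - x)\<bar> \<le> C * (norm (y - x))\<^sup>2" by blast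
    show ?thesis
    proof (intro exI[of _ "p x + m"] conjI ballI)
      have "C * \<rho> x \<le> C * R" using \<rho>_small[OF xB] R_pos C0 by (intro mult_left_mono) auto
      then show "norm (p x + m) \<le> M"
        using norm_triangle_ineq[of "p x" m] p_bound[OF xR] m(1) C0 E0 unfolding M_def by linarith
      fix y assume y: "y \<in> ball x0 (e / 2)"
      have yR: "y \<in> ball x0 R" using half_ball small_ball y by blast
      let ?n = "norm (y - x)"
      show "\<bar>blend y - blend x - (p x + m) \<bullet> (y - x)\<bar> \<le> M * ?n\<^sup>2"
      proof (cases "y \<in> patch x")
        case True
        have "C * ?n\<^sup>2 \<le> M * ?n\<^sup>2" using M by (intro mult_right_mono) auto
        then show ?thesis using m(2)[OF True] by linarith
      next
        case False
        then have "\<rho> x / (8 * L) \<le> ?n" using y unfolding patch_def by (simp add: dist_norm norm_minus_commute)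
        (* Outside the patch the scale itself is controlled by the distance. *)
        then have far: "\<rho> x \<le> 8 * L * ?n" using K_le by (simp add: field_simps)
        have 1: "\<bar>blend y - f x - p x \<bullet> (y - x)\<bar> \<le> L * (8 * L + 1)\<^sup>2 * ?n\<^sup>2"
        proof -
          have "(\<rho> x + ?n)\<^sup>2 \<le> ((8 * L + 1) * ?n)\<^sup>2" using far r0 by (intro power_mono) (auto simp: distrib_right)
          then have "L * (\<rho> x + ?n)\<^sup>2 \<le> L * ((8 * L + 1)\<^sup>2 * ?n\<^sup>2)"
            using K_le unfolding power_mult_distrib by (intro mult_left_mono) auto
          then show ?thesis using between_expansion[OF xB yR blend_between(1,2)[OF y]] by simp
        qed
        have 2: "\<bar>blend x - f x\<bar> \<le> 64 * L\<^sup>2 * ?n\<^sup>2"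
        proof -
          have "(\<rho> x)\<^sup>2 \<le> (8 * L * ?n)\<^sup>2" using far r0 by (rule power_mono)
          then show ?thesis using blend_between(1,2)[OF x] \<rho>_sq[OF xR] by (simp add: power_mult_distrib)
        qed
        have 3: "\<bar>m \<bullet> (y - x)\<bar> \<le> 8 * L * C * ?n\<^sup>2"
        proof -
          have "\<bar>m \<bullet> (y - x)\<bar> \<le> norm m * ?n" by (rule Cauchy_Schwarz_ineq2)
          also have "\<dots> \<le> C * (8 * L * ?n) * ?n"
            using m(1) mult_left_mono[OF far C0] by (intro mult_right_mono) auto
          finally show ?thesis by (simp add: power2_eq_square mult_ac)
        qed
        have "\<bar>blend y - blend x - (p x + m) \<bullet> (y - x)\<bar> \<le> E * ?n\<^sup>2"
          using 1 2 3 unfolding E_def inner_add_left distrib_right by linarith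
        also have "\<dots> \<le> M * ?n\<^sup>2" using M by (intro mult_right_mono) auto
        finally show ?thesis .
      qed
    qed
  qed
  then show thesis using that M(1) by blast
qed

end

lemma semiconcave_at_from_expansion:
  assumes "0 < r" "y \<in> ball x0 r" "\<And>x. x \<in> ball x0 r \<Longrightarrow> touched_both w (ball x0 r) C x"
  shows "semiconcave_at w y" "semiconcave_at (\<lambda>x. - w x) y"
proof -
  obtain e where e: "0 < e" "ball y e \<subseteq> ball x0 r" using assms(2) open_ball open_contains_ball by metis
  have up: "\<exists>m. norm m \<le> C \<and> (\<forall>z\<in>ball y e. w z \<le> w x + m \<bullet> (z - x) + C * (norm (z - x))\<^sup>2)"
    and low: "\<exists>m. norm m \<le> C \<and> (\<forall>z\<in>ball y e. - w z \<le> - w x + m \<bullet> (z - x) + C * (norm (z - x))\<^sup>2)"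
    if "x \<in> ball y e" for x
  proof -
    obtain m where m: "norm m \<le> C" "\<And>z. z \<in> ball x0 r \<Longrightarrow> \<bar>w z - w x - m \<bullet> (z - x)\<bar> \<le> C * (norm (z - x))\<^sup>2"
      using assms(3)[of x] e(2) \<open>x \<in> ball y e\<close> by blast
    have *: "\<bar>w z - w x - m \<bullet> (z - x)\<bar> \<le> C * (norm (z - x))\<^sup>2" if "z \<in> ball y e" for z
      using m(2) that e(2) by blast
    show "\<exists>m. norm m \<le> C \<and> (\<forall>z\<in>ball y e. w z \<le> w x + m \<bullet> (z - x) + C * (norm (z - x))\<^sup>2)"
      using m(1) * by (intro exI[of _ m]) (force simp: abs_le_iff)
    show "\<exists>m. norm m \<le> C \<and> (\<forall>z\<in>ball y e. - w z \<le> - w x + m \<bullet> (z - x) + C * (norm (z - x))\<^sup>2)"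
      using m(1) * by (intro exI[of _ "- m"]) (force simp: abs_le_iff)
  qed
  show "semiconcave_at w y" unfolding semiconcave_at_def using e(1) up by blast
  show "semiconcave_at (\<lambda>x. - w x) y" unfolding semiconcave_at_def using e(1) low by blast
qed

lemma isCont_tendsto_nhds: "isCont F x \<Longrightarrow> (F \<longlongrightarrow> F x) (nhds x)"
  unfolding isCont_def tendsto_at_iff_tendsto_nhds .

text \<open>
  At a point with a gap a constant function works, by continuity. At a contact point the blend of
  the locale \<open>squeezed_pair\<close> is used.
\<close>

theorem local_insertion:
  fixes f g :: "'a::euclidean_space \<Rightarrow> real"
  assumes "semiconcave_at (\<lambda>x. - f x) x0" "semiconcave_at g x0"
    and "open V" "x0 \<in> V" "\<And>x. x \<in> V \<Longrightarrow> f x \<le> g x"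
  obtains r w where "0 < r" "ball x0 r \<subseteq> V"
    "\<And>y. y \<in> ball x0 r \<Longrightarrow> f y \<le> w y \<and> w y \<le> g y \<and> (f y < g y \<longrightarrow> f y < w y \<and> w y < g y \<and> smooth_at w y)
       \<and> semiconcave_at w y \<and> semiconcave_at (\<lambda>x. - w x) y"
proof (cases "f x0 = g x0")
  case False
  then have lt: "f x0 < g x0" using assms(5)[OF assms(4)] by simp
  define t where "t = (f x0 + g x0) / 2"
  have "(f \<longlongrightarrow> f x0) (nhds x0)"
    using isCont_tendsto_nhds[OF isCont_minus[OF semiconcave_at_isCont[OF assms(1)]]] by simp
  moreover have "(g \<longlongrightarrow> g x0) (nhds x0)"
    using isCont_tendsto_nhds[OF semiconcave_at_isCont[OF assms(2)]] .
  moreover have "f x0 < t" "t < g x0" using lt unfolding t_def by auto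
  ultimately have "eventually (\<lambda>x. f x < t) (nhds x0)" "eventually (\<lambda>x. t < g x) (nhds x0)"
    by (auto intro: order_tendstoD)
  then have "eventually (\<lambda>x. f x < t \<and> t < g x) (nhds x0)" by (rule eventually_conj)
  then obtain r where r: "0 < r" "\<And>x. dist x x0 < r \<Longrightarrow> f x < t \<and> t < g x"
    unfolding eventually_nhds_metric by blast
  obtain r' where r': "0 < r'" "ball x0 r' \<subseteq> V" using assms(3,4) by (meson open_contains_ball)
  show thesis
  proof (rule that[of "min r r'" "\<lambda>_. t"])
    fix y assume "y \<in> ball x0 (min r r')"
    then have "f y < t" "t < g y" using r(2)[of y] by (auto simp: dist_commute)
    then show "f y \<le> t \<and> t \<le> g y \<and> (f y < g y \<longrightarrow> f y < t \<and> t < g y \<and> smooth_at (\<lambda>_. t) y)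
       \<and> semiconcave_at (\<lambda>_. t) y \<and> semiconcave_at (\<lambda>x. - t) y"
      by (auto intro: smooth_at_const semiconcave_at_smooth)
  qed (use r r' in auto)
next
  case True
  obtain R1 K1 where R1: "0 < R1" "R1 \<le> 1" "ball x0 R1 \<subseteq> V" "1 \<le> K1"
    and 1: "\<And>x. x \<in> ball x0 R1 \<Longrightarrow> \<exists>p. norm p \<le> K1 \<and>
     (\<forall>y\<in>ball x0 R1. - f y \<le> - f x + p \<bullet> (y - x) + K1 * (norm (y - x))\<^sup>2)"
    by (rule semiconcave_atE[OF assms(1,3,4)]) (rule that)
  have "x0 \<in> ball x0 R1" using R1 by simp
  then obtain R K2 where R: "0 < R" "R \<le> 1" "ball x0 R \<subseteq> ball x0 R1" "1 \<le> K2"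
    and 2: "\<And>x. x \<in> ball x0 R \<Longrightarrow> touched_above g (ball x0 R) K2 x"
    by (rule semiconcave_atE[OF assms(2) open_ball]) (rule that)
  define K where "K = max K1 K2"
  have K1: "K1 * t\<^sup>2 \<le> K * t\<^sup>2" and K2: "K2 * t\<^sup>2 \<le> K * t\<^sup>2" for t :: real
    unfolding K_def by (auto intro: mult_right_mono)
  have "\<exists>p. norm p \<le> K \<and> (\<forall>y\<in>ball x0 R. f x + p \<bullet> (y - x) - K * (norm (y - x))\<^sup>2 \<le> f y)"
    if x: "x \<in> ball x0 R" for x
  proof -
    obtain p where p: "norm p \<le> K1" "\<And>y. y \<in> ball x0 R1 \<Longrightarrow> - f y \<le> - f x + p \<bullet> (y - x) + K1 * (norm (y - x))\<^sup>2"
      using 1[of x] x R(3) by blast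
    show ?thesis
    proof (intro exI[of _ "- p"] conjI ballI)
      show "norm (- p) \<le> K" using p(1) unfolding K_def by simp
      fix y assume "y \<in> ball x0 R"
      then have "y \<in> ball x0 R1" using R(3) by blast
      from p(2)[OF this] show "f x + (- p) \<bullet> (y - x) - K * (norm (y - x))\<^sup>2 \<le> f y"
        using K1[of "norm (y - x)"] by simp
    qed
  qed
  then obtain p where p: "\<And>x. x \<in> ball x0 R \<Longrightarrow> norm (p x) \<le> K"
    "\<And>x y. x \<in> ball x0 R \<Longrightarrow> y \<in> ball x0 R \<Longrightarrow> f x + p x \<bullet> (y - x) - K * (norm (y - x))\<^sup>2 \<le> f y" by metis
  have "\<exists>q. \<forall>y\<in>ball x0 R. g y \<le> g x + q \<bullet> (y - x) + K * (norm (y - x))\<^sup>2"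
    if x: "x \<in> ball x0 R" for x
    using 2[OF x] K2 by (meson add_left_mono order_trans)
  then obtain q where q:
    "\<And>x y. x \<in> ball x0 R \<Longrightarrow> y \<in> ball x0 R \<Longrightarrow> g y \<le> g x + q x \<bullet> (y - x) + K * (norm (y - x))\<^sup>2" by metis
  have "isCont (\<lambda>x. sqrt (g x - f x)) x0"
    using isCont_minus[OF semiconcave_at_isCont[OF assms(1)]] semiconcave_at_isCont[OF assms(2)]
    by (intro continuous_intros) auto
  from isCont_tendsto_nhds[OF this] have "((\<lambda>x. sqrt (g x - f x)) \<longlongrightarrow> 0) (nhds x0)"
    using True by simp
  then have "eventually (\<lambda>x. sqrt (g x - f x) < R / 8) (nhds x0)"
    using R(1) by (intro order_tendstoD) auto
  then obtain r where r: "0 < r" "\<And>x. dist x x0 < r \<Longrightarrow> sqrt (g x - f x) < R / 8"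
    unfolding eventually_nhds_metric by blast
  define e where "e = min r (R / 8)"
  interpret squeezed_pair f g x0 R e K "real DIM('a)" p q
  proof
    show "0 < e" "e \<le> R / 8" "1 \<le> K" unfolding e_def K_def using r R by auto
    show "f x \<le> g x" if "x \<in> ball x0 R" for x using assms(5)[of x] that R R1 by blast
    show "sqrt (g x - f x) \<le> R / 8" if "x \<in> ball x0 e" for x
      using r(2)[of x] that unfolding e_def by (simp add: dist_commute)
  qed (use p q True in auto)
  obtain C where C: "0 \<le> C" "\<And>x. x \<in> ball x0 (e / 2) \<Longrightarrow> touched_both blend (ball x0 (e / 2)) C x"
    by (rule blend_expansion) (rule that)
  have e2: "0 < e / 2" using e(1) by simp
  show thesis
  proof (rule that[of "e / 2" blend])
    show "0 < e / 2" using e(1) by simp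
    show "ball x0 (e / 2) \<subseteq> V" using half_ball small_ball R(3) R1(3) by blast
    show "f y \<le> blend y \<and> blend y \<le> g y \<and> (f y < g y \<longrightarrow> f y < blend y \<and> blend y < g y \<and> smooth_at blend y)
       \<and> semiconcave_at blend y \<and> semiconcave_at (\<lambda>x. - blend x) y" if y: "y \<in> ball x0 (e / 2)" for y
      using blend_between[OF y] smooth_at_blend[OF y] semiconcave_at_from_expansion[OF e2 y C(2)] by blast
  qed
qed

section \<open>Insertion on a manifold\<close>

lemma chartD:
  assumes "is_chart K"
  shows "open (fst K)" "open (chart_image K)" "continuous_on (fst K) (snd K)"
    "continuous_on (chart_image K) (inv_chart K)"
    "p \<in> fst K \<Longrightarrow> inv_chart K (snd K p) = p" "p \<in> fst K \<Longrightarrow> snd K p \<in> chart_image K"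
    "x \<in> chart_image K \<Longrightarrow> inv_chart K x \<in> fst K" "x \<in> chart_image K \<Longrightarrow> snd K (inv_chart K x) = x"
  using assms unfolding is_chart_def homeomorphism_def chart_image_def by auto

lemma open_chart_preimage:
  assumes "is_chart K" "open U" shows "open (chart_image K \<inter> inv_chart K -` U)"
  using continuous_open_preimage[OF chartD(4,2)[OF assms(1)] assms(2)] .

lemma open_chart_pullback:
  assumes "is_chart K" "open T" shows "open (fst K \<inter> snd K -` T)"
  using continuous_open_preimage[OF chartD(3,1)[OF assms(1)] assms(2)] .

text \<open>
  With the second part, a function read in the chart \<open>K\<close> is, near the point, its reading in \<open>L\<close> composed
  with the transition map.
\<close>

lemma transition_smooth_at:
  assumes "is_chart K" "is_chart L" "smooth_transition K L" "p \<in> fst K" "p \<in> fst L"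
  shows "smooth_at (\<lambda>x. snd L (inv_chart K x)) (snd K p)"
    "\<exists>N. open N \<and> snd K p \<in> N \<and> (\<forall>x\<in>N. inv_chart L (snd L (inv_chart K x)) = inv_chart K x)"
proof -
  let ?N = "chart_image K \<inter> inv_chart K -` fst L"
  have N: "open ?N" using open_chart_preimage[OF assms(1) chartD(1)[OF assms(2)]] .
  have eq: "snd K ` (fst K \<inter> fst L) = ?N"
  proof (intro set_eqI iffI)
    fix x assume "x \<in> ?N"
    then show "x \<in> snd K ` (fst K \<inter> fst L)"
      using chartD(7,8)[OF assms(1), of x] by (intro image_eqI[of _ _ "inv_chart K x"]) auto
  qed (auto simp: chartD[OF assms(1)])
  have p: "snd K p \<in> ?N" using chartD(5,6)[OF assms(1)] assms(4,5) by auto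
  have "smooth_on ?N (snd L \<circ> inv_chart K)" using assms(3) unfolding smooth_transition_def eq .
  then show "smooth_at (\<lambda>x. snd L (inv_chart K x)) (snd K p)"
    unfolding smooth_on_iff_smooth_at[OF N] o_def using p by blast
  show "\<exists>N. open N \<and> snd K p \<in> N \<and> (\<forall>x\<in>N. inv_chart L (snd L (inv_chart K x)) = inv_chart K x)"
    using N p chartD(5)[OF assms(2)] by (intro exI[of _ ?N]) auto
qed

lemma smooth_at_change_chart:
  assumes "is_chart K" "is_chart L" "smooth_transition K L" "p \<in> fst K" "p \<in> fst L"
    and "smooth_at (F \<circ> inv_chart L) (snd L p)"
  shows "smooth_at (F \<circ> inv_chart K) (snd K p)"
proof -
  obtain N where N: "open N" "snd K p \<in> N" "\<forall>x\<in>N. inv_chart L (snd L (inv_chart K x)) = inv_chart K x"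
    using transition_smooth_at(2)[OF assms(1-5)] by blast
  have "smooth_at (F \<circ> inv_chart L) (snd L (inv_chart K (snd K p)))"
    using assms(6) chartD(5)[OF assms(1,4)] by simp
  from smooth_at_compose[OF this transition_smooth_at(1)[OF assms(1-5)]]
  show ?thesis by (rule smooth_at_cong[OF _ N(1,2)]) (use N(3) in simp)
qed

lemma semiconcave_at_change_chart:
  assumes "is_chart K" "is_chart L" "smooth_transition K L" "p \<in> fst K" "p \<in> fst L"
    and "semiconcave_at (F \<circ> inv_chart L) (snd L p)"
  shows "semiconcave_at (F \<circ> inv_chart K) (snd K p)"
proof -
  obtain N where N: "open N" "snd K p \<in> N" "\<forall>x\<in>N. inv_chart L (snd L (inv_chart K x)) = inv_chart K x"
    using transition_smooth_at(2)[OF assms(1-5)] by blast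
  have "semiconcave_at (F \<circ> inv_chart L) (snd L (inv_chart K (snd K p)))"
    using assms(6) chartD(5)[OF assms(1,4)] by simp
  from semiconcave_at_smooth_comp[OF this transition_smooth_at(1)[OF assms(1-5)]]
  show ?thesis by (rule semiconcave_at_cong[OF _ N(1,2)]) (use N(3) in simp)
qed

locale atlas =
  fixes A :: "('m::{t2_space, second_countable_topology}, 'e::euclidean_space) chart set"
  assumes smooth_atlas: "smooth_atlas A"
begin

lemma chart: "K \<in> A \<Longrightarrow> is_chart K"
  using smooth_atlas unfolding smooth_atlas_def by blast

lemma transition: "K \<in> A \<Longrightarrow> L \<in> A \<Longrightarrow> smooth_transition K L"
  using smooth_atlas unfolding smooth_atlas_def by blast

lemma chart_around: obtains K where "K \<in> A" "p \<in> fst K"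
  using smooth_atlas unfolding smooth_atlas_def by blast

text \<open>
  By invariance under changes of charts it does not matter which chart is used.
\<close>

definition "msmooth_at F p \<longleftrightarrow> (\<exists>K\<in>A. p \<in> fst K \<and> smooth_at (F \<circ> inv_chart K) (snd K p))"

definition "msemiconcave_at F p \<longleftrightarrow> (\<exists>K\<in>A. p \<in> fst K \<and> semiconcave_at (F \<circ> inv_chart K) (snd K p))"

lemma msmooth_atD:
  assumes "msmooth_at F p" "K \<in> A" "p \<in> fst K"
  shows "smooth_at (F \<circ> inv_chart K) (snd K p)"
proof -
  obtain L where "L \<in> A" "p \<in> fst L" "smooth_at (F \<circ> inv_chart L) (snd L p)"
    using assms(1) unfolding msmooth_at_def by blast
  then show ?thesis using smooth_at_change_chart[of K L p F] chart transition assms by blast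
qed

lemma msemiconcave_atD:
  assumes "msemiconcave_at F p" "K \<in> A" "p \<in> fst K"
  shows "semiconcave_at (F \<circ> inv_chart K) (snd K p)"
proof -
  obtain L where "L \<in> A" "p \<in> fst L" "semiconcave_at (F \<circ> inv_chart L) (snd L p)"
    using assms(1) unfolding msemiconcave_at_def by blast
  then show ?thesis using semiconcave_at_change_chart[of K L p F] chart transition assms by blast
qed

lemma msmooth_at_cong:
  assumes "msmooth_at F p" "open U" "p \<in> U" "\<And>q. q \<in> U \<Longrightarrow> F q = G q"
  shows "msmooth_at G p"
proof -
  obtain K where K: "K \<in> A" "p \<in> fst K" "smooth_at (F \<circ> inv_chart K) (snd K p)"
    using assms(1) unfolding msmooth_at_def by blast
  have "smooth_at (G \<circ> inv_chart K) (snd K p)"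
    using K(3) open_chart_preimage[OF chart[OF K(1)] assms(2)]
    by (rule smooth_at_cong) (use K assms chartD(5,6)[OF chart[OF K(1)] K(2)] in auto)
  then show ?thesis unfolding msmooth_at_def using K by blast
qed

lemma msemiconcave_at_cong:
  assumes "msemiconcave_at F p" "open U" "p \<in> U" "\<And>q. q \<in> U \<Longrightarrow> F q = G q"
  shows "msemiconcave_at G p"
proof -
  obtain K where K: "K \<in> A" "p \<in> fst K" "semiconcave_at (F \<circ> inv_chart K) (snd K p)"
    using assms(1) unfolding msemiconcave_at_def by blast
  have "semiconcave_at (G \<circ> inv_chart K) (snd K p)"
    using K(3) open_chart_preimage[OF chart[OF K(1)] assms(2)]
    by (rule semiconcave_at_cong) (use K assms chartD(5,6)[OF chart[OF K(1)] K(2)] in auto)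
  then show ?thesis unfolding msemiconcave_at_def using K by blast
qed

lemma msmooth_at_const: "msmooth_at (\<lambda>_. t) p"
proof -
  obtain K where "K \<in> A" "p \<in> fst K" using chart_around .
  then show ?thesis unfolding msmooth_at_def o_def using smooth_at_const by blast
qed

lemma msmooth_at_add:
  assumes "msmooth_at F p" "msmooth_at G p" shows "msmooth_at (\<lambda>q. F q + G q :: real) p"
proof -
  obtain K where K: "K \<in> A" "p \<in> fst K" using chart_around .
  from smooth_at_add[OF msmooth_atD[OF assms(1) K] msmooth_atD[OF assms(2) K]]
  show ?thesis unfolding msmooth_at_def o_def using K by blast
qed

lemma msmooth_at_mult:
  assumes "msmooth_at F p" "msmooth_at G p" shows "msmooth_at (\<lambda>q. F q * G q :: real) p"
proof -
  obtain K where K: "K \<in> A" "p \<in> fst K" using chart_around .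
  from smooth_at_mult[OF msmooth_atD[OF assms(1) K] msmooth_atD[OF assms(2) K]]
  show ?thesis unfolding msmooth_at_def o_def using K by blast
qed

lemma msmooth_at_one_minus:
  assumes "msmooth_at F p" shows "msmooth_at (\<lambda>q. 1 - F q :: real) p"
  using msmooth_at_add[OF msmooth_at_const[of 1] msmooth_at_mult[OF msmooth_at_const[of "-1"] assms]] by simp

lemma msmooth_at_sum:
  assumes "\<And>i. i \<in> J \<Longrightarrow> msmooth_at (F i) p" shows "msmooth_at (\<lambda>q. \<Sum>i\<in>J. F i q :: real) p"
  using assms
proof (induction J rule: infinite_finite_induct)
  case (insert i J)
  then show ?case using msmooth_at_add[of "F i" p "\<lambda>q. \<Sum>i\<in>J. F i q"] by simp
qed (simp_all add: msmooth_at_const)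

lemma msmooth_at_prod:
  assumes "\<And>i. i \<in> J \<Longrightarrow> msmooth_at (F i) p" shows "msmooth_at (\<lambda>q. \<Prod>i\<in>J. F i q :: real) p"
  using assms
proof (induction J rule: infinite_finite_induct)
  case (insert i J)
  then show ?case using msmooth_at_mult[of "F i" p "\<lambda>q. \<Prod>i\<in>J. F i q"] by simp
qed (simp_all add: msmooth_at_const)

lemma msemiconcave_at_smooth:
  assumes "msmooth_at F p" shows "msemiconcave_at F p"
proof -
  obtain K where K: "K \<in> A" "p \<in> fst K" using chart_around .
  from semiconcave_at_smooth[OF msmooth_atD[OF assms K]] show ?thesis
    unfolding msemiconcave_at_def using K by blast
qed

lemma msemiconcave_at_add:
  assumes "msemiconcave_at F p" "msemiconcave_at G p" shows "msemiconcave_at (\<lambda>q. F q + G q) p"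
proof -
  obtain K where K: "K \<in> A" "p \<in> fst K" using chart_around .
  from semiconcave_at_add[OF msemiconcave_atD[OF assms(1) K] msemiconcave_atD[OF assms(2) K]]
  show ?thesis unfolding msemiconcave_at_def o_def using K by blast
qed

lemma msemiconcave_at_sum:
  assumes "\<And>i. i \<in> J \<Longrightarrow> msemiconcave_at (F i) p" shows "msemiconcave_at (\<lambda>q. \<Sum>i\<in>J. F i q) p"
  using assms
proof (induction J rule: infinite_finite_induct)
  case (insert i J)
  then show ?case using msemiconcave_at_add[of "F i" p "\<lambda>q. \<Sum>i\<in>J. F i q"] by simp
qed (simp_all add: msemiconcave_at_smooth msmooth_at_const)

lemma msemiconcave_at_smooth_mult:
  assumes "msmooth_at \<psi> p" "msemiconcave_at F p" "\<And>q. 0 \<le> \<psi> q"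
  shows "msemiconcave_at (\<lambda>q. \<psi> q * F q) p"
proof -
  obtain K where K: "K \<in> A" "p \<in> fst K" using chart_around .
  have "\<And>x. 0 \<le> (\<psi> \<circ> inv_chart K) x" using assms(3) by simp
  from semiconcave_at_smooth_mult[OF msemiconcave_atD[OF assms(2) K] msmooth_atD[OF assms(1) K] this]
  show ?thesis unfolding msemiconcave_at_def o_def using K by blast
qed

lemma msemiconcave_at_isCont:
  assumes "msemiconcave_at F p" shows "isCont F p"
proof -
  obtain K where K: "K \<in> A" "p \<in> fst K" using chart_around .
  note c = chart[OF K(1)]
  have "isCont (snd K) p"
    using chartD(1,3)[OF c] K(2) continuous_on_eq_continuous_at by blast
  from continuous_at_compose[OF this semiconcave_at_isCont[OF msemiconcave_atD[OF assms K]]]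
  have cont: "isCont (\<lambda>q. F (inv_chart K (snd K q))) p" by (simp add: o_def)
  have ev: "eventually (\<lambda>q. F (inv_chart K (snd K q)) = F q) (nhds p)"
    using eventually_nhds_in_open[OF chartD(1)[OF c] K(2)]
    by (rule eventually_mono) (simp add: chartD(5)[OF c])
  show ?thesis using cont unfolding isCont_cong[OF ev] .
qed

lemma locally_semiconcaveD:
  assumes "locally_semiconcave A F" shows "msemiconcave_at F p"
proof -
  from assms obtain K where K: "K \<in> maximal_atlas A" "p \<in> fst K"
    and "\<exists>h s. concave_on (chart_image K) h \<and> smooth_on (chart_image K) s \<and>
               (\<forall>x\<in>chart_image K. F (inv_chart K x) = h x + s x)"
    unfolding locally_semiconcave_def by (elim allE[of _ p] bexE conjE)
  then obtain h s where h: "concave_on (chart_image K) h" and s: "smooth_on (chart_image K) s"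
    and F: "\<forall>x\<in>chart_image K. F (inv_chart K x) = h x + s x" by (elim exE conjE)
  obtain L where L: "L \<in> A" "p \<in> fst L" using chart_around .
  have cK: "is_chart K" and LK: "smooth_transition L K" using K(1) L(1) unfolding maximal_atlas_def by auto
  have op: "open (chart_image K)" and p: "snd K p \<in> chart_image K" using chartD[OF cK] K(2) by auto
  have "smooth_at s (snd K p)" using smooth_on_iff_smooth_at[OF op] s p by blast
  from semiconcave_at_add[OF semiconcave_at_concave[OF op h p] semiconcave_at_smooth[OF this]]
  have "semiconcave_at (F \<circ> inv_chart K) (snd K p)"
    by (rule semiconcave_at_cong[OF _ op p]) (simp add: F)
  from semiconcave_at_change_chart[OF chart[OF L(1)] cK LK L(2) K(2) this]
  show ?thesis unfolding msemiconcave_at_def using L by blast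
qed

lemma mfd_smooth_onI:
  assumes "\<And>p. p \<in> W \<Longrightarrow> msmooth_at F p" shows "mfd_smooth_on A W F"
  unfolding mfd_smooth_on_def
proof (intro ballI)
  fix K p assume K: "K \<in> A" and p: "p \<in> fst K \<inter> W"
  obtain S where S: "open S" "snd K p \<in> S" "smooth_on S (F \<circ> inv_chart K)"
    using msmooth_atD[OF assms K] p unfolding smooth_at_def by blast
  let ?N = "S \<inter> chart_image K"
  have "open ?N" "snd K p \<in> ?N" using S chartD(2,6)[OF chart[OF K]] p by auto
  moreover have "smooth_on ?N (F \<circ> inv_chart K)" using smooth_on_subset[OF S(3)] by blast
  ultimately show "\<exists>N. open N \<and> snd K p \<in> N \<and> N \<subseteq> chart_image K \<and> smooth_on N (F \<circ> inv_chart K)"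
    by blast
qed

lemma mfd_locally_C11I:
  assumes "\<And>p. msemiconcave_at F p" "\<And>p. msemiconcave_at (\<lambda>q. - F q) p"
  shows "mfd_locally_C11 A F"
  unfolding mfd_locally_C11_def
proof
  fix K assume K: "K \<in> A"
  note c = chart[OF K]
  show "locally_C11_on (chart_image K) (F \<circ> inv_chart K)"
  proof (rule locally_C11_onI[OF chartD(2)[OF c]])
    fix x assume "x \<in> chart_image K"
    then have x: "inv_chart K x \<in> fst K" "snd K (inv_chart K x) = x" using chartD(7,8)[OF c] by auto
    show "semiconcave_at (F \<circ> inv_chart K) x" using msemiconcave_atD[OF assms(1) K x(1)] x(2) by simp
    show "semiconcave_at (\<lambda>x. - (F \<circ> inv_chart K) x) x"
      using msemiconcave_atD[OF assms(2) K x(1)] x(2) by (simp add: o_def)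
  qed
qed

text \<open>
  The bump vanishes off a closed set, not only off \<open>V\<close>, so that its product with a function that is
  regular in \<open>V\<close> only is regular everywhere. Closedness of the compact set \<open>C\<close> is where the Hausdorff
  property enters.
\<close>

lemma bump_function:
  assumes "open V" "p \<in> V"
  obtains \<beta> W C where "open W" "p \<in> W" "closed C" "C \<subseteq> V" "\<And>q. 0 \<le> \<beta> q \<and> \<beta> q \<le> (1::real)"
    "\<And>q. q \<in> W \<Longrightarrow> \<beta> q = 1" "\<And>q. q \<notin> C \<Longrightarrow> \<beta> q = 0" "\<And>q. msmooth_at \<beta> q"
proof -
  obtain K where K: "K \<in> A" "p \<in> fst K" using chart_around .
  note c = chart[OF K(1)]
  define x0 where "x0 = snd K p"
  have "open (chart_image K \<inter> inv_chart K -` V)" by (rule open_chart_preimage[OF c assms(1)])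
  moreover have "x0 \<in> chart_image K \<inter> inv_chart K -` V"
    unfolding x0_def using chartD(5,6)[OF c K(2)] assms(2) by auto
  ultimately obtain r' where r': "0 < r'" "cball x0 r' \<subseteq> chart_image K \<inter> inv_chart K -` V"
    by (meson open_contains_cball)
  define r where "r = r' / 2"
  have r: "0 < r" "cball x0 (2 * r) \<subseteq> chart_image K \<inter> inv_chart K -` V" unfolding r_def using r' by auto
  define C where "C = inv_chart K ` cball x0 (2 * r)"
  define W where "W = fst K \<inter> snd K -` ball x0 r"
  define \<beta> where "\<beta> q = (if q \<in> fst K then bump r (snd K q - x0) else 0)" for q
  have "continuous_on (cball x0 (2 * r)) (inv_chart K)" using chartD(4)[OF c] r(2) continuous_on_subset by blast
  then have clC: "closed C" unfolding C_def by (intro compact_imp_closed compact_continuous_image) auto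
  have zero: "\<beta> q = 0" if q: "q \<notin> C" for q
  proof (cases "q \<in> fst K")
    case True
    have "snd K q \<notin> cball x0 (2 * r)"
    proof
      assume "snd K q \<in> cball x0 (2 * r)"
      then have "inv_chart K (snd K q) \<in> C" unfolding C_def by blast
      then show False using chartD(5)[OF c True] q by simp
    qed
    then have "2 * r \<le> norm (snd K q - x0)" by (simp add: dist_norm norm_minus_commute)
    then show ?thesis unfolding \<beta>_def using bump_eq_0[OF _ r(1)] by auto
  qed (simp add: \<beta>_def)
  have smooth: "msmooth_at \<beta> q" for q
  proof (cases "q \<in> fst K")
    case True
    have "smooth_at (\<lambda>x. x - x0) (snd K q)"
      using smooth_at_add[OF smooth_at_bounded_linear[OF bounded_linear_ident] smooth_at_const[of "- x0"]] by simp
    from smooth_at_compose[OF smooth_at_bump this]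
    have "smooth_at (\<lambda>x. bump r (x - x0)) (snd K q)" .
    then have "smooth_at (\<beta> \<circ> inv_chart K) (snd K q)"
      by (rule smooth_at_cong[OF _ chartD(2,6)[OF c]]) (use True chartD(7,8)[OF c] in \<open>auto simp: \<beta>_def\<close>)
    then show ?thesis unfolding msmooth_at_def using True K by blast
  next
    case False
    then have "q \<notin> C" unfolding C_def using r(2) chartD(7)[OF c] by blast
    then show ?thesis
      by (intro msmooth_at_cong[OF msmooth_at_const[of 0], of "- C"]) (use clC zero in auto)
  qed
  show thesis
  proof (rule that[of W C \<beta>])
    show "open W" unfolding W_def by (intro open_chart_pullback c open_ball)
    show "p \<in> W" unfolding W_def using K r by (simp add: x0_def)
    show "C \<subseteq> V" unfolding C_def using r(2) by blast
    show "0 \<le> \<beta> q \<and> \<beta> q \<le> 1" for q unfolding \<beta>_def using bump_range by auto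
    show "\<beta> q = 1" if "q \<in> W" for q
      unfolding \<beta>_def using that r(1) by (auto simp: W_def dist_norm norm_minus_commute intro!: bump_eq_1)
  qed (use clC zero smooth in auto)
qed

definition "good_insertion f g w q \<longleftrightarrow> f q \<le> w q \<and> w q \<le> g q \<and>
  (f q < g q \<longrightarrow> f q < w q \<and> w q < g q \<and> msmooth_at w q) \<and>
  msemiconcave_at w q \<and> msemiconcave_at (\<lambda>z. - w z) q"

lemma chartwise_insertion:
  assumes "msemiconcave_at (\<lambda>q. - f q) p" "msemiconcave_at g p" "\<And>q. f q \<le> g q"
  obtains V w where "open V" "p \<in> V" "\<And>q. q \<in> V \<Longrightarrow> good_insertion f g w q"
proof -
  obtain K where K: "K \<in> A" "p \<in> fst K" using chart_around .
  note c = chart[OF K(1)]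
  have sf: "semiconcave_at (\<lambda>x. - (f \<circ> inv_chart K) x) (snd K p)"
    using msemiconcave_atD[OF assms(1) K] by (simp add: o_def)
  have sg: "semiconcave_at (g \<circ> inv_chart K) (snd K p)" using msemiconcave_atD[OF assms(2) K] .
  have le: "\<And>x. (f \<circ> inv_chart K) x \<le> (g \<circ> inv_chart K) x" using assms(3) by simp
  obtain r w where r: "0 < r" "ball (snd K p) r \<subseteq> chart_image K"
    and w: "\<And>y. y \<in> ball (snd K p) r \<Longrightarrow> (f \<circ> inv_chart K) y \<le> w y \<and> w y \<le> (g \<circ> inv_chart K) y \<and>
      ((f \<circ> inv_chart K) y < (g \<circ> inv_chart K) y \<longrightarrow>
         (f \<circ> inv_chart K) y < w y \<and> w y < (g \<circ> inv_chart K) y \<and> smooth_at w y)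
       \<and> semiconcave_at w y \<and> semiconcave_at (\<lambda>x. - w x) y"
    by (rule local_insertion[OF sf sg chartD(2)[OF c] chartD(6)[OF c K(2)] le]) (rule that)
  let ?V = "fst K \<inter> snd K -` ball (snd K p) r"
  show thesis
  proof (rule that[of ?V "\<lambda>q. w (snd K q)"])
    show "open ?V" by (intro open_chart_pullback c open_ball)
    show "p \<in> ?V" using K r by simp
    fix q assume q: "q \<in> ?V"
    then have qK: "q \<in> fst K" and qb: "snd K q \<in> ball (snd K p) r" by auto
    have inv: "inv_chart K (snd K q) = q" using chartD(5)[OF c qK] .
    note wq = w[OF qb, unfolded o_def inv]
    have sc: "semiconcave_at w (snd K q)" "semiconcave_at (\<lambda>x. - w x) (snd K q)"
      and sm: "f q < g q \<Longrightarrow> smooth_at w (snd K q)" using wq by blast+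
    have eq: "w x = ((\<lambda>q. w (snd K q)) \<circ> inv_chart K) x" if "x \<in> chart_image K" for x
      using chartD(8)[OF c that] by simp
    have "msemiconcave_at (\<lambda>q. w (snd K q)) q"
    proof -
      have "semiconcave_at ((\<lambda>q. w (snd K q)) \<circ> inv_chart K) (snd K q)"
        by (rule semiconcave_at_cong[OF sc(1) chartD(2,6)[OF c]]) (use eq qK in auto)
      then show ?thesis unfolding msemiconcave_at_def using K(1) qK by blast
    qed
    moreover have "msemiconcave_at (\<lambda>q. - w (snd K q)) q"
    proof -
      have "semiconcave_at ((\<lambda>q. - w (snd K q)) \<circ> inv_chart K) (snd K q)"
        by (rule semiconcave_at_cong[OF sc(2) chartD(2,6)[OF c]]) (use eq qK in auto)
      then show ?thesis unfolding msemiconcave_at_def using K(1) qK by blast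
    qed
    moreover have "msmooth_at (\<lambda>q. w (snd K q)) q" if "f q < g q"
    proof -
      have "smooth_at ((\<lambda>q. w (snd K q)) \<circ> inv_chart K) (snd K q)"
        by (rule smooth_at_cong[OF sm[OF that] chartD(2,6)[OF c]]) (use eq qK in auto)
      then show ?thesis unfolding msmooth_at_def using K(1) qK by blast
    qed
    ultimately show "good_insertion f g (\<lambda>q. w (snd K q)) q" unfolding good_insertion_def using wq by simp
  qed
qed

lemma partition_sum:
  fixes \<beta> :: "nat \<Rightarrow> real"
  shows "(\<Sum>m<n. \<beta> m * (\<Prod>j<m. 1 - \<beta> j)) = 1 - (\<Prod>j<n. 1 - \<beta> j)"
  by (induction n) (simp_all add: algebra_simps)

text \<open>
  With bumps \<open>\<beta> j\<close> equal to 1 on the members of a countable open cover, the functions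
  \<open>\<beta> m * (\<Prod>j<m. 1 - \<beta> j)\<close> form a partition of unity which is locally finite without any further
  refinement: on the open set where \<open>\<beta> n = 1\<close> all the functions after the \<open>n\<close>-th vanish.
\<close>

theorem insertion:
  assumes "\<And>p. msemiconcave_at (\<lambda>q. - f q) p" "\<And>p. msemiconcave_at g p" "\<And>q. f q \<le> g q"
  obtains w where "\<And>q. good_insertion f g w q"
proof -
  have "\<exists>V u W C \<beta>. p \<in> W \<and> open W \<and> closed C \<and> C \<subseteq> V \<and> (\<forall>q\<in>V. good_insertion f g u q) \<and>
    (\<forall>q. 0 \<le> \<beta> q \<and> \<beta> q \<le> (1::real)) \<and> (\<forall>q\<in>W. \<beta> q = 1) \<and> (\<forall>q. q \<notin> C \<longrightarrow> \<beta> q = 0) \<and> (\<forall>q. msmooth_at \<beta> q)" for p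
  proof -
    obtain V u where V: "open V" "p \<in> V" "\<And>q. q \<in> V \<Longrightarrow> good_insertion f g u q"
      by (rule chartwise_insertion[OF assms(1,2,3)]) (rule that)
    obtain \<beta> W C where "open W" "p \<in> W" "closed C" "C \<subseteq> V" "\<And>q. 0 \<le> \<beta> q \<and> \<beta> q \<le> (1::real)"
      "\<And>q. q \<in> W \<Longrightarrow> \<beta> q = 1" "\<And>q. q \<notin> C \<Longrightarrow> \<beta> q = 0" "\<And>q. msmooth_at \<beta> q"
      by (rule bump_function[OF V(1,2)]) (rule that)
    then show ?thesis using V(3) by (intro exI[of _ V] exI[of _ u] exI[of _ W] exI[of _ C] exI[of _ \<beta>]) simp
  qed
  then obtain V u W C \<beta> where loc: "\<And>p. p \<in> W p" "\<And>p. open (W p)" "\<And>p. closed (C p)" "\<And>p. C p \<subseteq> V p"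
    "\<And>p q. q \<in> V p \<Longrightarrow> good_insertion f g (u p) q" "\<And>p q. 0 \<le> \<beta> p q \<and> \<beta> p q \<le> (1::real)"
    "\<And>p q. q \<in> W p \<Longrightarrow> \<beta> p q = 1" "\<And>p q. q \<notin> C p \<Longrightarrow> \<beta> p q = 0" "\<And>p q. msmooth_at (\<beta> p) q"
    by metis
  obtain D where D: "countable D" "(\<Union>p\<in>D. W p) = UNIV"
  proof -
    obtain F where F: "F \<subseteq> range W" "countable F" "\<Union>F = \<Union>(range W)"
      using Lindelof[of "range W"] loc(2) by blast
    obtain D where "countable D" "F = W ` D"
      using countable_subset_image[of F W UNIV] F by auto
    then show thesis using that[of D] F(3) loc(1) by blast
  qed
  have "D \<noteq> {}" using D(2) by auto
  define c where "c = from_nat_into D"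
  have c: "range c = D" unfolding c_def using range_from_nat_into[OF \<open>D \<noteq> {}\<close> D(1)] .
  define \<psi> where "\<psi> m q = \<beta> (c m) q * (\<Prod>j<m. 1 - \<beta> (c j) q)" for m q
  have psi0: "0 \<le> \<psi> m q" for m q
    unfolding \<psi>_def using loc(6) by (intro mult_nonneg_nonneg prod_nonneg) auto
  have psi_smooth: "msmooth_at (\<psi> m) q" for m q
    unfolding \<psi>_def[abs_def] by (intro msmooth_at_mult msmooth_at_prod msmooth_at_one_minus loc(9))
  have psi_supp: "\<psi> m q = 0" if "q \<notin> C (c m)" for m q unfolding \<psi>_def using loc(8)[OF that] by simp
  have cover: "\<exists>n. q \<in> W (c n)" for q using D(2) c by blast
  have psi_sum: "(\<Sum>m\<le>n. \<psi> m q) = 1" if "q \<in> W (c n)" for n q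
  proof -
    have "(\<Prod>j<Suc n. 1 - \<beta> (c j) q) = 0" using loc(7)[OF that] by (intro prod_zero) auto
    then show ?thesis
      unfolding \<psi>_def lessThan_Suc_atMost[symmetric] partition_sum by simp
  qed
  have psi_late: "\<psi> m q = 0" if "q \<in> W (c n)" "n < m" for m n q
  proof -
    have "(\<Prod>j<m. 1 - \<beta> (c j) q) = 0" using loc(7)[OF that(1)] that(2) by (intro prod_zero) auto
    then show ?thesis unfolding \<psi>_def by simp
  qed
  define N where "N q = (LEAST n. q \<in> W (c n))" for q
  define w where "w q = (\<Sum>m\<le>N q. \<psi> m q * u (c m) q)" for q
  have N: "q \<in> W (c (N q))" for q unfolding N_def using cover by (rule LeastI_ex)
  have w_eq: "w q = (\<Sum>m\<le>n. \<psi> m q * u (c m) q)" if q: "q \<in> W (c n)" for n q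
    unfolding w_def
  proof (rule sum.mono_neutral_left)
    have "N q \<le> n" unfolding N_def using q by (rule Least_le)
    then show "{..N q} \<subseteq> {..n}" by auto
    show "\<forall>i\<in>{..n} - {..N q}. \<psi> i q * u (c i) q = 0" using psi_late[OF N] by auto
  qed auto
  have "good_insertion f g w q" for q
  proof -
    obtain n where n: "q \<in> W (c n)" using cover by blast
    have good: "good_insertion f g (u (c m)) q" if "q \<in> C (c m)" for m
      using loc(4,5) that by blast
    have term_sc: "msemiconcave_at (\<lambda>z. \<psi> m z * u (c m) z) q" for m
    proof (cases "q \<in> C (c m)")
      case True
      then show ?thesis using good unfolding good_insertion_def
        by (intro msemiconcave_at_smooth_mult psi_smooth psi0) auto
    next
      case False
      show ?thesis
        by (rule msemiconcave_at_cong[OF msemiconcave_at_smooth[OF msmooth_at_const[of 0]], of "- C (c m)"])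
           (use False loc(3) psi_supp in auto)
    qed
    have term_sc': "msemiconcave_at (\<lambda>z. \<psi> m z * (- u (c m) z)) q" for m
    proof (cases "q \<in> C (c m)")
      case True
      then show ?thesis using good unfolding good_insertion_def
        by (intro msemiconcave_at_smooth_mult psi_smooth psi0) auto
    next
      case False
      show ?thesis
        by (rule msemiconcave_at_cong[OF msemiconcave_at_smooth[OF msmooth_at_const[of 0]], of "- C (c m)"])
           (use False loc(3) psi_supp in auto)
    qed
    have term_smooth: "msmooth_at (\<lambda>z. \<psi> m z * u (c m) z) q" if "f q < g q" for m
    proof (cases "q \<in> C (c m)")
      case True
      then show ?thesis using good that unfolding good_insertion_def
        by (intro msmooth_at_mult psi_smooth) auto
    next
      case False
      show ?thesis
        by (rule msmooth_at_cong[OF msmooth_at_const[of 0], of "- C (c m)"])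
           (use False loc(3) psi_supp in auto)
    qed
    have sc: "msemiconcave_at w q"
      by (rule msemiconcave_at_cong[OF msemiconcave_at_sum[of "{..n}", OF term_sc] loc(2) n]) (simp add: w_eq)
    have sc': "msemiconcave_at (\<lambda>z. - w z) q"
      by (rule msemiconcave_at_cong[OF msemiconcave_at_sum[of "{..n}", OF term_sc'] loc(2) n])
         (simp add: w_eq sum_negf)
    have sm: "msmooth_at w q" if "f q < g q"
      by (rule msmooth_at_cong[OF msmooth_at_sum[of "{..n}", OF term_smooth[OF that]] loc(2) n]) (simp add: w_eq)
    have const: "t = (\<Sum>m\<le>n. \<psi> m q * t)" for t
      using psi_sum[OF n] by (simp add: sum_distrib_right[symmetric])
    have lo: "\<psi> m q * f q \<le> \<psi> m q * u (c m) q" and hi: "\<psi> m q * u (c m) q \<le> \<psi> m q * g q" for m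
      using good[of m] psi_supp[of q m] psi0[of m q] unfolding good_insertion_def
      by (cases "q \<in> C (c m)"; auto intro: mult_left_mono)+
    have le: "f q \<le> w q" "w q \<le> g q"
      unfolding w_eq[OF n] by (subst const, intro sum_mono lo) (subst (2) const, intro sum_mono hi)
    have lt: "f q < w q \<and> w q < g q" if fg: "f q < g q"
    proof -
      obtain k where k: "k \<le> n" "\<psi> k q \<noteq> 0" using psi_sum[OF n] by (metis atMost_iff sum.neutral zero_neq_one)
      have "q \<in> C (c k)" using psi_supp k by blast
      then have "f q < u (c k) q" "u (c k) q < g q" using good fg unfolding good_insertion_def by auto
      moreover have "0 < \<psi> k q" using psi0[of k q] k by simp
      ultimately have s: "\<psi> k q * f q < \<psi> k q * u (c k) q" "\<psi> k q * u (c k) q < \<psi> k q * g q" by auto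
      have "(\<Sum>m\<le>n. \<psi> m q * f q) < w q" unfolding w_eq[OF n]
        using s(1) k(1) lo by (intro sum_strict_mono_ex1) auto
      moreover have "w q < (\<Sum>m\<le>n. \<psi> m q * g q)" unfolding w_eq[OF n]
        using s(2) k(1) hi by (intro sum_strict_mono_ex1) auto
      ultimately show ?thesis using const by metis
    qed
    show ?thesis unfolding good_insertion_def using le lt sm sc sc' by blast
  qed
  then show thesis using that by blast
qed

end

section \<open>Subsolutions and the Aubry sets\<close>

lemma T_minus_le: "subsolution c u \<Longrightarrow> T_minus c u x \<le> u y + c y x"
  unfolding T_minus_def by (rule cINF_lower[OF subsolution_bdd_below]) auto

lemma T_minus_ge: "(\<And>y. t \<le> u y + c y x) \<Longrightarrow> t \<le> T_minus c u x"
  unfolding T_minus_def by (rule cINF_greatest) auto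

lemma T_plus_ge: "subsolution c u \<Longrightarrow> u y - c x y \<le> T_plus c u x"
  unfolding T_plus_def by (rule cSUP_upper[OF _ subsolution_bdd_above]) auto

lemma T_plus_le: "(\<And>y. u y - c x y \<le> t) \<Longrightarrow> T_plus c u x \<le> t"
  unfolding T_plus_def by (rule cSUP_least) auto

lemma subsolutionD: "subsolution c u \<Longrightarrow> u y - u x \<le> c x y"
  unfolding subsolution_def by blast

lemma le_T_minus: "subsolution c u \<Longrightarrow> u x \<le> T_minus c u x"
  by (rule T_minus_ge) (use subsolutionD[of c u] in \<open>simp add: algebra_simps\<close>)

lemma T_plus_le_self: "subsolution c u \<Longrightarrow> T_plus c u x \<le> u x"
  by (rule T_plus_le) (use subsolutionD[of c u] in \<open>simp add: algebra_simps\<close>)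

lemma T_minus_mono: "subsolution c u \<Longrightarrow> (\<And>y. u y \<le> v y) \<Longrightarrow> T_minus c u x \<le> T_minus c v x"
  by (rule T_minus_ge) (meson T_minus_le add_right_mono order_trans)

lemma T_plus_mono: "subsolution c v \<Longrightarrow> (\<And>y. u y \<le> v y) \<Longrightarrow> T_plus c u x \<le> T_plus c v x"
  by (rule T_plus_le) (meson T_plus_ge diff_right_mono order_trans)

text \<open>
  The value at \<open>y\<close> is compared with \<open>T_minus c u y \<le> u x + c x y\<close> and the value at \<open>x\<close> with \<open>u x\<close>, so
  the two values of \<open>v\<close> are estimated independently of each other.
\<close>

lemma subsolution_above:
  assumes "subsolution c u" "\<And>x. u x \<le> v x" "\<And>x. v x \<le> T_minus c u x"
  shows "subsolution c v"
  unfolding subsolution_def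
proof (intro allI)
  fix x y
  have "v y \<le> u x + c x y" using assms(3)[of y] T_minus_le[OF assms(1), of y x] by linarith
  then show "v y - v x \<le> c x y" using assms(2)[of x] by linarith
qed

lemma subsolution_below:
  assumes "subsolution c u" "\<And>x. T_plus c u x \<le> v x" "\<And>x. v x \<le> u x"
  shows "subsolution c v"
  unfolding subsolution_def
proof (intro allI)
  fix x y
  have "u y - c x y \<le> v x" using assms(2)[of x] T_plus_ge[OF assms(1), of y x] by linarith
  then show "v y - v x \<le> c x y" using assms(3)[of y] by linarith
qed

lemma subsolution_T_minus: "subsolution c u \<Longrightarrow> subsolution c (T_minus c u)"
  by (rule subsolution_above) (auto intro: le_T_minus)

lemma subsolution_T_plus: "subsolution c u \<Longrightarrow> subsolution c (T_plus c u)"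
  by (rule subsolution_below) (auto intro: T_plus_le_self)

lemma T_plus_T_minus_le: "subsolution c u \<Longrightarrow> T_plus c (T_minus c u) x \<le> u x"
  by (rule T_plus_le) (use T_minus_le[of c u] in \<open>simp add: algebra_simps\<close>)

lemma T_minus_T_plus_ge: "subsolution c u \<Longrightarrow> u x \<le> T_minus c (T_plus c u) x"
  by (rule T_minus_ge) (use T_plus_ge[of c u] in \<open>simp add: algebra_simps\<close>)

text \<open>
  Raising a subsolution \<open>u\<close> towards \<open>T_minus c u\<close> does not raise its image under \<open>T_plus\<close> above \<open>u\<close>. This is how
  freeness is gained.
\<close>

lemma T_plus_lt_if_above:
  assumes "subsolution c u" "\<And>y. u y \<le> v y" "\<And>y. v y \<le> T_minus c u y" "u x < v x"
  shows "T_plus c v x < v x"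
proof -
  have "T_plus c v x \<le> T_plus c (T_minus c u) x"
    using T_plus_mono[OF subsolution_T_minus[OF assms(1)] assms(3)] .
  also have "\<dots> \<le> u x" by (rule T_plus_T_minus_le[OF assms(1)])
  finally show ?thesis using assms(4) by linarith
qed

text \<open>
  The sum of the \<open>v n\<close> with weights $2^{-n-1}$: it keeps a fixed fraction of the defect
  \<open>c x y - (v n y - v n x)\<close> of each term, because all defects are nonnegative.
\<close>

lemma weighted_subsolution:
  assumes "\<And>n. subsolution c (v n)"
  obtains u where "\<And>n x y. u y - u x \<le> c x y - (1 / 2) ^ Suc n * (c x y - (v n y - v n x))"
proof -
  fix z
  let ?a = "\<lambda>n. (1 / 2 :: real) ^ Suc n"
  (* Normalizing at z makes the terms bounded in n, since subsolutions satisfy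
     - c x z \<le> v x - v z \<le> c z x. *)
  define u where "u x = (\<Sum>n. ?a n * (v n x - v n z))" for x
  have a: "summable ?a" "suminf ?a = 1" using power_half_series sums_summable sums_unique by force+
  have sm: "summable (\<lambda>n. ?a n * (v n x - v n z))" for x
  proof (rule summable_comparison_test_ev)
    let ?M = "max (c z x) (c x z)"
    show "summable (\<lambda>n. ?a n * ?M)" using a(1) by (rule summable_mult2)
    have "\<bar>v n x - v n z\<bar> \<le> ?M" for n
      using subsolutionD[OF assms, of n x z] subsolutionD[OF assms, of n z x] by linarith
    then show "\<forall>\<^sub>F n in sequentially. norm (?a n * (v n x - v n z)) \<le> ?a n * ?M"
      by (intro always_eventually allI) (simp add: abs_mult mult_left_mono)
  qed
  have diff: "(\<lambda>n. ?a n * (v n y - v n x)) sums (u y - u x)" for x y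
    using sums_diff[OF summable_sums[OF sm[of y]] summable_sums[OF sm[of x]]]
    unfolding u_def[symmetric] by (simp add: right_diff_distrib)
  have "u y - u x \<le> c x y - ?a n * (c x y - (v n y - v n x))" for n x y
  proof -
    let ?s = "\<lambda>n. ?a n * (c x y - (v n y - v n x))"
    have s: "?s sums (1 * c x y - (u y - u x))"
      using sums_diff[OF sums_mult2[OF power_half_series, of "c x y"] diff[of y x]]
      by (simp add: right_diff_distrib)
    have "(\<Sum>k\<in>{n}. ?s k) \<le> suminf ?s"
      using subsolutionD[OF assms] by (intro sum_le_suminf sums_summable[OF s]) auto
    then show ?thesis using sums_unique[OF s] by simp
  qed
  then show thesis using that by blast
qed

lemma T_plus_weighted:
  assumes "subsolution c v" "0 \<le> t" "\<And>x y. u y - u x \<le> c x y - t * (c x y - (v y - v x))"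
  shows "T_plus c u x \<le> u x - t * (v x - T_plus c v x)"
proof (rule T_plus_le)
  fix y
  have "v x - T_plus c v x \<le> c x y - (v y - v x)" using T_plus_ge[OF assms(1), of y x] by linarith
  then have "t * (v x - T_plus c v x) \<le> t * (c x y - (v y - v x))" using assms(2) by (rule mult_left_mono)
  then show "u y - c x y \<le> u x - t * (v x - T_plus c v x)" using assms(3)[of y x] by linarith
qed

text \<open>
  Lindelof's theorem for indexed families.
\<close>

lemma countable_subfamily_cover:
  fixes O' :: "'i \<Rightarrow> 'a::second_countable_topology set"
  assumes "\<And>i. i \<in> S \<Longrightarrow> open (O' i)"
  obtains D where "D \<subseteq> S" "countable D" "(\<Union>i\<in>D. O' i) = (\<Union>i\<in>S. O' i)"
proof -
  have "\<And>U. U \<in> O' ` S \<Longrightarrow> open U" using assms by blast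
  then obtain F where F: "F \<subseteq> O' ` S" "countable F" "\<Union>F = \<Union>(O' ` S)" using Lindelof by metis
  then obtain D where "countable D" "D \<subseteq> S" "F = O' ` D" using countable_subset_image by metis
  then show thesis using that F(3) by metis
qed

text \<open>
  Off the Aubry set some subsolution \<open>w\<close> has \<open>w < T_minus c w\<close> or \<open>T_plus c w < w\<close>, and in either case a
  continuous \<open>v\<close> with \<open>T_plus c v < v\<close> can be built from it. On the Aubry set all subsolutions agree with
  their images under \<open>T_minus\<close>, which are continuous. Lindelof's theorem then selects countably many
  continuous subsolutions, and their weighted sum inherits all the strict inequalities.
\<close>

lemma extremal_subsolution:
  fixes c :: "'m::second_countable_topology cost"
  assumes reg: "\<And>w. subsolution c w \<Longrightarrow> continuous_on UNIV (T_minus c w) \<and> continuous_on UNIV (T_plus c w)"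
    and ex: "\<exists>w. subsolution c w"
  obtains u where "subsolution c u" "\<And>x. x \<notin> Aubry c \<Longrightarrow> T_plus c u x < u x"
    "\<And>x y. x \<in> Aubry c \<Longrightarrow> y \<in> Aubry c \<Longrightarrow> (x, y) \<notin> Aubry2 c \<Longrightarrow> u y - u x < c x y"
proof -
  define S :: "('m \<Rightarrow> real) set" where "S = {v. subsolution c v \<and> continuous_on UNIV v}"
  have free: "\<exists>v\<in>S. T_plus c v x < v x" if x: "x \<notin> Aubry c" for x
  proof -
    obtain w where w: "subsolution c w" "x \<notin> Aubry_of c w" using x unfolding Aubry_def by blast
    then consider "w x < T_minus c w x" | "T_plus c w x < w x"
      using le_T_minus[OF w(1), of x] T_plus_le_self[OF w(1), of x] unfolding Aubry_of_def by fastforce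
    then show ?thesis
    proof cases
      case 1
      then have "T_plus c (T_minus c w) x < T_minus c w x" using T_plus_T_minus_le[OF w(1), of x] by linarith
      then show ?thesis unfolding S_def using subsolution_T_minus[OF w(1)] reg[OF w(1)] by blast
    next
      case 2
      (* T_plus c w may equal its image under T_plus at x; its midpoint with
         T_minus c (T_plus c w) does not. *)
      define v1 where "v1 = T_plus c w"
      define v where "v y = (v1 y + T_minus c v1 y) / 2" for y
      have v1: "subsolution c v1" unfolding v1_def by (rule subsolution_T_plus[OF w(1)])
      have gap: "v1 x < T_minus c v1 x" using 2 T_minus_T_plus_ge[OF w(1), of x] unfolding v1_def by linarith
      have b: "v1 y \<le> v y" "v y \<le> T_minus c v1 y" for y using le_T_minus[OF v1, of y] unfolding v_def by simp_all
      have "continuous_on UNIV v" unfolding v_def using reg[OF w(1)] reg[OF v1]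
        by (auto intro!: continuous_intros simp: v1_def)
      moreover have "subsolution c v" using subsolution_above[OF v1 b] .
      moreover have "v1 x < v x" using gap unfolding v_def by simp
      ultimately show ?thesis unfolding S_def using T_plus_lt_if_above[OF v1 b] by blast
    qed
  qed
  have strict: "\<exists>v\<in>S. v y - v x < c x y"
    if xy: "x \<in> Aubry c" "y \<in> Aubry c" "(x, y) \<notin> Aubry2 c" for x y
  proof -
    obtain w where w: "subsolution c w" "(x, y) \<notin> Aubry2_of c w" using xy unfolding Aubry2_def by blast
    then have "w y - w x < c x y" using subsolutionD[OF w(1), of y x] unfolding Aubry2_of_def by simp
    moreover have "w x = T_minus c w x" "w y = T_minus c w y"
      using xy w(1) unfolding Aubry_def Aubry_of_def by auto
    ultimately show ?thesis unfolding S_def using subsolution_T_minus[OF w(1)] reg[OF w(1)] by auto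
  qed
  have open1: "open {x. T_plus c v x < v x}" if "v \<in> S" for v
    using that reg unfolding S_def by (intro open_Collect_less) auto
  (* The cost need not be semicontinuous, so its values enter as an additional real coordinate:
     the set of all (x, y, t) with v y - v x < t is open. *)
  have open2: "open {z. v (fst (snd z)) - v (fst z) < snd (snd z)}" if "v \<in> S" for v
  proof -
    have v: "continuous_on UNIV v" using that unfolding S_def by blast
    show ?thesis
      by (intro open_Collect_less continuous_intros continuous_on_compose2[OF v]) auto
  qed
  obtain D1 where D1: "D1 \<subseteq> S" "countable D1"
    "(\<Union>v\<in>D1. {x. T_plus c v x < v x}) = (\<Union>v\<in>S. {x. T_plus c v x < v x})"
    using countable_subfamily_cover[of S "\<lambda>v. {x. T_plus c v x < v x}", OF open1] .
  obtain D2 where D2: "D2 \<subseteq> S" "countable D2"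
    "(\<Union>v\<in>D2. {z. v (fst (snd z)) - v (fst z) < snd (snd z)}) =
     (\<Union>v\<in>S. {z. v (fst (snd z)) - v (fst z) < (snd (snd z) :: real)})"
    using countable_subfamily_cover[of S "\<lambda>v. {z. v (fst (snd z)) - v (fst z) < snd (snd z)}", OF open2] .
  obtain w0 where w0: "subsolution c w0" using ex by blast
  have "T_minus c w0 \<in> S" unfolding S_def using subsolution_T_minus[OF w0] reg[OF w0] by blast
  then have D: "insert (T_minus c w0) (D1 \<union> D2) \<subseteq> S" "countable (insert (T_minus c w0) (D1 \<union> D2))"
    using D1 D2 by auto
  define v where "v = from_nat_into (insert (T_minus c w0) (D1 \<union> D2))"
  have range_v: "range v = insert (T_minus c w0) (D1 \<union> D2)"
    unfolding v_def using D(2) by (intro range_from_nat_into) auto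
  then have vS: "v n \<in> S" for n using D(1) by blast
  then have v: "subsolution c (v n)" for n unfolding S_def by blast
  obtain u where u: "\<And>n x y. u y - u x \<le> c x y - (1 / 2) ^ Suc n * (c x y - (v n y - v n x))"
    by (rule weighted_subsolution[OF v]) (rule that)
  have gap: "0 \<le> (1 / 2) ^ Suc n * (c x y - (v n y - v n x))" for n x y
    using subsolutionD[OF v, of n y x] by simp
  show thesis
  proof (rule that[of u])
    have "u y - u x \<le> c x y" for x y using u[of y x 0] gap[of 0 x y] by linarith
    then show "subsolution c u" unfolding subsolution_def by blast
    show "T_plus c u x < u x" if "x \<notin> Aubry c" for x
    proof -
      have "x \<in> (\<Union>v\<in>D1. {x. T_plus c v x < v x})" unfolding D1(3) using free[OF that] by blast
      then obtain v' where v': "v' \<in> D1" "T_plus c v' x < v' x" by blast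
      then obtain n where n: "v' = v n" using range_v by blast
      have "T_plus c u x \<le> u x - (1 / 2) ^ Suc n * (v n x - T_plus c (v n) x)"
        by (rule T_plus_weighted[OF v _ u]) simp
      moreover have "0 < (1 / 2 :: real) ^ Suc n * (v n x - T_plus c (v n) x)" using v'(2) unfolding n by simp
      ultimately show ?thesis by linarith
    qed
    show "u y - u x < c x y" if "x \<in> Aubry c" "y \<in> Aubry c" "(x, y) \<notin> Aubry2 c" for x y
    proof -
      have "(x, y, c x y) \<in> (\<Union>v\<in>D2. {z. v (fst (snd z)) - v (fst z) < snd (snd z)})"
        unfolding D2(3) using strict[OF that] by simp
      then obtain v' where v': "v' \<in> D2" "v' y - v' x < c x y" by auto
      then obtain n where n: "v' = v n" using range_v by blast
      have "0 < (1 / 2 :: real) ^ Suc n * (c x y - (v n y - v n x))" using v'(2) unfolding n by simp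
      then show ?thesis using u[of y x n] by linarith
    qed
  qed
qed

theorem theorem4:
  fixes A :: "('m::{t2_space, second_countable_topology}, 'e::euclidean_space) chart set"
    and g :: "('m, 'e) chart \<Rightarrow> 'm \<Rightarrow> 'e \<Rightarrow> 'e \<Rightarrow> real"
    and c :: "'m \<Rightarrow> 'm \<Rightarrow> real"
  assumes "connected_riemannian_manifold A g"
    and "\<And>w. subsolution c w \<Longrightarrow>
           locally_semiconcave A (T_minus c w) \<and> locally_semiconcave A (\<lambda>x. - T_plus c w x)"
    and "\<exists>w. subsolution c w"
  shows "\<exists>u. subsolution c u \<and> mfd_locally_C11 A u \<and>
             free_on c u (- Aubry c) \<and> mfd_smooth_on A (- Aubry c) u \<and>
             strict_on c u (- Aubry2 c)"
proof -
  interpret atlas A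
    using assms(1) unfolding connected_riemannian_manifold_def by unfold_locales blast
  have sc: "msemiconcave_at (T_minus c w) p" "msemiconcave_at (\<lambda>x. - T_plus c w x) p"
    if "subsolution c w" for w p
    using assms(2)[OF that] locally_semiconcaveD by blast+
  have reg: "continuous_on UNIV (T_minus c w) \<and> continuous_on UNIV (T_plus c w)" if "subsolution c w" for w
  proof -
    have "isCont (T_plus c w) p" for p
      using isCont_minus[OF msemiconcave_at_isCont[OF sc(2)[OF that]]] by simp
    then show ?thesis using msemiconcave_at_isCont[OF sc(1)[OF that]]
      by (simp add: continuous_at_imp_continuous_on)
  qed
  obtain u where u: "subsolution c u" "\<And>x. x \<notin> Aubry c \<Longrightarrow> T_plus c u x < u x"
    "\<And>x y. x \<in> Aubry c \<Longrightarrow> y \<in> Aubry c \<Longrightarrow> (x, y) \<notin> Aubry2 c \<Longrightarrow> u y - u x < c x y"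
    by (rule extremal_subsolution[OF _ assms(3)]) (rule reg, assumption, rule that)
  (* Everything between f and h will be a subsolution. *)
  define f where "f = T_plus c u"
  define h where "h = T_minus c f"
  have f: "subsolution c f" unfolding f_def by (rule subsolution_T_plus[OF u(1)])
  have fh: "f x \<le> h x" for x unfolding h_def by (rule le_T_minus[OF f])
  have uh: "u x \<le> h x" for x unfolding h_def f_def by (rule T_minus_T_plus_ge[OF u(1)])
  have off: "f x < h x" if "x \<notin> Aubry c" for x using u(2)[OF that] uh[of x] unfolding f_def by linarith
  have on: "f x = u x" "h x = u x" if "x \<in> Aubry c" for x
  proof -
    show 1: "f x = u x" using that u(1) unfolding Aubry_def Aubry_of_def f_def by auto
    have "f x = T_minus c f x" using that f unfolding Aubry_def Aubry_of_def by auto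
    then show "h x = u x" using 1 unfolding h_def by simp
  qed
  have "msemiconcave_at (\<lambda>x. - f x) p" "msemiconcave_at h p" for p
    unfolding f_def h_def using sc(2)[OF u(1)] sc(1)[OF f[unfolded f_def]] by auto
  then obtain w where good: "\<And>x. good_insertion f h w x"
    by (rule insertion[OF _ _ fh]) (rule that)
  have w: "f x \<le> w x" "w x \<le> h x" for x using good[of x] unfolding good_insertion_def by auto
  have w_off: "f x < w x" "w x < h x" "msmooth_at w x" if "x \<notin> Aubry c" for x
    using good[of x] off[OF that] unfolding good_insertion_def by auto
  have w_on: "w x = u x" if "x \<in> Aubry c" for x using w[of x] on[OF that] by simp
  have sub: "subsolution c w" using subsolution_above[OF f w(1)] w(2) unfolding h_def by blast
  moreover have "mfd_locally_C11 A w"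
    using good unfolding good_insertion_def by (intro mfd_locally_C11I) auto
  moreover have "free_on c w (- Aubry c)"
    unfolding free_on_def
  proof
    fix x assume "x \<in> - Aubry c"
    then have x: "f x < w x" "w x < h x" using w_off[of x] by auto
    have "T_plus c w x < w x" by (rule T_plus_lt_if_above[OF f w(1) _ x(1)]) (use w(2) in \<open>simp add: h_def\<close>)
    moreover have "h x \<le> T_minus c w x" unfolding h_def by (rule T_minus_mono[OF f w(1)])
    ultimately show "T_plus c w x < w x \<and> w x < T_minus c w x" using x(2) by linarith
  qed
  moreover have "mfd_smooth_on A (- Aubry c) w" using w_off(3) by (intro mfd_smooth_onI) auto
  moreover have "strict_on c w (- Aubry2 c)"
  proof -
    have "w y - w x < c x y" if xy: "(x, y) \<notin> Aubry2 c" for x y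
    proof (cases "x \<in> Aubry c \<and> y \<in> Aubry c")
      case True
      then show ?thesis using u(3)[of x y] xy w_on by simp
    next
      case False
      have "h y \<le> f x + c x y" unfolding h_def by (rule T_minus_le[OF f])
      then show ?thesis using False w[of x] w[of y] w_off(1)[of x] w_off(2)[of y] by linarith
    qed
    then show ?thesis unfolding strict_on_def by auto
  qed
  ultimately show ?thesis by blast
qed

end
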